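(* Let $d\ge1$, $T>0$ and $B\in C^1_b(\mathbb R^d,\mathbb R^d)$, and let $f_0\in L^1(\mathbb R^d)\cap L^2(\mathbb R^d)$. Then the PDE with initial datum $f_0$ has at most one weak solution in the space $\mathcal X$: if $p_1,p_2\in\mathcal X$ are both weak solutions with initial datum $f_0$, then $p_1=p_2$ almost everywhere.
   Context: Notation: write $x=(x^1,\tilde x)\in\mathbb R\times\mathbb R^{d-1}$ and $(m,x)=(m,x^1,\tilde x)\in\mathbb R^{d+1}$; $\mathcal T:=\{(m,x)\in\mathbb R\times\mathbb R^d: m\ge x^1\}$. For $\Phi\in C^2(\mathbb R^{d+1})$, $\mathcal L\Phi(m,x)=\sum_{i=1}^d B^i(x)\partial_{x^i}\Phi(m,x)+\frac12\sum_{i=1}^d\partial^2_{x^ix^i}\Phi(m,x)$. The space $\mathcal X$: the set of real functions $p$ on $]0,T]\times\mathcal T$ such that (a) $\sup_{t\in]0,T]}\int_{\mathbb R^d}\big[\int_{m\ge x^1}|p(m,x;t)|\,dm\big]^2dx<\infty$; (c) for all $t\in]0,T]$, $(m,\tilde x)\mapsto\sup_{u>0}p(m,m-u,\tilde x;t)$ belongs to $L^1(\mathbb R^d)$, and for almost every $(m,\tilde x)$ the map $x^1\mapsto p(m,x^1,\tilde x;t)$ is continuous on $]-\infty,m[$ and $\lim_{u\to0^+}p(m,m-u,\tilde x;t)$ exists, denoted $p(m,m,\tilde x;t)$; (b) $(m,\tilde x;s)\mapsto p(m,m,\tilde x;s)$ belongs to $L^1(]0,T];L^2(\mathbb R^d))$.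 Weak solution with initial datum $f_0$: $p\in\mathcal X$ such that for every $\Phi\in C^2_c(\mathbb R^{d+1})$ and $t\in]0,T]$, $$\int_{\mathcal T}\Phi(m,x)p(m,x;t)\,dm\,dx=\int_{\mathbb R^d}\Phi(m,m,\tilde x)f_0(m,\tilde x)\,dm\,d\tilde x+\int_0^t\!\!\int_{\mathcal T}p(m,x;s)\mathcal L\Phi(m,x)\,dm\,dx\,ds+\frac12\int_0^t\!\!\int_{\mathbb R^d}\frac{\partial\Phi}{\partial m}(m,m,\tilde x)\,p(m,m,\tilde x;s)\,dm\,d\tilde x\,ds,$$ where $\frac{\partial\Phi}{\partial m}(m,m,\tilde x)$ is the derivative of $\Phi$ in its first variable evaluated at $(m,m,\tilde x)$. *)

theory Defs
  imports "HOL-Analysis.Analysis"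
begin

text \<open>Conventions. The space R^d is rendered as real^'d for an arbitrary finite
index type 'd (so d = CARD('d) >= 1), and a distinguished index i1 plays the
role of the first coordinate x^1; the remaining coordinates form x~.
A point (m,x~) of R^d is encoded as the vector y :: real^'d with y$i1 = m and the
other coordinates equal to x~. Thus (m,m,x~) corresponds to (y$i1, y), and
(m, m-u, x~) to (y$i1, setc y i1 (y$i1 - u)).
A point (m,x) of R^{d+1} is a pair of type 'd pt.
Solutions p are written p m x t.\<close>

type_synonym 'd pt = "real \<times> (real^'d)"

definition setc :: "real^('d::finite) \<Rightarrow> 'd \<Rightarrow> real \<Rightarrow> real^'d" where
  "setc y i a = (\<chi> j. if j = i then a else y $ j)"

definition Tdom :: "'d::finite \<Rightarrow> ('d pt) set" where
  "Tdom i1 = {(m, x). x $ i1 \<le> m}"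

definition trace_p :: "'d::finite \<Rightarrow> (real \<Rightarrow> real^'d \<Rightarrow> real \<Rightarrow> real) \<Rightarrow> real^'d \<Rightarrow> real \<Rightarrow> real" where
  "trace_p i1 p y t = Lim (at_right 0) (\<lambda>u. p (y $ i1) (setc y i1 (y $ i1 - u)) t)"

definition C1b :: "(real^('d::finite) \<Rightarrow> real^'d) \<Rightarrow> bool" where
  "C1b B \<longleftrightarrow> bounded (range B) \<and>
     (\<exists>B' :: real^'d \<Rightarrow> ((real^'d) \<Rightarrow>\<^sub>L (real^'d)).
        (\<forall>x. (B has_derivative blinfun_apply (B' x)) (at x)) \<and>
        continuous_on UNIV B' \<and> bounded (range B'))"

definition C2c_with :: "(('d::finite) pt \<Rightarrow> real) \<Rightarrow> ('d pt \<Rightarrow> ('d pt \<Rightarrow>\<^sub>L real))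
     \<Rightarrow> ('d pt \<Rightarrow> ('d pt \<Rightarrow>\<^sub>L ('d pt \<Rightarrow>\<^sub>L real))) \<Rightarrow> bool" where
  "C2c_with \<Phi> \<Phi>' \<Phi>'' \<longleftrightarrow>
     (\<forall>z. (\<Phi> has_derivative blinfun_apply (\<Phi>' z)) (at z)) \<and>
     (\<forall>z. (\<Phi>' has_derivative blinfun_apply (\<Phi>'' z)) (at z)) \<and>
     continuous_on UNIV \<Phi>'' \<and>
     (\<exists>K. compact K \<and> (\<forall>z. z \<notin> K \<longrightarrow> \<Phi> z = 0))"

definition Lop :: "(real^('d::finite) \<Rightarrow> real^'d) \<Rightarrow> ('d pt \<Rightarrow> ('d pt \<Rightarrow>\<^sub>L real))
     \<Rightarrow> ('d pt \<Rightarrow> ('d pt \<Rightarrow>\<^sub>L ('d pt \<Rightarrow>\<^sub>L real))) \<Rightarrow> 'd pt \<Rightarrow> real" where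
  "Lop B \<Phi>' \<Phi>'' z =
     (\<Sum>i\<in>UNIV. B (snd z) $ i * blinfun_apply (\<Phi>' z) (0, axis i 1))
     + 1/2 * (\<Sum>i\<in>UNIV. blinfun_apply (blinfun_apply (\<Phi>'' z) (0, axis i 1)) (0, axis i 1))"

definition dm :: "(('d::finite) pt \<Rightarrow> ('d pt \<Rightarrow>\<^sub>L real)) \<Rightarrow> 'd pt \<Rightarrow> real" where
  "dm \<Phi>' z = blinfun_apply (\<Phi>' z) (1, 0)"

text \<open>The space X (measurability, implicit in the paper, made explicit).\<close>
definition spaceX :: "'d::finite \<Rightarrow> real \<Rightarrow> (real \<Rightarrow> real^'d \<Rightarrow> real \<Rightarrow> real) \<Rightarrow> bool" where
  "spaceX i1 T p \<longleftrightarrow>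
     \<comment> \<open>measurability of p on ]0,T] x T\<close>
     (\<lambda>(m, x, t). if 0 < t \<and> t \<le> T \<and> x $ i1 \<le> m then p m x t else 0)
        \<in> borel_measurable (lborel :: (real \<times> (real^'d) \<times> real) measure) \<and>
     \<comment> \<open>(a)\<close>
     (\<exists>C::real. \<forall>t\<in>{0<..T}.
        (\<integral>\<^sup>+ x. (\<integral>\<^sup>+ m. indicator {x $ i1..} m * ennreal \<bar>p m x t\<bar> \<partial>lborel) ^ 2 \<partial>lborel) \<le> ennreal C) \<and>
     \<comment> \<open>(c)\<close>
     (\<forall>t\<in>{0<..T}.
        (\<lambda>y. SUP u\<in>{0<..}. ereal (p (y $ i1) (setc y i1 (y $ i1 - u)) t))
           \<in> borel_measurable (lborel :: (real^'d) measure) \<and>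
        (\<integral>\<^sup>+ y. e2ennreal \<bar>SUP u\<in>{0<..}. ereal (p (y $ i1) (setc y i1 (y $ i1 - u)) t)\<bar> \<partial>lborel) < \<infinity> \<and>
        (AE y in lborel.
           continuous_on {..<y $ i1} (\<lambda>a. p (y $ i1) (setc y i1 a) t) \<and>
           (\<exists>L. ((\<lambda>u. p (y $ i1) (setc y i1 (y $ i1 - u)) t) \<longlongrightarrow> L) (at_right 0)))) \<and>
     \<comment> \<open>(b): the trace lies in L^1(]0,T]; L^2(R^d))\<close>
     (\<lambda>(y, s). trace_p i1 p y s) \<in> borel_measurable (lborel :: ((real^'d) \<times> real) measure) \<and>
     (AE s in lborel. s \<in> {0<..T} \<longrightarrow> (\<integral>\<^sup>+ y. ennreal ((trace_p i1 p y s)\<^sup>2) \<partial>lborel) < \<infinity>) \<and>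
     (\<integral>\<^sup>+ s. indicator {0<..T} s *
          ennreal (sqrt (enn2real (\<integral>\<^sup>+ y. ennreal ((trace_p i1 p y s)\<^sup>2) \<partial>lborel))) \<partial>lborel) < \<infinity>"

text \<open>Weak solution with initial datum f0 (f0 y stands for f_0(m,x~), y ~ (m,x~)).\<close>
definition weak_solution ::
  "'d \<Rightarrow> real \<Rightarrow> (real^'d \<Rightarrow> real^'d) \<Rightarrow> (real^'d \<Rightarrow> real) \<Rightarrow> (real \<Rightarrow> real^'d \<Rightarrow> real \<Rightarrow> real) \<Rightarrow> bool" where
  "weak_solution i1 T B f0 p \<longleftrightarrow> spaceX i1 T p \<and>
     (\<forall>\<Phi> \<Phi>' \<Phi>'' t. C2c_with \<Phi> \<Phi>' \<Phi>'' \<and> t \<in> {0<..T} \<longrightarrow>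
        set_lebesgue_integral lborel (Tdom i1) (\<lambda>z. \<Phi> z * p (fst z) (snd z) t)
        = (\<integral>y. \<Phi> (y $ i1, y) * f0 y \<partial>lborel)
          + set_lebesgue_integral lborel {0<..t} (\<lambda>s.
               set_lebesgue_integral lborel (Tdom i1) (\<lambda>z. p (fst z) (snd z) s * Lop B \<Phi>' \<Phi>'' z))
          + 1/2 * set_lebesgue_integral lborel {0<..t} (\<lambda>s.
               \<integral>y. dm \<Phi>' (y $ i1, y) * trace_p i1 p y s \<partial>lborel))"

end

theory Submission
  imports Defs
begin

text \<open>
  Fix a level \<open>m0\<close> and put \<open>P(x, t) = \<integral> p(m, x; t) dm\<close> over \<open>x\<^sup>1 \<le> m \<le> m0\<close>, for \<open>p\<close> the difference of two
  solutions. Testing with \<open>\<Phi>(m, x) = g(n (m - m0)) \<phi>(x)\<close>, where \<open>g\<close> is a smooth step from 1 to 0 and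
  \<open>\<phi> = 0\<close> on \<open>x\<^sup>1 = m0\<close>, the trace term disappears as \<open>n \<rightarrow> \<infinity>\<close>, so that \<open>P\<close> is a very weak solution in
  \<open>L\<^sup>2\<close> of the Dirichlet problem for the Fokker-Planck equation on \<open>x\<^sup>1 < m0\<close> with zero initial datum
  (probabilistically, \<open>P\<close> is the density of the process killed at level \<open>m0\<close>).

  Uniqueness for this problem is shown by duality. On a box with side \<open>x\<^sup>1 = m0\<close> let \<open>e\<^sub>k\<close> be the Dirichlet
  eigenfunctions (products of sines). For \<open>F = \<Sum> \<zeta>\<^sub>k(t) e\<^sub>k(x)\<close> solve \<open>\<theta>\<^sub>k' = (\<mu>\<^sub>k + \<lambda>) \<theta>\<^sub>k + \<zeta>\<^sub>k\<close> backwards from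
  \<open>\<theta>\<^sub>k(T) = 0\<close>; by orthogonality \<open>\<Psi> = \<Sum> \<theta>\<^sub>k e\<^sub>k\<close> satisfies \<open>\<parallel>\<Psi>\<parallel>, \<parallel>\<nabla>\<Psi>\<parallel> \<le> \<lambda>\<^sup>-\<^sup>1\<^sup>/\<^sup>2 \<parallel>F\<parallel>\<close>. Testing the equation for
  \<open>P\<close> with \<open>e\<^sup>-\<^sup>\<lambda>\<^sup>t \<chi> \<Psi>\<close>, \<open>\<chi>\<close> a cutoff, leaves only terms with at most one derivative of \<open>\<Psi>\<close>, so
  \<open>\<langle>e\<^sup>-\<^sup>\<lambda>\<^sup>t \<chi> P, F\<rangle>\<close> is bounded by \<open>\<lambda>\<^sup>-\<^sup>1\<^sup>/\<^sup>2\<close> times norms of \<open>e\<^sup>-\<^sup>\<lambda>\<^sup>t P\<close> and \<open>F\<close>. The functions \<open>F\<close> are dense in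
  \<open>L\<^sup>2\<close> (Stone-Weierstrass), and for large \<open>\<lambda>\<close> and growing box this forces \<open>P = 0\<close>. Since \<open>m0\<close> is
  arbitrary, \<open>p = 0\<close> almost everywhere.
\<close>

section \<open>Tensor products and test functions\<close>

text \<open>The obstacle is that \<open>P\<close> is merely \<open>L^2\<close> in space. There it
  costs nothing: \<open>F\<close> is a finite sine sum, hence the dual function is explicit and no
  regularity theory for a parabolic equation with drift is invoked. The price is that the dual
  function solves only the driftless heat equation, so that drift and cutoff leave first-order
  errors. The exponential weight in time is there to beat these: they carry a small factor which
  does not depend on the size of the box, because the derivatives of a rescaled cutoff do not grow
  with it. Only the face \<open>x^1 = m0\<close> of the box is a true boundary. On the other faces
  the cutoff vanishes, so the zeros of the sines there impose nothing on \<open>P\<close>. All test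
  functions are products of functions of one variable. A partial derivative then replaces one
  factor, and integrals over boxes become products, which keeps calculus in several variables to a
  minimum.\<close>

definition tens :: "('d::finite \<Rightarrow> real \<Rightarrow> real) \<Rightarrow> real^'d \<Rightarrow> real" where
  "tens f x = (\<Prod>i\<in>UNIV. f i (x $ i))"

lemma tens_split: "tens f x = f i (x $ i) * (\<Prod>j\<in>UNIV - {i}. f j (x $ j))"
  unfolding tens_def by (simp add: prod.remove)

lemma tens_upd: "tens (f(i := g)) x = g (x $ i) * (\<Prod>j\<in>UNIV - {i}. f j (x $ j))"
proof -
  have "(\<Prod>j\<in>UNIV - {i}. (f(i := g)) j (x $ j)) = (\<Prod>j\<in>UNIV - {i}. f j (x $ j))"
    by (rule prod.cong) auto
  then show ?thesis by (simp add: tens_split[of _ _ i])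
qed

lemma tens_mult: "tens (\<lambda>i s. f i s * g i s) x = tens f x * tens g x"
  by (simp add: tens_def prod.distrib)

lemma borel_measurable_tens:
  assumes "\<And>i. f i \<in> borel_measurable borel"
  shows "tens f \<in> borel_measurable borel"
  unfolding tens_def using assms by measurable

lemma continuous_on_tens:
  assumes "\<And>i. continuous_on UNIV (f i)"
  shows "continuous_on UNIV (tens f)"
  unfolding tens_def
  by (intro continuous_on_prod continuous_on_compose2[OF assms] continuous_intros) auto

lemma abs_tens_le_1:
  assumes "\<And>i s. \<bar>f i s\<bar> \<le> 1" shows "\<bar>tens f x\<bar> \<le> 1"
  unfolding tens_def abs_prod using assms by (intro prod_le_1) auto

text \<open>By \<open>lborel_eq\<close>, Lebesgue measure on \<open>real^'d\<close> is the image of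
  a product measure indexed by \<open>Basis\<close>. The factors are therefore re-indexed from
  coordinates to basis vectors, and the product formula for finite product measures applies.\<close>

lemma integral_tens:
  fixes f :: "'d::finite \<Rightarrow> real \<Rightarrow> real"
  assumes "\<And>i. integrable lborel (f i)"
  shows "integrable lborel (tens f)"
    and "integral\<^sup>L lborel (tens f) = (\<Prod>i\<in>UNIV. integral\<^sup>L lborel (f i))"
proof -
  interpret product_sigma_finite "\<lambda>b::real^'d. lborel :: real measure" by standard
  define F where "F b = f (THE i. b = axis i 1)" for b :: "real^'d"
  have Fax: "F (axis i 1) = f i" for i
  proof -
    have "(THE j. axis i (1::real) = axis j 1) = i"
      by (rule the_equality) (auto simp: axis_eq_axis)
    then show ?thesis by (simp add: F_def)
  qed
  have Basis: "(Basis :: (real^'d) set) = (\<lambda>i. axis i 1) ` UNIV"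
    by (auto simp: Basis_vec_def)
  have inj: "inj (\<lambda>i::'d. axis i (1::real))"
    by (auto simp: inj_on_def axis_eq_axis)
  have tensF: "tens f x = (\<Prod>b\<in>Basis. F b (x \<bullet> b))" for x
    by (simp add: Basis prod.reindex[OF inj] Fax tens_def cart_eq_inner_axis)
  have Fi: "integrable lborel (F b)" if "b \<in> Basis" for b
    using that assms by (auto simp: Basis Fax)
  have [measurable]: "f i \<in> borel_measurable borel" for i
    using borel_measurable_integrable[OF assms[of i]] by simp
  have tm [measurable]: "tens f \<in> borel_measurable borel"
    by (rule borel_measurable_tens) measurable
  have m [measurable]: "(\<lambda>g. \<Sum>b\<in>Basis. g b *\<^sub>R b) \<in> PiM Basis (\<lambda>b. lborel) \<rightarrow>\<^sub>M (borel :: (real^'d) measure)"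
    by measurable
  have eq: "tens f (\<Sum>b\<in>Basis. g b *\<^sub>R b) = (\<Prod>b\<in>Basis. F b (g b))" for g
    unfolding tensF by (rule prod.cong) (auto simp: inner_sum_left inner_Basis if_distrib sum.delta cong: if_cong)
  show "integrable lborel (tens f)"
    by (subst lborel_eq, subst integrable_distr_eq) (auto simp: eq intro!: product_integrable_prod Fi)
  have "integral\<^sup>L lborel (tens f) = (\<Prod>b\<in>Basis. integral\<^sup>L lborel (F b))"
    by (subst lborel_eq, subst integral_distr) (auto simp: eq intro!: product_integral_prod Fi)
  also have "\<dots> = (\<Prod>i\<in>UNIV. integral\<^sup>L lborel (f i))"
    by (simp add: Basis prod.reindex[OF inj] Fax)
  finally show "integral\<^sup>L lborel (tens f) = (\<Prod>i\<in>UNIV. integral\<^sup>L lborel (f i))" .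
qed

text \<open>The smoothness part of \<open>C2c_with\<close> with the derivatives hidden, so that it
  passes through products by induction. The derivatives obtained this way are opaque;
  \<open>C2c_with_product\<close> identifies the components it needs.\<close>

definition C2 :: "('a::real_normed_vector \<Rightarrow> real) \<Rightarrow> bool" where
  "C2 f \<longleftrightarrow> (\<exists>f' f''. (\<forall>z. (f has_derivative blinfun_apply (f' z)) (at z)) \<and>
     (\<forall>z. (f' has_derivative blinfun_apply (f'' z)) (at z)) \<and> continuous_on UNIV f'')"

lemma C2I:
  assumes "\<And>z. (f has_derivative blinfun_apply (f' z)) (at z)"
    "\<And>z. (f' has_derivative blinfun_apply (f'' z)) (at z)" "continuous_on UNIV f''"
  shows "C2 f"
  unfolding C2_def using assms by (intro exI[of _ f'] exI[of _ f'']) auto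

lemma C2_mult:
  assumes "C2 f" "C2 g" shows "C2 (\<lambda>z. f z * g z)"
proof -
  obtain f' f'' where f: "\<And>z. (f has_derivative blinfun_apply (f' z)) (at z)"
     "\<And>z. (f' has_derivative blinfun_apply (f'' z)) (at z)" "continuous_on UNIV f''"
    using assms(1) unfolding C2_def by auto
  obtain g' g'' where g: "\<And>z. (g has_derivative blinfun_apply (g' z)) (at z)"
     "\<And>z. (g' has_derivative blinfun_apply (g'' z)) (at z)" "continuous_on UNIV g''"
    using assms(2) unfolding C2_def by auto
  have c: "continuous_on UNIV f" "continuous_on UNIV g" "continuous_on UNIV f'" "continuous_on UNIV g'"
    by (rule has_derivative_continuous_on, rule has_derivative_at_withinI, rule f g)+
  let ?h' = "\<lambda>z. f z *\<^sub>R g' z + g z *\<^sub>R f' z"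
  \<comment> \<open>Product rule for the second derivative. The compositions with
    \<open>blinfun_scaleR_left\<close> are the two rank-one maps formed from \<open>f' z\<close> and
    \<open>g' z\<close>.\<close>
  let ?h'' = "\<lambda>z. f z *\<^sub>R g'' z + (blinfun_scaleR_left (g' z) o\<^sub>L f' z)
     + (g z *\<^sub>R f'' z + (blinfun_scaleR_left (f' z) o\<^sub>L g' z))"
  have "((\<lambda>z. f z * g z) has_derivative blinfun_apply (?h' z)) (at z)" for z
    by (rule has_derivative_eq_rhs[OF has_derivative_mult[OF f(1) g(1)]])
       (auto simp: blinfun.bilinear_simps)
  moreover have "(?h' has_derivative blinfun_apply (?h'' z)) (at z)" for z
    by (rule has_derivative_eq_rhs[OF has_derivative_add[OF has_derivative_scaleR[OF f(1) g(2)] has_derivative_scaleR[OF g(1) f(2)]]])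
       (auto simp: blinfun.bilinear_simps)
  moreover have "continuous_on UNIV ?h''"
    by (intro continuous_intros c f g bounded_linear.continuous_on[OF bounded_linear_blinfun_scaleR_left]
      bounded_bilinear.continuous_on[OF bounded_bilinear_blinfun_compose])
  ultimately show ?thesis by (rule C2I)
qed

lemma C2_const: "C2 (\<lambda>z. c)"
  unfolding C2_def by (rule exI[of _ "\<lambda>_. 0"], rule exI[of _ "\<lambda>_. 0"]) (auto simp: zero_blinfun.rep_eq)

lemma C2_prod:
  assumes "\<And>i. i \<in> I \<Longrightarrow> C2 (f i)" shows "C2 (\<lambda>z. \<Prod>i\<in>I. f i z)"
  using assms
proof (induction I rule: infinite_finite_induct)
  case (insert x F)
  then show ?case by (simp add: C2_mult)
qed (auto simp: C2_const)

lemma C2_linear: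
  fixes l :: "'a::real_normed_vector \<Rightarrow> real"
  assumes l: "bounded_linear l"
    and g: "\<And>s. (g has_real_derivative g' s) (at s)" "\<And>s. (g' has_real_derivative g'' s) (at s)"
      "continuous_on UNIV g''"
  shows "C2 (\<lambda>z. g (l z))"
proof -
  define L where "L = Blinfun l"
  have L: "blinfun_apply L = l" using l by (simp add: L_def bounded_linear_Blinfun_apply)
  have ld: "(l has_derivative l) (at z)" for z
    using l by (rule bounded_linear_imp_has_derivative)
  let ?f' = "\<lambda>z. g' (l z) *\<^sub>R L"
  let ?f'' = "\<lambda>z. g'' (l z) *\<^sub>R (blinfun_scaleR_left L o\<^sub>L L)"
  have 1: "((\<lambda>z. h (l z)) has_derivative (\<lambda>v. h' * l v)) (at z)" 
    if "(h has_real_derivative h') (at (l z))" for h h' z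
    using has_derivative_compose[OF ld that[unfolded has_field_derivative_def]] .
  have "((\<lambda>z. g (l z)) has_derivative blinfun_apply (?f' z)) (at z)" for z
    by (rule has_derivative_eq_rhs[OF 1[OF g(1)]]) (auto simp: blinfun.bilinear_simps L)
  moreover have "(?f' has_derivative blinfun_apply (?f'' z)) (at z)" for z
    by (rule has_derivative_eq_rhs[OF has_derivative_scaleR_left[OF 1[OF g(2)]]]) (auto simp: blinfun.bilinear_simps L)
  moreover have "continuous_on UNIV ?f''"
    using l by (intro continuous_intros continuous_on_compose2[OF g(3)] linear_continuous_on) auto
  ultimately show ?thesis by (rule C2I)
qed

lemma has_real_derivative_directional:
  fixes F :: "'a::real_normed_vector \<Rightarrow> real"
  assumes "(F has_derivative D) (at z)"
  shows "((\<lambda>t. F (z + t *\<^sub>R v)) has_real_derivative D v) (at 0)"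
proof -
  have 1: "((\<lambda>t. z + t *\<^sub>R v) has_derivative (\<lambda>t. t *\<^sub>R v)) (at 0)"
    by (auto intro!: derivative_eq_intros)
  have "((\<lambda>t. F (z + t *\<^sub>R v)) has_derivative (\<lambda>t. D (t *\<^sub>R v))) (at 0)"
    using has_derivative_compose[OF 1, of F D] assms by simp
  moreover have "D (t *\<^sub>R v) = D v * t" for t
    using has_derivative_linear[OF assms] by (simp add: linear_cmul)
  ultimately show ?thesis by (simp add: has_field_derivative_def)
qed

lemma tens_shift_axis:
  "tens f (x + t *\<^sub>R axis i 1) = f i (x $ i + t) * (\<Prod>j\<in>UNIV - {i}. f j (x $ j))"
proof -
  have "(\<Prod>j\<in>UNIV - {i}. f j ((x + t *\<^sub>R axis i 1) $ j)) = (\<Prod>j\<in>UNIV - {i}. f j (x $ j))"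
    by (rule prod.cong) (auto simp: axis_def)
  then show ?thesis by (simp add: tens_split[of _ _ i])
qed

text \<open>The operator "B . grad plus half the Laplacian" applied to \<open>tens f\<close>, once
  \<open>f'\<close> and \<open>f''\<close> are the derivatives of the factors. Passing them as
  arguments avoids evaluating a derivative operator.\<close>

definition Lten :: "(real^'d \<Rightarrow> real^'d) \<Rightarrow> ('d::finite \<Rightarrow> real \<Rightarrow> real) \<Rightarrow> ('d \<Rightarrow> real \<Rightarrow> real)
    \<Rightarrow> ('d \<Rightarrow> real \<Rightarrow> real) \<Rightarrow> real^'d \<Rightarrow> real" where
  "Lten B f f' f'' x = (\<Sum>i\<in>UNIV. B x $ i * tens (f(i := f' i)) x) + 1/2 * (\<Sum>i\<in>UNIV. tens (f(i := f'' i)) x)"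

lemma C2c_with_product:
  fixes f :: "'d::finite \<Rightarrow> real \<Rightarrow> real" and G :: "real \<Rightarrow> real"
  assumes f: "\<And>i s. (f i has_real_derivative f' i s) (at s)" "\<And>i s. (f' i has_real_derivative f'' i s) (at s)"
      "\<And>i. continuous_on UNIV (f'' i)"
    and G: "\<And>s. (G has_real_derivative G' s) (at s)" "\<And>s. (G' has_real_derivative G'' s) (at s)"
      "continuous_on UNIV G''"
    and supp: "\<And>i s. \<bar>s\<bar> > R \<Longrightarrow> f i s = 0" "\<And>s. \<bar>s\<bar> > R' \<Longrightarrow> G s = 0"
  obtains \<Phi>' \<Phi>'' where "C2c_with (\<lambda>z. G (fst z) * tens f (snd z)) \<Phi>' \<Phi>''"
    "\<And>m x. dm \<Phi>' (m, x) = G' m * tens f x"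
    "\<And>B m x. Lop B \<Phi>' \<Phi>'' (m, x) = G m * Lten B f f' f'' x"
proof -
  let ?\<Phi> = "\<lambda>z :: 'd pt. G (fst z) * tens f (snd z)"
  have "C2 (\<lambda>z::'d pt. G (fst z))"
    by (rule C2_linear[OF _ G]) (rule bounded_linear_fst)
  moreover have "C2 (\<lambda>z::'d pt. f i (snd z $ i))" for i
    by (rule C2_linear[OF _ f]) (intro bounded_linear_compose[OF bounded_linear_vec_nth] bounded_linear_snd)
  ultimately have "C2 ?\<Phi>" unfolding tens_def by (intro C2_mult C2_prod)
  then obtain \<Phi>' \<Phi>'' where D: "\<And>z. (?\<Phi> has_derivative blinfun_apply (\<Phi>' z)) (at z)"
    "\<And>z. (\<Phi>' has_derivative blinfun_apply (\<Phi>'' z)) (at z)" "continuous_on UNIV \<Phi>''"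
    unfolding C2_def by auto
  let ?K = "cbox (-R') R' \<times> cbox (\<chi> i. -R) (\<chi> i. R) :: 'd pt set"
  have "?\<Phi> z = 0" if "z \<notin> ?K" for z
  proof (cases "\<bar>fst z\<bar> > R'")
    case True then show ?thesis by (simp add: supp)
  next
    case False
    then have "snd z \<notin> cbox (\<chi> i. -R) (\<chi> i. R)" using that by (cases z) (auto simp: abs_le_iff)
    then obtain i where "\<not> (-R \<le> snd z $ i \<and> snd z $ i \<le> R)" by (auto simp: mem_box_cart)
    then have "f i (snd z $ i) = 0" by (intro supp) auto
    then show ?thesis by (simp add: tens_split[of _ _ i])
  qed
  moreover have "compact ?K" by (intro compact_Times compact_cbox)
  ultimately have C: "C2c_with ?\<Phi> \<Phi>' \<Phi>''" unfolding C2c_with_def using D by blast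
  \<comment> \<open>\<open>\<Phi>'\<close> is only known to exist. Along one axis
    \<open>?\<Phi>\<close> is a function of one variable with a known derivative, and uniqueness of
    that derivative pins down this component. The same argument serves for \<open>d2\<close> and
    \<open>d0\<close>.\<close>
  have d1: "\<Phi>' (m, x) (0, axis i 1) = G m * tens (f(i := f' i)) x" for m x i
  proof -
    have "((\<lambda>t. ?\<Phi> ((m, x) + t *\<^sub>R (0, axis i 1))) has_real_derivative \<Phi>' (m, x) (0, axis i 1)) (at 0)"
      by (rule has_real_derivative_directional[OF D(1)])
    moreover have "((\<lambda>t. ?\<Phi> ((m, x) + t *\<^sub>R (0, axis i 1))) has_real_derivative G m * tens (f(i := f' i)) x) (at 0)"
      unfolding tens_upd by (auto simp: tens_shift_axis intro!: derivative_eq_intros DERIV_chain'[OF _ f(1)])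
    ultimately show ?thesis by (rule DERIV_unique)
  qed
  have d2: "\<Phi>'' (m, x) (0, axis i 1) (0, axis i 1) = G m * tens (f(i := f'' i)) x" for m x i
  proof -
    have "((\<lambda>z. \<Phi>' z (0, axis i 1)) has_derivative (\<lambda>h. \<Phi>'' (m, x) h (0, axis i 1))) (at (m, x))"
      by (rule bounded_linear.has_derivative[OF blinfun.bounded_linear_left D(2)])
    then have "((\<lambda>t. \<Phi>' ((m, x) + t *\<^sub>R (0, axis i 1)) (0, axis i 1)) has_real_derivative
         \<Phi>'' (m, x) (0, axis i 1) (0, axis i 1)) (at 0)"
      by (rule has_real_derivative_directional)
    moreover have "((\<lambda>t. \<Phi>' ((m, x) + t *\<^sub>R (0, axis i 1)) (0, axis i 1)) has_real_derivative
         G m * tens (f(i := f'' i)) x) (at 0)"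
    proof -
      have *: "(\<Prod>j\<in>UNIV - {i}. (f(i := f' i)) j (x $ j)) = (\<Prod>j\<in>UNIV - {i}. f j (x $ j))"
        by (rule prod.cong) auto
      show ?thesis unfolding tens_upd
        by (auto simp: d1 tens_shift_axis * intro!: derivative_eq_intros DERIV_chain'[OF _ f(2)])
    qed
    ultimately show ?thesis by (rule DERIV_unique)
  qed
  have d0: "dm \<Phi>' (m, x) = G' m * tens f x" for m x
  proof -
    have "((\<lambda>t. ?\<Phi> ((m, x) + t *\<^sub>R (1, 0))) has_real_derivative \<Phi>' (m, x) (1, 0)) (at 0)"
      by (rule has_real_derivative_directional[OF D(1)])
    moreover have "((\<lambda>t. ?\<Phi> ((m, x) + t *\<^sub>R (1, 0))) has_real_derivative G' m * tens f x) (at 0)"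
      by (auto intro!: derivative_eq_intros DERIV_chain'[OF _ G(1)])
    ultimately show ?thesis unfolding dm_def by (rule DERIV_unique)
  qed
  have "Lop B \<Phi>' \<Phi>'' (m, x) = G m * Lten B f f' f'' x" for B m x
    by (simp add: Lop_def Lten_def d1 d2 distrib_left sum_distrib_left mult_ac)
  from that[OF C d0 this] show thesis .
qed

section \<open>Cutoffs and convergence\<close>

lemma DERIV_max_0_power:
  assumes "n \<ge> 1"
  shows "((\<lambda>r::real. (max 0 r) ^ Suc n) has_real_derivative real (Suc n) * (max 0 r) ^ n) (at r)"
proof -
  consider "r < 0" | "r > 0" | "r = 0" by linarith
  then show ?thesis
  proof cases
    case 1
    have "((\<lambda>r::real. 0) has_real_derivative 0) (at r)" by simp
    then have "((\<lambda>r::real. (max 0 r) ^ Suc n) has_real_derivative 0) (at r)"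
      by (rule has_field_derivative_transform_within_open[where S="{..<0}"]) (use 1 in auto)
    then show ?thesis using 1 assms by (simp add: power_0_left max_def)
  next
    case 2
    have "((\<lambda>r::real. r ^ Suc n) has_real_derivative real (Suc n) * r ^ n) (at r)"
      by (rule derivative_eq_intros refl)+ simp
    then have "((\<lambda>r::real. (max 0 r) ^ Suc n) has_real_derivative real (Suc n) * r ^ n) (at r)"
      by (rule has_field_derivative_transform_within_open[where S="{0<..}"]) (use 2 in \<open>auto simp: max_def\<close>)
    then show ?thesis using 2 by (simp add: max_def)
  next
    case 3
    have "((\<lambda>h. max 0 h ^ n) \<longlongrightarrow> max 0 (0::real) ^ n) (at 0)"
      by (intro tendsto_intros)
    then have lim: "((\<lambda>h::real. max 0 h ^ n) \<longlongrightarrow> 0) (at 0)" using assms by (simp add: power_0_left)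
    have "((\<lambda>h::real. max 0 h ^ Suc n / h) \<longlongrightarrow> 0) (at 0)"
      by (rule Lim_transform_eventually[OF lim]) (use assms in \<open>auto simp: eventually_at_filter max_def power_0_left\<close>)
    then show ?thesis using 3 assms
      by (simp add: has_field_derivative_iff power_0_left)
  qed
qed

text \<open>The cube of the positive part: 3 is the least power whose second derivative is
  continuous at 0. The upper bounds stop at \<open>r = 1\<close> because the ramp grows without
  bound beyond it.\<close>

lemma cubic_ramp:
  obtains q q' q'' :: "real \<Rightarrow> real" where
    "\<And>r. (q has_real_derivative q' r) (at r)" "\<And>r. (q' has_real_derivative q'' r) (at r)"
    "continuous_on UNIV q''" "\<And>r. 0 \<le> q r \<and> 0 \<le> q' r \<and> 0 \<le> q'' r" "q 1 = 1"
    "\<And>r. r \<le> 0 \<Longrightarrow> q r = 0 \<and> q' r = 0 \<and> q'' r = 0"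
    "\<And>r. r \<le> 1 \<Longrightarrow> q r \<le> 1 \<and> q' r \<le> 3 \<and> q'' r \<le> 6" "\<And>r. r \<ge> 1 \<Longrightarrow> q r \<ge> 1"
proof -
  have "((\<lambda>r::real. (max 0 r) ^ 3) has_real_derivative 3 * (max 0 r)\<^sup>2) (at r)"
    "((\<lambda>r::real. 3 * (max 0 r)\<^sup>2) has_real_derivative 6 * max 0 r) (at r)" for r
    using DERIV_max_0_power[of 2 r] DERIV_cmult[OF DERIV_max_0_power[of 1 r], of 3]
    by (simp_all add: numeral_2_eq_2 numeral_3_eq_3)
  moreover have "continuous_on UNIV (\<lambda>r::real. 6 * max 0 r)" by (intro continuous_intros)
  ultimately show thesis
    by (rule that) (auto simp: max_def power_le_one one_le_power)
qed

text \<open>Built as \<open>q (1 - q s)\<close>: the inner ramp is 0 for \<open>s \<le> 0\<close>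
  and at least 1 for \<open>s \<ge> 1\<close>, and the outer ramp turns these values into 1 and 0.
  The bound 9 is \<open>3 * 3\<close> from the chain rule.\<close>

lemma smooth_step:
  obtains g g' g'' :: "real \<Rightarrow> real" where
    "\<And>s. (g has_real_derivative g' s) (at s)" "\<And>s. (g' has_real_derivative g'' s) (at s)"
    "continuous_on UNIV g''" "\<And>s. 0 \<le> g s \<and> g s \<le> 1" "\<And>s. s \<le> 0 \<Longrightarrow> g s = 1" "\<And>s. s \<ge> 1 \<Longrightarrow> g s = 0"
    "\<And>s. s \<le> 0 \<Longrightarrow> g' s = 0" "\<And>s. s \<ge> 1 \<Longrightarrow> g' s = 0" "\<And>s. \<bar>g' s\<bar> \<le> 9"
proof (rule cubic_ramp)
  fix q q' q'' :: "real \<Rightarrow> real"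
  assume q: "\<And>r. (q has_real_derivative q' r) (at r)" "\<And>r. (q' has_real_derivative q'' r) (at r)"
    "continuous_on UNIV q''" "\<And>r. 0 \<le> q r \<and> 0 \<le> q' r \<and> 0 \<le> q'' r" "q 1 = 1"
    "\<And>r. r \<le> 0 \<Longrightarrow> q r = 0 \<and> q' r = 0 \<and> q'' r = 0"
    "\<And>r. r \<le> 1 \<Longrightarrow> q r \<le> 1 \<and> q' r \<le> 3 \<and> q'' r \<le> 6" "\<And>r. r \<ge> 1 \<Longrightarrow> q r \<ge> 1"
  have c: "continuous_on UNIV q" "continuous_on UNIV q'"
    by (rule DERIV_continuous_on, rule has_field_derivative_at_within, rule q)+
  let ?g' = "\<lambda>s. - (q' (1 - q s) * q' s)"
  let ?g'' = "\<lambda>s. q'' (1 - q s) * (q' s)\<^sup>2 - q' (1 - q s) * q'' s"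
  note d = DERIV_chain'[OF _ q(1)] DERIV_chain'[OF _ q(2)]
  have bound: "\<bar>?g' s\<bar> \<le> 9" for s
  proof (cases "s \<ge> 1")
    case True
    then have "1 - q s \<le> 0" using q(8) by auto
    then show ?thesis using q(6)[of "1 - q s"] by simp
  next
    case False
    then have "\<bar>q' s\<bar> \<le> 3" using q(4,7)[of s] by simp
    moreover have "\<bar>q' (1 - q s)\<bar> \<le> 3" using q(7)[of "1 - q s"] q(4)[of s] q(4)[of "1 - q s"] by simp
    ultimately have "\<bar>q' (1 - q s)\<bar> * \<bar>q' s\<bar> \<le> 3 * 3" by (intro mult_mono) auto
    then show ?thesis by (simp add: abs_mult)
  qed
  show thesis
  proof (rule that[of "\<lambda>s. q (1 - q s)" ?g' ?g''])
    show "((\<lambda>s. q (1 - q s)) has_real_derivative ?g' s) (at s)" for s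
      by (rule DERIV_cong, (rule derivative_eq_intros d refl)+) simp
    show "(?g' has_real_derivative ?g'' s) (at s)" for s
      by (rule DERIV_cong[OF DERIV_minus[OF DERIV_mult[OF DERIV_chain'[OF DERIV_diff[OF DERIV_const q(1)] q(2)] q(2)]]])
        (simp add: power2_eq_square)
    show "continuous_on UNIV ?g''"
      by (intro continuous_intros c q continuous_on_compose2[OF c(2)] continuous_on_compose2[OF q(3)]) auto
    show "0 \<le> q (1 - q s) \<and> q (1 - q s) \<le> 1" for s
      using q(7)[of "1 - q s"] q(4)[of s] q(4)[of "1 - q s"] by simp
    show "q (1 - q s) = 0" "?g' s = 0" if "s \<ge> 1" for s
      using q(8)[OF that] q(6)[of "1 - q s"] by simp_all
  qed (use q bound in auto)
qed

text \<open>Built as \<open>q (1 - s\<^sup>2)\<close>. On the unit interval the first derivative is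
  at most 6 in absolute value and the second lies between -6 and 24. The crude common bound 30
  reappears in the constant \<open>M\<close> of \<open>cutoff_energy\<close>.\<close>

lemma bump:
  obtains c c' c'' :: "real \<Rightarrow> real" where
    "\<And>s. (c has_real_derivative c' s) (at s)" "\<And>s. (c' has_real_derivative c'' s) (at s)"
    "continuous_on UNIV c''" "c 0 = 1"
    "\<And>s. \<bar>c s\<bar> \<le> 1" "\<And>s. \<bar>c' s\<bar> \<le> 30" "\<And>s. \<bar>c'' s\<bar> \<le> 30"
    "\<And>s. \<bar>s\<bar> \<ge> 1 \<Longrightarrow> c s = 0" "\<And>s. \<bar>s\<bar> \<ge> 1 \<Longrightarrow> c' s = 0" "\<And>s. \<bar>s\<bar> \<ge> 1 \<Longrightarrow> c'' s = 0"
proof (rule cubic_ramp)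
  fix q q' q'' :: "real \<Rightarrow> real"
  assume q: "\<And>r. (q has_real_derivative q' r) (at r)" "\<And>r. (q' has_real_derivative q'' r) (at r)"
    "continuous_on UNIV q''" "\<And>r. 0 \<le> q r \<and> 0 \<le> q' r \<and> 0 \<le> q'' r" "q 1 = 1"
    "\<And>r. r \<le> 0 \<Longrightarrow> q r = 0 \<and> q' r = 0 \<and> q'' r = 0"
    "\<And>r. r \<le> 1 \<Longrightarrow> q r \<le> 1 \<and> q' r \<le> 3 \<and> q'' r \<le> 6" "\<And>r. r \<ge> 1 \<Longrightarrow> q r \<ge> 1"
  have c: "continuous_on UNIV q" "continuous_on UNIV q'"
    by (rule DERIV_continuous_on, rule has_field_derivative_at_within, rule q)+
  let ?c = "\<lambda>s. q (1 - s\<^sup>2)"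
  let ?c' = "\<lambda>s. - (2 * s * q' (1 - s\<^sup>2))"
  let ?c'' = "\<lambda>s. 4 * s\<^sup>2 * q'' (1 - s\<^sup>2) - 2 * q' (1 - s\<^sup>2)"
  note d = DERIV_chain'[OF _ q(1)] DERIV_chain'[OF _ q(2)]
  have far: "1 - s\<^sup>2 \<le> 0" if "\<bar>s\<bar> \<ge> 1" for s :: real
    using one_le_power[OF that, of 2] by simp
  have z: "?c s = 0" "?c' s = 0" "?c'' s = 0" if "\<bar>s\<bar> \<ge> 1" for s
    using q(6)[OF far[OF that]] by simp_all
  have s2: "s\<^sup>2 \<le> 1" if "\<not> \<bar>s\<bar> \<ge> 1" for s :: real using that by (simp add: abs_square_le_1)
  have b: "0 \<le> q (1 - s\<^sup>2)" "q (1 - s\<^sup>2) \<le> 1" "0 \<le> q' (1 - s\<^sup>2)" "q' (1 - s\<^sup>2) \<le> 3"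
     "0 \<le> q'' (1 - s\<^sup>2)" "q'' (1 - s\<^sup>2) \<le> 6" for s :: real
    using q(4)[of "1 - s\<^sup>2"] q(7)[of "1 - s\<^sup>2"] by auto
  show thesis
  proof (rule that[of ?c ?c' ?c''])
    show "(?c has_real_derivative ?c' s) (at s)" for s
      by (rule DERIV_cong, (rule derivative_eq_intros d refl)+) simp
    show "(?c' has_real_derivative ?c'' s) (at s)" for s
      by (rule DERIV_cong, (rule derivative_eq_intros d refl)+) (simp add: power2_eq_square)
    show "continuous_on UNIV ?c''"
      by (intro continuous_intros continuous_on_compose2[OF c(2)] continuous_on_compose2[OF q(3)]) auto
    show "\<bar>?c' s\<bar> \<le> 30" for s
    proof (cases "\<bar>s\<bar> \<ge> 1")
      case False
      then have "(2 * \<bar>s\<bar>) * q' (1 - s\<^sup>2) \<le> 2 * 3" using b[of s] by (intro mult_mono) auto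
      then show ?thesis using b[of s] by (simp add: abs_mult)
    next
      case True then show ?thesis using z(2)[OF True] by linarith
    qed
    show "\<bar>?c'' s\<bar> \<le> 30" for s
    proof (cases "\<bar>s\<bar> \<ge> 1")
      case False
      then have "(4 * s\<^sup>2) * q'' (1 - s\<^sup>2) \<le> 4 * 6" using b[of s] s2[of s] by (intro mult_mono) auto
      moreover have "0 \<le> (4 * s\<^sup>2) * q'' (1 - s\<^sup>2)" using b[of s] by (intro mult_nonneg_nonneg) auto
      ultimately show ?thesis using b[of s] by linarith
    next
      case True then show ?thesis using z(3)[OF True] by linarith
    qed
  qed (use q b in \<open>auto intro!: z[simplified]\<close>)
qed

text \<open>Dominated convergence is applied once on the product space and unfolded by Fubini. This
  asks for one joint majorant \<open>w\<close> instead of a separate majorant for the inner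
  integrals.\<close>

lemma iterated_dominated_convergence:
  fixes h :: "nat \<Rightarrow> 'a::euclidean_space \<Rightarrow> 'b::euclidean_space \<Rightarrow> real" and l :: "'a \<Rightarrow> 'b \<Rightarrow> real"
  assumes w: "integrable (lborel \<Otimes>\<^sub>M lborel) w"
    and h: "\<And>n. (\<lambda>z. h n (fst z) (snd z)) \<in> borel_measurable borel"
    and bound: "\<And>n x y. \<bar>h n x y\<bar> \<le> w (x, y)"
    and lim: "\<And>x y. (\<lambda>n. h n x y) \<longlonglongrightarrow> l x y"
  shows "(\<lambda>n. \<integral>x. \<integral>y. h n x y \<partial>lborel \<partial>lborel) \<longlonglongrightarrow> (\<integral>x. \<integral>y. l x y \<partial>lborel \<partial>lborel)"
proof -
  have hm: "(\<lambda>z. h n (fst z) (snd z)) \<in> borel_measurable (lborel \<Otimes>\<^sub>M lborel)" for n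
    using h[of n] by (simp add: lborel_prod)
  have lm: "(\<lambda>z. l (fst z) (snd z)) \<in> borel_measurable (lborel \<Otimes>\<^sub>M lborel)"
    by (rule borel_measurable_LIMSEQ_real[OF lim hm])
  have bl: "\<bar>l x y\<bar> \<le> w (x, y)" for x y
    by (rule LIMSEQ_le_const2[OF tendsto_rabs[OF lim]]) (auto intro: bound)
  have "norm (h n (fst z) (snd z)) \<le> norm (w z)" "norm (l (fst z) (snd z)) \<le> norm (w z)" for n z
    using bound[of n "fst z" "snd z"] bl[of "fst z" "snd z"] by auto
  then have ih: "integrable (lborel \<Otimes>\<^sub>M lborel) (\<lambda>z. h n (fst z) (snd z))"
    and il: "integrable (lborel \<Otimes>\<^sub>M lborel) (\<lambda>z. l (fst z) (snd z))" for n
    by (blast intro: Bochner_Integration.integrable_bound[OF w hm] Bochner_Integration.integrable_bound[OF w lm] AE_I2)+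
  have "(\<lambda>n. \<integral>z. h n (fst z) (snd z) \<partial>(lborel \<Otimes>\<^sub>M lborel)) \<longlonglongrightarrow> (\<integral>z. l (fst z) (snd z) \<partial>(lborel \<Otimes>\<^sub>M lborel))"
    by (rule integral_dominated_convergence[OF lm hm w]) (use bound lim in auto)
  then show ?thesis
    using lborel_pair.integral_fst'[OF ih] lborel_pair.integral_fst'[OF il] by simp
qed

text \<open>A crude Cauchy-Schwarz inequality: with \<open>a\<close> the \<open>L^2\<close> norm of
  \<open>h\<close>, integrate \<open>\<bar>h\<bar> \<le> a + h\<^sup>2 / a\<close> over
  \<open>A\<close>, the case \<open>a = 0\<close> being separate. The point is that the result is
  linear in the norm, since the trace is assumed only to have an \<open>L^2\<close> norm that is
  integrable in time, not square integrable.\<close>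

lemma nn_integral_abs_le_L2:
  fixes h :: "'a::euclidean_space \<Rightarrow> real"
  assumes h: "h \<in> borel_measurable borel" and A: "A \<in> sets borel" "emeasure lborel A < \<infinity>"
    and fin: "(\<integral>\<^sup>+ y. ennreal ((h y)\<^sup>2) \<partial>lborel) < \<infinity>"
  shows "(\<integral>\<^sup>+ y. ennreal (indicator A y * \<bar>h y\<bar>) \<partial>lborel)
    \<le> ennreal ((1 + measure lborel A) * sqrt (enn2real (\<integral>\<^sup>+ y. ennreal ((h y)\<^sup>2) \<partial>lborel)))"
proof -
  note [measurable] = h A(1)
  define a where "a = sqrt (enn2real (\<integral>\<^sup>+ y. ennreal ((h y)\<^sup>2) \<partial>lborel))"
  have a0: "a \<ge> 0" by (simp add: a_def)
  have a2: "(\<integral>\<^sup>+ y. ennreal ((h y)\<^sup>2) \<partial>lborel) = ennreal (a\<^sup>2)"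
    using fin by (simp add: a_def ennreal_enn2real)
  show ?thesis
  proof (cases "a = 0")
    case True
    then have "AE y in lborel. ennreal ((h y)\<^sup>2) = 0"
      using a2 by (simp add: nn_integral_0_iff_AE)
    then have "AE y in lborel. ennreal (indicator A y * \<bar>h y\<bar>) = 0"
      by eventually_elim (auto simp: ennreal_eq_0_iff)
    then have "(\<integral>\<^sup>+ y. ennreal (indicator A y * \<bar>h y\<bar>) \<partial>lborel) = (\<integral>\<^sup>+ y. 0 \<partial>(lborel :: 'a measure))"
      by (rule nn_integral_cong_AE)
    then show ?thesis by simp
  next
    case False
    with a0 have a: "a > 0" by simp
    have "indicator A y * \<bar>h y\<bar> \<le> a * indicator A y + (1 / a) * (h y)\<^sup>2" for y
    proof -
      have "2 * \<bar>h y\<bar> * a \<le> \<bar>h y\<bar>\<^sup>2 + a\<^sup>2" by (rule sum_squares_bound)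
      moreover have "0 \<le> \<bar>h y\<bar> * a" using a by simp
      ultimately have "a * \<bar>h y\<bar> \<le> a * a + (h y)\<^sup>2" by (simp add: power2_eq_square mult.commute)
      then have "\<bar>h y\<bar> \<le> a + (1 / a) * (h y)\<^sup>2" using a by (simp add: field_simps)
      then show ?thesis using a by (auto simp: indicator_def)
    qed
    then have "(\<integral>\<^sup>+ y. ennreal (indicator A y * \<bar>h y\<bar>) \<partial>lborel)
      \<le> (\<integral>\<^sup>+ y. ennreal a * indicator A y + ennreal (1 / a) * ennreal ((h y)\<^sup>2) \<partial>lborel)"
      using a by (intro nn_integral_mono) (auto simp flip: ennreal_mult' ennreal_plus ennreal_indicator intro!: ennreal_leI)
    also have "\<dots> = ennreal a * emeasure lborel A + ennreal (1 / a) * ennreal (a\<^sup>2)"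
      by (subst nn_integral_add) (auto simp: nn_integral_cmult a2)
    also have "\<dots> = ennreal (a * measure lborel A + (1 / a) * a\<^sup>2)"
      using a A(2) by (simp add: emeasure_eq_ennreal_measure less_top flip: ennreal_mult ennreal_plus)
    also have "\<dots> \<le> ennreal ((1 + measure lborel A) * a)"
      using a by (intro ennreal_leI) (simp add: power2_eq_square algebra_simps)
    finally show ?thesis by (simp add: a_def)
  qed
qed

section \<open>Truncated solutions and their slab integrals\<close>

text \<open>Extension by zero, so that integrals over the wedge \<open>Tdom i1\<close> become
  integrals over the whole space.\<close>

definition cutp :: "'d::finite \<Rightarrow> real \<Rightarrow> (real \<Rightarrow> real^'d \<Rightarrow> real \<Rightarrow> real) \<Rightarrow> real \<Rightarrow> real^'d \<Rightarrow> real \<Rightarrow> real" where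
  "cutp i1 T p m x t = (if 0 < t \<and> t \<le> T \<and> x $ i1 \<le> m then p m x t else 0)"

text \<open>The \<open>P\<close> of the overview for a single solution; the lower limit
  \<open>x^1\<close> of the integral is hidden in \<open>cutp\<close>.\<close>

definition slabP :: "'d::finite \<Rightarrow> real \<Rightarrow> (real \<Rightarrow> real^'d \<Rightarrow> real \<Rightarrow> real) \<Rightarrow> real \<Rightarrow> real^'d \<Rightarrow> real \<Rightarrow> real" where
  "slabP i1 T p m0 x t = (\<integral>m. indicator {..m0} m * cutp i1 T p m x t \<partial>lborel)"

lemma borel_measurable_fst_snd [measurable (raw)]:
  fixes f :: "'a \<Rightarrow> 'b::second_countable_topology \<times> 'c::second_countable_topology"
  assumes "f \<in> borel_measurable M"
  shows "(\<lambda>w. fst (f w)) \<in> borel_measurable M" "(\<lambda>w. snd (f w)) \<in> borel_measurable M"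
  using measurable_compose[OF assms borel_measurable_continuous_onI[OF continuous_on_fst[OF continuous_on_id]]]
    measurable_compose[OF assms borel_measurable_continuous_onI[OF continuous_on_snd[OF continuous_on_id]]] by auto

lemma ennreal_le_1_plus_square: "(a::ennreal) \<le> 1 + a\<^sup>2"
proof (cases a rule: ennreal_cases)
  case (real r)
  have "r \<le> 1 + r\<^sup>2" using sum_squares_bound[of r 1] real(1) by simp
  then have "ennreal r \<le> ennreal (1 + r\<^sup>2)" by (rule ennreal_leI)
  then show ?thesis using real by (simp add: ennreal_power)
qed (simp add: power2_eq_square ennreal_top_mult)

lemma ennreal_abs_integral_le:
  fixes f :: "'a \<Rightarrow> real"
  shows "ennreal \<bar>integral\<^sup>L M f\<bar> \<le> (\<integral>\<^sup>+ x. ennreal \<bar>f x\<bar> \<partial>M)"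
proof (cases "integrable M f")
  case True
  then show ?thesis using integral_norm_bound_ennreal[of M f] by simp
qed (simp add: not_integrable_integral_eq)

context
  fixes i1 :: "'d::finite" and T :: real and p :: "real \<Rightarrow> real^'d \<Rightarrow> real \<Rightarrow> real"
  assumes T0: "0 \<le> T" and X: "spaceX i1 T p"
begin

lemma cutp_measurable [measurable]:
  assumes [measurable]: "f \<in> borel_measurable M" "g \<in> borel_measurable M" "h \<in> borel_measurable M"
  shows "(\<lambda>w. cutp i1 T p (f w) (g w) (h w)) \<in> borel_measurable M"
proof -
  have "(\<lambda>(m, x, t). cutp i1 T p m x t) \<in> borel_measurable borel"
    using X unfolding spaceX_def cutp_def by simp
  moreover have "(\<lambda>w. (f w, g w, h w)) \<in> M \<rightarrow>\<^sub>M borel" by measurable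
  ultimately show ?thesis
    using measurable_compose[of "\<lambda>w. (f w, g w, h w)" M borel "\<lambda>(m, x, t). cutp i1 T p m x t" borel] by simp
qed

lemma cutp_L2:
  obtains C :: real where "C \<ge> 0"
    "\<And>t. (\<integral>\<^sup>+ x. (\<integral>\<^sup>+ m. ennreal \<bar>cutp i1 T p m x t\<bar> \<partial>lborel)\<^sup>2 \<partial>lborel) \<le> ennreal C"
proof -
  obtain C where C: "\<And>t. t \<in> {0<..T} \<Longrightarrow>
        (\<integral>\<^sup>+ x. (\<integral>\<^sup>+ m. indicator {x $ i1..} m * ennreal \<bar>p m x t\<bar> \<partial>lborel) ^ 2 \<partial>lborel) \<le> ennreal C"
    using X unfolding spaceX_def by blast
  have "(\<integral>\<^sup>+ x. (\<integral>\<^sup>+ m. ennreal \<bar>cutp i1 T p m x t\<bar> \<partial>lborel)\<^sup>2 \<partial>lborel) \<le> ennreal (max 0 C)" for t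
  proof (cases "t \<in> {0<..T}")
    case True
    then have "ennreal \<bar>cutp i1 T p m x t\<bar> = indicator {x $ i1..} m * ennreal \<bar>p m x t\<bar>" for m x
      by (auto simp: cutp_def indicator_def)
    then show ?thesis using C[OF True] by (auto intro: order_trans[OF _ ennreal_leI])
  next
    case False
    then have "cutp i1 T p m x t = 0" for m x by (auto simp: cutp_def)
    then show ?thesis by simp
  qed
  then show thesis using that[of "max 0 C"] by auto
qed

lemma slabP_measurable [measurable]:
  "(\<lambda>z. slabP i1 T p m0 (fst z) (snd z)) \<in> borel_measurable borel"
  "(\<lambda>x. slabP i1 T p m0 x t) \<in> borel_measurable borel"
proof -
  have "(\<lambda>w::((real^'d) \<times> real) \<times> real. indicator {..m0} (snd w) * cutp i1 T p (snd w) (fst (fst w)) (snd (fst w))) 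
    \<in> borel_measurable (borel \<Otimes>\<^sub>M lborel)" by measurable
  then show *: "(\<lambda>z. slabP i1 T p m0 (fst z) (snd z)) \<in> borel_measurable borel"
    unfolding slabP_def by (intro lborel.borel_measurable_lebesgue_integral) (simp add: split_beta')
  show "(\<lambda>x. slabP i1 T p m0 x t) \<in> borel_measurable borel"
    using measurable_compose[OF _ *, of "\<lambda>x. (x, t)" borel] by simp
qed

lemma slabP_L2:
  obtains C :: real where "C \<ge> 0"
    "\<And>t. (\<integral>\<^sup>+ x. ennreal ((slabP i1 T p m0 x t)\<^sup>2) \<partial>lborel) \<le> ennreal C"
proof (rule cutp_L2)
  fix C :: real
  assume C: "C \<ge> 0" "\<And>t. (\<integral>\<^sup>+ x. (\<integral>\<^sup>+ m. ennreal \<bar>cutp i1 T p m x t\<bar> \<partial>lborel)\<^sup>2 \<partial>lborel) \<le> ennreal C"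
  have "ennreal ((slabP i1 T p m0 x t)\<^sup>2) \<le> (\<integral>\<^sup>+ m. ennreal \<bar>cutp i1 T p m x t\<bar> \<partial>lborel)\<^sup>2" for x t
  proof -
    have "ennreal \<bar>slabP i1 T p m0 x t\<bar> \<le> (\<integral>\<^sup>+ m. ennreal \<bar>indicator {..m0} m * cutp i1 T p m x t\<bar> \<partial>lborel)"
      unfolding slabP_def by (rule ennreal_abs_integral_le)
    also have "\<dots> \<le> (\<integral>\<^sup>+ m. ennreal \<bar>cutp i1 T p m x t\<bar> \<partial>lborel)"
      by (intro nn_integral_mono ennreal_leI) (auto simp: indicator_def)
    finally have "(ennreal \<bar>slabP i1 T p m0 x t\<bar>)\<^sup>2 \<le> (\<integral>\<^sup>+ m. ennreal \<bar>cutp i1 T p m x t\<bar> \<partial>lborel)\<^sup>2"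
      by (intro power_mono) auto
    then show ?thesis by (simp add: ennreal_power)
  qed
  then have "(\<integral>\<^sup>+ x. ennreal ((slabP i1 T p m0 x t)\<^sup>2) \<partial>lborel) \<le> ennreal C" for t
    using C(2)[of t] by (meson nn_integral_mono order_trans)
  then show thesis using that C(1) by blast
qed

text \<open>If \<open>N\<close> is the inner integral over \<open>m\<close>, then
  \<open>N \<le> 1 + N\<^sup>2\<close> on \<open>A\<close> turns the mixed bound of condition (a)
  into a local \<open>L^1\<close> bound. \<open>D\<close> does not depend on \<open>t\<close>, so it
  can later be integrated over time.\<close>

lemma nn_integral_cutp_local:
  assumes A: "A \<in> sets borel" "emeasure lborel A < \<infinity>"
  obtains D :: real where "D \<ge> 0"
   "\<And>t. (\<integral>\<^sup>+ z. ennreal (indicator A (snd z) * \<bar>cutp i1 T p (fst z) (snd z) t\<bar>) \<partial>lborel) \<le> ennreal D"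
proof (rule cutp_L2)
  fix C :: real
  assume C: "C \<ge> 0" "\<And>t. (\<integral>\<^sup>+ x. (\<integral>\<^sup>+ m. ennreal \<bar>cutp i1 T p m x t\<bar> \<partial>lborel)\<^sup>2 \<partial>lborel) \<le> ennreal C"
  note [measurable] = A(1)
  have "(\<integral>\<^sup>+ z. ennreal (indicator A (snd z) * \<bar>cutp i1 T p (fst z) (snd z) t\<bar>) \<partial>lborel) \<le> ennreal (measure lborel A + C)" for t
  proof -
    have "(\<integral>\<^sup>+ z. ennreal (indicator A (snd z) * \<bar>cutp i1 T p (fst z) (snd z) t\<bar>) \<partial>lborel)
      = (\<integral>\<^sup>+ x. \<integral>\<^sup>+ m. ennreal (indicator A x * \<bar>cutp i1 T p m x t\<bar>) \<partial>lborel \<partial>lborel)"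
      by (subst lborel_prod[symmetric], subst lborel_pair.nn_integral_snd[symmetric]) auto
    also have "\<dots> = (\<integral>\<^sup>+ x. indicator A x * (\<integral>\<^sup>+ m. ennreal \<bar>cutp i1 T p m x t\<bar> \<partial>lborel) \<partial>lborel)"
      by (intro nn_integral_cong) (simp add: ennreal_mult ennreal_indicator nn_integral_cmult)
    also have "\<dots> \<le> (\<integral>\<^sup>+ x. indicator A x + (\<integral>\<^sup>+ m. ennreal \<bar>cutp i1 T p m x t\<bar> \<partial>lborel)\<^sup>2 \<partial>lborel)"
      by (intro nn_integral_mono) (auto simp: indicator_def ennreal_le_1_plus_square)
    also have "\<dots> = emeasure lborel A + (\<integral>\<^sup>+ x. (\<integral>\<^sup>+ m. ennreal \<bar>cutp i1 T p m x t\<bar> \<partial>lborel)\<^sup>2 \<partial>lborel)"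
      by (subst nn_integral_add) auto
    also have "\<dots> \<le> emeasure lborel A + ennreal C" using C(2) by (intro add_left_mono)
    also have "\<dots> = ennreal (measure lborel A + C)"
      using A C(1) by (simp add: emeasure_eq_ennreal_measure less_top)
    finally show ?thesis .
  qed
  then show thesis using that[of "measure lborel A + C"] C(1) by simp
qed

lemma integrable_cutp_mult:
  assumes A: "A \<in> sets borel" "emeasure lborel A < \<infinity>"
    and h [measurable]: "h \<in> borel_measurable borel" and bound: "\<And>z. \<bar>h z\<bar> \<le> K * indicator A (snd z)"
  shows "integrable lborel (\<lambda>z. h z * cutp i1 T p (fst z) (snd z) t)"
proof (rule nn_integral_cutp_local[OF A])
  fix D :: real
  assume D: "\<And>t. (\<integral>\<^sup>+ z. ennreal (indicator A (snd z) * \<bar>cutp i1 T p (fst z) (snd z) t\<bar>) \<partial>lborel) \<le> ennreal D"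
  note [measurable] = A(1)
  have "integrable lborel (\<lambda>z. indicator A (snd z) * \<bar>cutp i1 T p (fst z) (snd z) t\<bar>)"
    by (rule integrableI_bounded, measurable)
      (use le_less_trans[OF D[of t] ennreal_less_top] in \<open>simp add: abs_mult\<close>)
  then have "integrable lborel (\<lambda>z. K * (indicator A (snd z) * \<bar>cutp i1 T p (fst z) (snd z) t\<bar>))"
    by (rule integrable_mult_right)
  then show ?thesis
  proof (rule Bochner_Integration.integrable_bound)
    have "\<bar>h z * cutp i1 T p (fst z) (snd z) t\<bar> \<le> \<bar>K * (indicator A (snd z) * \<bar>cutp i1 T p (fst z) (snd z) t\<bar>)\<bar>" for z
      using mult_right_mono[OF bound[of z] abs_ge_zero[of "cutp i1 T p (fst z) (snd z) t"]]
      unfolding abs_mult[of "h z"] mult.assoc by (rule order_trans[OF _ abs_ge_self])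
    then show "AE z in lborel. norm (h z * cutp i1 T p (fst z) (snd z) t)
       \<le> norm (K * (indicator A (snd z) * \<bar>cutp i1 T p (fst z) (snd z) t\<bar>))"
      unfolding real_norm_def by (rule AE_I2)
  qed measurable
qed

lemma integrable_cutp_space_time:
  assumes A: "A \<in> sets borel" "emeasure lborel A < \<infinity>"
  shows "integrable (lborel \<Otimes>\<^sub>M lborel) (\<lambda>w. K * (indicator A (snd (snd w)) * \<bar>cutp i1 T p (fst (snd w)) (snd (snd w)) (fst w)\<bar>))"
proof (rule nn_integral_cutp_local[OF A])
  fix D :: real
  assume D: "D \<ge> 0" "\<And>t. (\<integral>\<^sup>+ z. ennreal (indicator A (snd z) * \<bar>cutp i1 T p (fst z) (snd z) t\<bar>) \<partial>lborel) \<le> ennreal D"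
  note [measurable] = A(1)
  have "(\<lambda>w::real \<times> 'd pt. indicator A (snd (snd w)) * \<bar>cutp i1 T p (fst (snd w)) (snd (snd w)) (fst w)\<bar>) \<in> borel_measurable borel"
    by measurable
  then have m: "(\<lambda>w. indicator A (snd (snd w)) * \<bar>cutp i1 T p (fst (snd w)) (snd (snd w)) (fst w)\<bar>) \<in> borel_measurable (lborel \<Otimes>\<^sub>M lborel)"
    by (simp add: lborel_prod)
  have "(\<integral>\<^sup>+ w. ennreal (indicator A (snd (snd w)) * \<bar>cutp i1 T p (fst (snd w)) (snd (snd w)) (fst w)\<bar>) \<partial>(lborel \<Otimes>\<^sub>M lborel))
    = (\<integral>\<^sup>+ s. \<integral>\<^sup>+ z. ennreal (indicator A (snd z) * \<bar>cutp i1 T p (fst z) (snd z) s\<bar>) \<partial>lborel \<partial>lborel)"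
    by (subst lborel.nn_integral_fst[symmetric]) (auto intro: measurable_compose[OF m])
  also have "\<dots> \<le> (\<integral>\<^sup>+ s. ennreal D * indicator {0<..T} s \<partial>lborel)"
  proof (intro nn_integral_mono)
    fix s show "(\<integral>\<^sup>+ z. ennreal (indicator A (snd z) * \<bar>cutp i1 T p (fst z) (snd z) s\<bar>) \<partial>lborel) \<le> ennreal D * indicator {0<..T} s"
    proof (cases "s \<in> {0<..T}")
      case False
      then have "cutp i1 T p m x s = 0" for m x by (auto simp: cutp_def)
      then show ?thesis by simp
    qed (use D in simp)
  qed
  also have "\<dots> < \<infinity>" by (simp add: nn_integral_cmult ennreal_mult_less_top T0)
  finally have "integrable (lborel \<Otimes>\<^sub>M lborel) (\<lambda>w. indicator A (snd (snd w)) * \<bar>cutp i1 T p (fst (snd w)) (snd (snd w)) (fst w)\<bar>)"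
    by (intro integrableI_bounded m) (simp add: abs_mult)
  then show ?thesis by (rule integrable_mult_right)
qed

text \<open>A test function that is the indicator of \<open>m \<le> m0\<close> times a function of
  \<open>x\<close> sees the density only through its slab integral. This is where the variable
  \<open>m\<close> leaves the problem.\<close>

lemma integral_cutp_slabP:
  assumes A: "A \<in> sets borel" "emeasure lborel A < \<infinity>"
    and h [measurable]: "h \<in> borel_measurable borel" and bound: "\<And>x. \<bar>h x\<bar> \<le> K * indicator A x"
  shows "(\<integral>z. indicator {..m0} (fst z) * h (snd z) * cutp i1 T p (fst z) (snd z) t \<partial>lborel)
     = (\<integral>x. h x * slabP i1 T p m0 x t \<partial>lborel)"
proof -
  have "integrable lborel (\<lambda>z. indicator {..m0} (fst z) * h (snd z) * cutp i1 T p (fst z) (snd z) t)"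
  proof (rule integrable_cutp_mult[OF A])
    have "0 \<le> K * indicator A x" for x using bound[of x] by linarith
    then show "\<bar>indicator {..m0} (fst z) * h (snd z)\<bar> \<le> K * indicator A (snd z)" for z
      using bound[of "snd z"] by (auto simp: indicator_def abs_mult)
  qed measurable
  then have i: "integrable (lborel \<Otimes>\<^sub>M lborel) (\<lambda>(m, x). indicator {..m0} m * h x * cutp i1 T p m x t)"
    by (simp add: lborel_prod split_beta')
  have "(\<integral>z. indicator {..m0} (fst z) * h (snd z) * cutp i1 T p (fst z) (snd z) t \<partial>lborel)
     = (\<integral>x. (\<integral>m. indicator {..m0} m * h x * cutp i1 T p m x t \<partial>lborel) \<partial>lborel)"
    using lborel_pair.integral_snd[OF i] by (simp add: lborel_prod split_beta')
  also have "\<dots> = (\<integral>x. h x * slabP i1 T p m0 x t \<partial>lborel)"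
    unfolding slabP_def by (subst integral_mult_right_zero[symmetric]) (simp add: mult_ac)
  finally show ?thesis .
qed

lemma trace_p_measurable [measurable]:
  assumes [measurable]: "f \<in> borel_measurable M" "g \<in> borel_measurable M"
  shows "(\<lambda>w. trace_p i1 p (f w) (g w)) \<in> borel_measurable M"
proof -
  have "(\<lambda>(y, s). trace_p i1 p y s) \<in> borel_measurable borel"
    using X unfolding spaceX_def by simp
  moreover have "(\<lambda>w. (f w, g w)) \<in> borel_measurable M" by measurable
  ultimately show ?thesis
    using measurable_compose[of "\<lambda>w. (f w, g w)" M borel "\<lambda>(y, s). trace_p i1 p y s"] by simp
qed

text \<open>Space is integrated first, for almost every time, by the linear bound
  \<open>nn_integral_abs_le_L2\<close>. What remains is the time integral of the \<open>L^2\<close>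
  norm of the trace, finite by condition (b).\<close>

lemma integrable_trace:
  assumes A: "A \<in> sets borel" "emeasure lborel A < \<infinity>"
  shows "integrable (lborel \<Otimes>\<^sub>M lborel) (\<lambda>w. K * (indicator {0<..T} (fst w) * (indicator A (snd w) * \<bar>trace_p i1 p (snd w) (fst w)\<bar>)))"
proof -
  note [measurable] = A(1)
  have fin: "AE s in lborel. s \<in> {0<..T} \<longrightarrow> (\<integral>\<^sup>+ y. ennreal ((trace_p i1 p y s)\<^sup>2) \<partial>lborel) < \<infinity>"
    and fin2: "(\<integral>\<^sup>+ s. indicator {0<..T} s *
          ennreal (sqrt (enn2real (\<integral>\<^sup>+ y. ennreal ((trace_p i1 p y s)\<^sup>2) \<partial>lborel))) \<partial>lborel) < \<infinity>"
    using X unfolding spaceX_def by auto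
  have "(\<integral>\<^sup>+ w. ennreal (indicator {0<..T} (fst w) * (indicator A (snd w) * \<bar>trace_p i1 p (snd w) (fst w)\<bar>)) \<partial>(lborel \<Otimes>\<^sub>M lborel))
    = (\<integral>\<^sup>+ s. \<integral>\<^sup>+ y. ennreal (indicator {0<..T} s * (indicator A y * \<bar>trace_p i1 p y s\<bar>)) \<partial>lborel \<partial>lborel)"
    by (subst lborel.nn_integral_fst[symmetric]) auto
  also have "\<dots> \<le> (\<integral>\<^sup>+ s. ennreal (1 + measure lborel A) * (indicator {0<..T} s *
          ennreal (sqrt (enn2real (\<integral>\<^sup>+ y. ennreal ((trace_p i1 p y s)\<^sup>2) \<partial>lborel)))) \<partial>lborel)"
  proof (rule nn_integral_mono_AE, use fin in eventually_elim)
    fix s assume s: "s \<in> {0<..T} \<longrightarrow> (\<integral>\<^sup>+ y. ennreal ((trace_p i1 p y s)\<^sup>2) \<partial>lborel) < \<infinity>"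
    show "(\<integral>\<^sup>+ y. ennreal (indicator {0<..T} s * (indicator A y * \<bar>trace_p i1 p y s\<bar>)) \<partial>lborel)
      \<le> ennreal (1 + measure lborel A) * (indicator {0<..T} s *
          ennreal (sqrt (enn2real (\<integral>\<^sup>+ y. ennreal ((trace_p i1 p y s)\<^sup>2) \<partial>lborel))))"
    proof (cases "s \<in> {0<..T}")
      case True
      have "(\<integral>\<^sup>+ y. ennreal (indicator A y * \<bar>trace_p i1 p y s\<bar>) \<partial>lborel)
         \<le> ennreal ((1 + measure lborel A) * sqrt (enn2real (\<integral>\<^sup>+ y. ennreal ((trace_p i1 p y s)\<^sup>2) \<partial>lborel)))"
        using s True by (intro nn_integral_abs_le_L2 A) auto
      then show ?thesis using True by (simp add: ennreal_mult)
    qed simp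
  qed
  also have "\<dots> < \<infinity>"
    using fin2 by (subst nn_integral_cmult) (auto simp: ennreal_mult_less_top)
  finally have "integrable (lborel \<Otimes>\<^sub>M lborel) (\<lambda>w. indicator {0<..T} (fst w) * (indicator A (snd w) * \<bar>trace_p i1 p (snd w) (fst w)\<bar>))"
    by (intro integrableI_bounded) (auto simp: abs_mult)
  then show ?thesis by (rule integrable_mult_right)
qed

end

section \<open>Functions bounded in time with values in \<open>L^2\<close>, and integrability of
  products\<close>

definition L2bdd :: "real \<Rightarrow> (real^'d::finite \<Rightarrow> real \<Rightarrow> real) \<Rightarrow> bool" where
  "L2bdd T P \<longleftrightarrow> (\<lambda>z. P (fst z) (snd z)) \<in> borel_measurable borel
     \<and> (\<exists>C\<ge>0. \<forall>t. (\<integral>\<^sup>+ x. ennreal ((P x t)\<^sup>2) \<partial>lborel) \<le> ennreal C)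
     \<and> (\<forall>x t. t \<notin> {0<..T} \<longrightarrow> P x t = 0)"

lemma L2bdd_measurable:
  assumes "L2bdd T P" and [measurable]: "f \<in> borel_measurable M" "g \<in> borel_measurable M"
  shows "(\<lambda>w. P (f w) (g w)) \<in> borel_measurable M"
proof -
  have "(\<lambda>w. (f w, g w)) \<in> borel_measurable M" by measurable
  then show ?thesis
    using measurable_compose[of "\<lambda>w. (f w, g w)" M borel "\<lambda>z. P (fst z) (snd z)" borel] assms(1)
    by (simp add: L2bdd_def)
qed

lemma L2bdd_slabP:
  assumes "0 \<le> T" "spaceX i1 T p"
  shows "L2bdd T (slabP i1 T p m0)"
  unfolding L2bdd_def
proof (intro conjI allI impI)
  show "\<exists>C\<ge>0. \<forall>t. (\<integral>\<^sup>+ x. ennreal ((slabP i1 T p m0 x t)\<^sup>2) \<partial>lborel) \<le> ennreal C"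
    using slabP_L2[OF assms] by metis
  show "slabP i1 T p m0 x t = 0" if "t \<notin> {0<..T}" for x t
  proof -
    have "cutp i1 T p m x t = 0" for m using that by (auto simp: cutp_def)
    then show ?thesis by (simp add: slabP_def)
  qed
qed (rule slabP_measurable[OF assms])

lemma L2bdd_diff:
  assumes "L2bdd T P" "L2bdd T Q"
  shows "L2bdd T (\<lambda>x t. P x t - Q x t)"
proof -
  obtain C1 C2 where C: "C1 \<ge> 0" "C2 \<ge> 0"
     "\<And>t. (\<integral>\<^sup>+ x. ennreal ((P x t)\<^sup>2) \<partial>lborel) \<le> ennreal C1"
     "\<And>t. (\<integral>\<^sup>+ x. ennreal ((Q x t)\<^sup>2) \<partial>lborel) \<le> ennreal C2"
    using assms unfolding L2bdd_def by blast
  note [measurable] = L2bdd_measurable[OF assms(1)] L2bdd_measurable[OF assms(2)]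
  have "(\<integral>\<^sup>+ x. ennreal ((P x t - Q x t)\<^sup>2) \<partial>lborel) \<le> ennreal (2 * C1 + 2 * C2)" for t
  proof -
    have "(P x t - Q x t)\<^sup>2 \<le> 2 * (P x t)\<^sup>2 + 2 * (Q x t)\<^sup>2" for x
      using zero_le_power2[of "P x t + Q x t"] unfolding power2_sum power2_diff by linarith
    then have "ennreal ((P x t - Q x t)\<^sup>2) \<le> ennreal (2 * (P x t)\<^sup>2 + 2 * (Q x t)\<^sup>2)" for x
      by (rule ennreal_leI)
    then have "ennreal ((P x t - Q x t)\<^sup>2) \<le> ennreal 2 * ennreal ((P x t)\<^sup>2) + ennreal 2 * ennreal ((Q x t)\<^sup>2)" for x
      by (simp add: ennreal_plus ennreal_mult)
    then have "(\<integral>\<^sup>+ x. ennreal ((P x t - Q x t)\<^sup>2) \<partial>lborel) 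
      \<le> (\<integral>\<^sup>+ x. ennreal 2 * ennreal ((P x t)\<^sup>2) + ennreal 2 * ennreal ((Q x t)\<^sup>2) \<partial>lborel)"
      by (intro nn_integral_mono)
    also have "\<dots> = ennreal 2 * (\<integral>\<^sup>+ x. ennreal ((P x t)\<^sup>2) \<partial>lborel) + ennreal 2 * (\<integral>\<^sup>+ x. ennreal ((Q x t)\<^sup>2) \<partial>lborel)"
      by (subst nn_integral_add) (auto simp: nn_integral_cmult)
    also have "\<dots> \<le> ennreal 2 * ennreal C1 + ennreal 2 * ennreal C2"
      using C by (intro add_mono mult_left_mono) auto
    also have "\<dots> = ennreal (2 * C1 + 2 * C2)" using C by (simp add: ennreal_mult)
    finally show ?thesis .
  qed
  then have "\<exists>C\<ge>0. \<forall>t. (\<integral>\<^sup>+ x. ennreal ((P x t - Q x t)\<^sup>2) \<partial>lborel) \<le> ennreal C"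
    using C by (intro exI[of _ "2 * C1 + 2 * C2"]) auto
  moreover have "(\<lambda>z. P (fst z) (snd z) - Q (fst z) (snd z)) \<in> borel_measurable borel" by measurable
  ultimately show ?thesis using assms unfolding L2bdd_def by auto
qed

lemma L2bdd_integrable:
  assumes P: "L2bdd T P" and T0: "0 \<le> T"
  shows "integrable (lborel \<Otimes>\<^sub>M lborel) (\<lambda>w. (P (snd w) (fst w))\<^sup>2)"
    and "integrable lborel (\<lambda>x. (P x t)\<^sup>2)"
proof -
  note [measurable] = L2bdd_measurable[OF P]
  obtain C where C: "C \<ge> 0" "\<And>t. (\<integral>\<^sup>+ x. ennreal ((P x t)\<^sup>2) \<partial>lborel) \<le> ennreal C"
    and z: "\<And>x t. t \<notin> {0<..T} \<Longrightarrow> P x t = 0"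
    using P unfolding L2bdd_def by blast
  show "integrable lborel (\<lambda>x. (P x t)\<^sup>2)"
    by (rule integrableI_bounded, measurable) (use le_less_trans[OF C(2)[of t] ennreal_less_top] in simp)
  have "(\<integral>\<^sup>+ w. ennreal ((P (snd w) (fst w))\<^sup>2) \<partial>(lborel \<Otimes>\<^sub>M lborel))
     = (\<integral>\<^sup>+ s. \<integral>\<^sup>+ x. ennreal ((P x s)\<^sup>2) \<partial>lborel \<partial>lborel)"
    by (subst lborel.nn_integral_fst[symmetric]) auto
  also have "\<dots> \<le> (\<integral>\<^sup>+ s. ennreal C * indicator {0<..T} s \<partial>lborel)"
  proof (intro nn_integral_mono)
    fix s show "(\<integral>\<^sup>+ x. ennreal ((P x s)\<^sup>2) \<partial>lborel) \<le> ennreal C * indicator {0<..T} s"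
      using C z[of s] by (cases "s \<in> {0<..T}") auto
  qed
  also have "\<dots> < \<infinity>" by (simp add: nn_integral_cmult ennreal_mult_less_top T0)
  finally show "integrable (lborel \<Otimes>\<^sub>M lborel) (\<lambda>w. (P (snd w) (fst w))\<^sup>2)"
    by (intro integrableI_bounded) auto
qed

lemma integrable_mult_L2:
  fixes f g :: "'a \<Rightarrow> real"
  assumes [measurable]: "f \<in> borel_measurable M" "g \<in> borel_measurable M"
    and "integrable M (\<lambda>x. (f x)\<^sup>2)" "integrable M (\<lambda>x. (g x)\<^sup>2)"
  shows "integrable M (\<lambda>x. f x * g x)"
proof (rule Bochner_Integration.integrable_bound)
  show "integrable M (\<lambda>x. (f x)\<^sup>2 + (g x)\<^sup>2)" using assms by auto
  have "\<bar>f x * g x\<bar> \<le> \<bar>(f x)\<^sup>2 + (g x)\<^sup>2\<bar>" for x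
  proof -
    have "2 * \<bar>f x\<bar> * \<bar>g x\<bar> \<le> (f x)\<^sup>2 + (g x)\<^sup>2" using sum_squares_bound[of "\<bar>f x\<bar>" "\<bar>g x\<bar>"] by simp
    moreover have "0 \<le> \<bar>f x\<bar> * \<bar>g x\<bar>" by simp
    ultimately show ?thesis unfolding abs_mult by linarith
  qed
  then show "AE x in M. norm (f x * g x) \<le> norm ((f x)\<^sup>2 + (g x)\<^sup>2)" by simp
qed measurable

lemma bounded_on_compact_support:
  fixes h :: "'a::euclidean_space \<Rightarrow> real"
  assumes "continuous_on UNIV h" "compact A" "\<And>x. x \<notin> A \<Longrightarrow> h x = 0"
  obtains K where "K \<ge> 0" "\<And>x. \<bar>h x\<bar> \<le> K * indicator A x"
proof -
  have "compact (h ` A)" using assms by (meson compact_continuous_image continuous_on_subset top_greatest)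
  then obtain K where "\<forall>y\<in>h ` A. norm y \<le> K" using compact_imp_bounded bounded_iff by metis
  then have "\<bar>h x\<bar> \<le> max 0 K * indicator A x" for x
    using assms(3)[of x] by (cases "x \<in> A") force+
  then show thesis using that[of "max 0 K"] by auto
qed

lemma integrable_square_bounded_support:
  fixes h :: "'a::euclidean_space \<Rightarrow> real"
  assumes [measurable]: "h \<in> borel_measurable borel" "A \<in> sets borel" and A: "emeasure lborel A < \<infinity>"
    and b: "\<And>x. \<bar>h x\<bar> \<le> K * indicator A x"
  shows "integrable lborel (\<lambda>x. (h x)\<^sup>2)"
proof (rule Bochner_Integration.integrable_bound)
  show "integrable lborel (\<lambda>x. K\<^sup>2 * indicator A x)" using A by simp
  have "(h x)\<^sup>2 \<le> K\<^sup>2 * indicator A x" for x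
    using power_mono[OF b[of x], of 2] by (auto simp: power_mult_distrib indicator_def)
  then show "AE x in lborel. norm ((h x)\<^sup>2) \<le> norm (K\<^sup>2 * indicator A x)" by simp
qed measurable

text \<open>For the smooth step \<open>g\<close>, the first factor falls from 1 to 0 across a layer
  of width \<open>1 / k\<close> above \<open>m0\<close>. The factor \<open>g (- m - R)\<close> only
  makes the support compact in \<open>m\<close>: it equals 1 for \<open>m \<ge> - R\<close>, hence
  at every point of the wedge lying over the support of the spatial factor.\<close>

lemma smooth_step_scaled:
  fixes g g' g'' :: "real \<Rightarrow> real"
  assumes g: "\<And>s. (g has_real_derivative g' s) (at s)" "\<And>s. (g' has_real_derivative g'' s) (at s)"
    "continuous_on UNIV g''"
  obtains G'' where
    "\<And>m. ((\<lambda>m. g (k * (m - m0)) * g (- m - R)) has_real_derivative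
        k * g' (k * (m - m0)) * g (- m - R) - g (k * (m - m0)) * g' (- m - R)) (at m)"
    "\<And>m. ((\<lambda>m. k * g' (k * (m - m0)) * g (- m - R) - g (k * (m - m0)) * g' (- m - R)) has_real_derivative G'' m) (at m)"
    "continuous_on UNIV G''"
proof -
  have c: "continuous_on UNIV g" "continuous_on UNIV g'"
    by (rule DERIV_continuous_on, rule has_field_derivative_at_within, rule g)+
  have a1: "((\<lambda>m. k * (m - m0)) has_real_derivative k) (at m)" for m :: real
    by (auto intro!: derivative_eq_intros)
  have a2: "((\<lambda>m. - m - R) has_real_derivative -1) (at m)" for m :: real
    by (auto intro!: derivative_eq_intros)
  note d = DERIV_chain'[OF a1 g(1)] DERIV_chain'[OF a2 g(1)] DERIV_chain'[OF a1 g(2)] DERIV_chain'[OF a2 g(2)]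
  let ?G'' = "\<lambda>m. (k * k * g'' (k * (m - m0)) * g (- m - R) - 2 * k * g' (k * (m - m0)) * g' (- m - R)) + g (k * (m - m0)) * g'' (- m - R)"
  show thesis
  proof (rule that[of ?G''])
    show "((\<lambda>m. g (k * (m - m0)) * g (- m - R)) has_real_derivative
        k * g' (k * (m - m0)) * g (- m - R) - g (k * (m - m0)) * g' (- m - R)) (at m)" for m
      by (rule DERIV_cong[OF DERIV_mult[OF d(1) d(2)]]) (simp add: mult_ac)
    show "((\<lambda>m. k * g' (k * (m - m0)) * g (- m - R) - g (k * (m - m0)) * g' (- m - R)) has_real_derivative ?G'' m) (at m)" for m
      by (rule DERIV_cong[OF DERIV_diff[OF DERIV_mult[OF DERIV_cmult[OF d(3), of k] d(2)] DERIV_mult[OF d(1) d(4)]]]) (simp add: algebra_simps)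
    show "continuous_on UNIV ?G''"
      by (intro continuous_intros continuous_on_compose2[OF c(1)] continuous_on_compose2[OF c(2)] continuous_on_compose2[OF g(3)]) auto
  qed
qed

section \<open>The sine basis of a box\<close>

definition esin :: "('d \<Rightarrow> real) \<Rightarrow> real \<Rightarrow> ('d \<Rightarrow> nat) \<Rightarrow> 'd \<Rightarrow> real \<Rightarrow> real" where
  "esin a R k i s = sin (real (k i) * ((s - a i) / R))"

definition ecos :: "('d \<Rightarrow> real) \<Rightarrow> real \<Rightarrow> ('d \<Rightarrow> nat) \<Rightarrow> 'd \<Rightarrow> real \<Rightarrow> real" where
  "ecos a R k i s = real (k i) / R * cos (real (k i) * ((s - a i) / R))"

definition pibox :: "('d \<Rightarrow> real) \<Rightarrow> real \<Rightarrow> (real^'d) set" where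
  "pibox a R = cbox (\<chi> i. a i) (\<chi> i. a i + pi * R)"

lemma indicator_pibox: "indicator (pibox a R) x = tens (\<lambda>i. indicator {a i..a i + pi * R}) x"
proof (cases "x \<in> pibox a R")
  case True
  then show ?thesis by (auto simp: pibox_def mem_box_cart tens_def intro!: prod.neutral[symmetric])
next
  case False
  then obtain i where "\<not> (a i \<le> x $ i \<and> x $ i \<le> a i + pi * R)" by (auto simp: pibox_def mem_box_cart)
  then have "indicator {a i..a i + pi * R} (x $ i) = (0::real)" by (auto simp: indicator_def)
  then show ?thesis using False by (simp add: tens_split[of _ _ i])
qed

text \<open>The frequency is an integer and not a natural number, since the product-to-sum formulas
  use it at \<open>k i - l i\<close> as well as at \<open>k i + l i\<close>.\<close>

lemma has_integral_cos_period:
  assumes R: "R > 0"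
  shows "has_bochner_integral lborel (\<lambda>s. cos (real_of_int n * ((s - a) / R)) * indicator {a..a + pi * R} s)
    (if n = 0 then pi * R else 0)"
proof (cases "n = 0")
  case True
  have "has_bochner_integral lborel (indicator {a..a + pi * R} :: real \<Rightarrow> real) (measure lborel {a..a + pi * R})"
    using R by (intro has_bochner_integral_real_indicator) auto
  then show ?thesis using True R by simp
next
  case False
  have "has_bochner_integral lborel (\<lambda>s. cos (real_of_int n * ((s - a) / R)) * indicator {a..a + pi * R} s)
    ((\<lambda>s. R / real_of_int n * sin (real_of_int n * ((s - a) / R))) (a + pi * R)
     - (\<lambda>s. R / real_of_int n * sin (real_of_int n * ((s - a) / R))) a)"
    using R False by (intro has_bochner_integral_FTC_Icc_real)
     (auto intro!: derivative_eq_intros continuous_intros)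
  moreover have "sin (real_of_int n * ((a + pi * R - a) / R)) = 0"
    using R by (simp add: mult.commute[of _ pi] sin_int_times_real sin_zero_iff_int2)
  ultimately show ?thesis using False by simp
qed

lemma esin_orthogonal_1d:
  assumes R: "R > 0"
  shows "has_bochner_integral lborel (\<lambda>s. indicator {a i..a i + pi * R} s * (esin a R k i s * esin a R l i s))
    (if k i = l i \<and> k i \<noteq> 0 then pi * R / 2 else 0)"
proof -
  let ?c = "\<lambda>n s. cos (real_of_int n * ((s - a i) / R)) * indicator {a i..a i + pi * R} s"
  let ?n = "int (k i) - int (l i)" and ?m = "int (k i) + int (l i)"
  have "has_bochner_integral lborel (\<lambda>s. 1/2 * (?c ?n s - ?c ?m s))
    (1/2 * ((if ?n = 0 then pi * R else 0) - (if ?m = 0 then pi * R else 0)))"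
    by (intro has_bochner_integral_mult_right has_bochner_integral_diff has_integral_cos_period R)
  moreover have "1/2 * (?c ?n s - ?c ?m s) = indicator {a i..a i + pi * R} s * (esin a R k i s * esin a R l i s)" for s
    unfolding esin_def sin_times_sin by (simp add: algebra_simps diff_divide_distrib)
  \<comment> \<open>\<open>?m = 0\<close> forces both indices to be 0. The two terms then cancel,
    which is the right value for the zero function.\<close>
  moreover have "1/2 * ((if ?n = 0 then pi * R else 0) - (if ?m = 0 then pi * R else 0))
     = (if k i = l i \<and> k i \<noteq> 0 then pi * R / 2 else 0)" by auto
  ultimately show ?thesis by simp
qed

lemma ecos_orthogonal_1d:
  assumes R: "R > 0"
  shows "has_bochner_integral lborel (\<lambda>s. indicator {a i..a i + pi * R} s * (ecos a R k i s * ecos a R l i s))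
    ((real (k i) / R)\<^sup>2 * (if k i = l i \<and> k i \<noteq> 0 then pi * R / 2 else 0))"
proof -
  let ?c = "\<lambda>n s. cos (real_of_int n * ((s - a i) / R)) * indicator {a i..a i + pi * R} s"
  let ?n = "int (k i) - int (l i)" and ?m = "int (k i) + int (l i)"
  let ?C = "real (k i) / R * (real (l i) / R) / 2"
  have "has_bochner_integral lborel (\<lambda>s. ?C * (?c ?n s + ?c ?m s))
    (?C * ((if ?n = 0 then pi * R else 0) + (if ?m = 0 then pi * R else 0)))"
    by (intro has_bochner_integral_mult_right has_bochner_integral_add has_integral_cos_period R)
  moreover have "?C * (?c ?n s + ?c ?m s) = indicator {a i..a i + pi * R} s * (ecos a R k i s * ecos a R l i s)" for s
  proof -
    have "cos (real (k i) * ((s - a i) / R)) * cos (real (l i) * ((s - a i) / R))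
       = (cos (real_of_int ?n * ((s - a i) / R)) + cos (real_of_int ?m * ((s - a i) / R))) / 2"
      unfolding cos_times_cos by (simp add: algebra_simps diff_divide_distrib)
    moreover have "ecos a R k i s * ecos a R l i s = (real (k i) / R * (real (l i) / R))
       * (cos (real (k i) * ((s - a i) / R)) * cos (real (l i) * ((s - a i) / R)))"
      unfolding ecos_def by (simp only: mult_ac)
    ultimately have "ecos a R k i s * ecos a R l i s
       = ?C * (cos (real_of_int ?n * ((s - a i) / R)) + cos (real_of_int ?m * ((s - a i) / R)))"
      by (simp only: times_divide_eq_left times_divide_eq_right)
    then show ?thesis by (simp add: algebra_simps)
  qed
  moreover have "?C * ((if ?n = 0 then pi * R else 0) + (if ?m = 0 then pi * R else 0))
     = (real (k i) / R)\<^sup>2 * (if k i = l i \<and> k i \<noteq> 0 then pi * R / 2 else 0)"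
    by (auto simp: power2_eq_square)
  ultimately show ?thesis by simp
qed

definition ebase :: "('d::finite \<Rightarrow> real) \<Rightarrow> real \<Rightarrow> ('d \<Rightarrow> nat) \<Rightarrow> real^'d \<Rightarrow> real" where
  "ebase a R k = tens (esin a R k)"

definition dbase :: "('d::finite \<Rightarrow> real) \<Rightarrow> real \<Rightarrow> 'd \<Rightarrow> ('d \<Rightarrow> nat) \<Rightarrow> real^'d \<Rightarrow> real" where
  "dbase a R i k = tens ((esin a R k)(i := ecos a R k i))"

text \<open>The squared \<open>L^2\<close> norm of \<open>ebase a R k\<close> over the box, as
  \<open>ebase_orthogonal\<close> shows.\<close>

definition enorm :: "real \<Rightarrow> ('d::finite \<Rightarrow> nat) \<Rightarrow> real" where
  "enorm R k = (\<Prod>i\<in>UNIV. if k i = 0 then 0 else pi * R / 2)"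

lemma enorm_nonneg: "R > 0 \<Longrightarrow> enorm R k \<ge> 0"
  unfolding enorm_def by (intro prod_nonneg) auto

lemma has_bochner_integral_tens:
  fixes f :: "'d::finite \<Rightarrow> real \<Rightarrow> real"
  assumes "\<And>i. has_bochner_integral lborel (f i) (c i)"
  shows "has_bochner_integral lborel (tens f) (\<Prod>i\<in>UNIV. c i)"
  using integral_tens[of f] assms by (auto simp: has_bochner_integral_iff)

lemma ebase_orthogonal:
  assumes R: "R > 0"
  shows "has_bochner_integral lborel (\<lambda>x. indicator (pibox a R) x * (ebase a R k x * ebase a R l x))
     (if k = l then enorm R k else 0)"
proof -
  have "has_bochner_integral lborel (tens (\<lambda>i s. indicator {a i..a i + pi * R} s * (esin a R k i s * esin a R l i s)))
     (\<Prod>i\<in>UNIV. if k i = l i \<and> k i \<noteq> 0 then pi * R / 2 else 0)"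
    by (intro has_bochner_integral_tens esin_orthogonal_1d R)
  moreover have "tens (\<lambda>i s. indicator {a i..a i + pi * R} s * (esin a R k i s * esin a R l i s))
     = (\<lambda>x. indicator (pibox a R) x * (ebase a R k x * ebase a R l x))"
    by (rule ext) (simp only: tens_mult indicator_pibox ebase_def)
  moreover have "(\<Prod>i\<in>UNIV. if k i = l i \<and> k i \<noteq> 0 then pi * R / 2 else 0) = (if k = l then enorm R k else 0)"
  proof (cases "k = l")
    case True then show ?thesis unfolding enorm_def by (auto intro!: prod.cong)
  next
    case False
    then obtain i where "k i \<noteq> l i" by auto
    then show ?thesis using False by (auto intro!: prod_zero)
  qed
  ultimately show ?thesis by (simp only:)
qed

text \<open>The partial derivatives of the modes stay orthogonal, with the additional weight of the
  squared frequency. This lets the gradient of the dual function be estimated mode by mode.\<close>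

lemma dbase_orthogonal:
  assumes R: "R > 0"
  shows "has_bochner_integral lborel (\<lambda>x. indicator (pibox a R) x * (dbase a R j k x * dbase a R j l x))
     (if k = l then (real (k j) / R)\<^sup>2 * enorm R k else 0)"
proof -
  let ?f = "\<lambda>k. (esin a R k)(j := ecos a R k j)"
  let ?c = "\<lambda>i. (if i = j then (real (k j) / R)\<^sup>2 else 1) * (if k i = l i \<and> k i \<noteq> 0 then pi * R / 2 else 0)"
  have "has_bochner_integral lborel (tens (\<lambda>i s. indicator {a i..a i + pi * R} s * (?f k i s * ?f l i s)))
     (\<Prod>i\<in>UNIV. ?c i)"
  proof (rule has_bochner_integral_tens)
    fix i show "has_bochner_integral lborel (\<lambda>s. indicator {a i..a i + pi * R} s * (?f k i s * ?f l i s)) (?c i)"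
      using esin_orthogonal_1d[OF R, of a i k l] ecos_orthogonal_1d[OF R, of a i k l] by (cases "i = j") auto
  qed
  moreover have "tens (\<lambda>i s. indicator {a i..a i + pi * R} s * (?f k i s * ?f l i s))
     = (\<lambda>x. indicator (pibox a R) x * (dbase a R j k x * dbase a R j l x))"
    by (rule ext) (simp only: tens_mult indicator_pibox dbase_def)
  moreover have "(\<Prod>i\<in>UNIV. ?c i) = (if k = l then (real (k j) / R)\<^sup>2 * enorm R k else 0)"
  proof (cases "k = l")
    case True
    then have "(\<Prod>i\<in>UNIV. if k i = l i \<and> k i \<noteq> 0 then pi * R / 2 else 0) = enorm R k"
      unfolding enorm_def by (auto intro!: prod.cong)
    then show ?thesis using True unfolding prod.distrib by (simp add: prod.delta)
  next
    case False
    then obtain i where "k i \<noteq> l i" by auto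
    then show ?thesis using False by (auto intro!: prod_zero)
  qed
  ultimately show ?thesis by (simp only:)
qed

section \<open>Sine sums with time-dependent coefficients and their density\<close>

definition trigV :: "('d::finite \<Rightarrow> real) \<Rightarrow> real \<Rightarrow> (real \<times> (real^'d) \<Rightarrow> real) set" where
  "trigV a R = {F. \<exists>K \<zeta>. finite K \<and> (\<forall>k. continuous_on UNIV (\<zeta> k)) \<and>
      F = (\<lambda>z. \<Sum>k\<in>K. \<zeta> k (fst z) * ebase a R k (snd z))}"

lemma trigV_term:
  assumes "continuous_on UNIV \<zeta>" shows "(\<lambda>z. \<zeta> (fst z) * ebase a R k (snd z)) \<in> trigV a R"
  unfolding trigV_def using assms by (auto intro!: exI[of _ "{k}"] exI[of _ "\<lambda>_. \<zeta>"])

lemma trigV_add: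
  assumes "F \<in> trigV a R" "G \<in> trigV a R" shows "(\<lambda>z. F z + G z) \<in> trigV a R"
proof -
  obtain K \<zeta> where 1: "finite K" "\<And>k. continuous_on UNIV (\<zeta> k)" "F = (\<lambda>z. \<Sum>k\<in>K. \<zeta> k (fst z) * ebase a R k (snd z))"
    using assms(1) unfolding trigV_def by blast
  obtain L \<xi> where 2: "finite L" "\<And>k. continuous_on UNIV (\<xi> k)" "G = (\<lambda>z. \<Sum>k\<in>L. \<xi> k (fst z) * ebase a R k (snd z))"
    using assms(2) unfolding trigV_def by blast
  define \<eta> where "\<eta> k t = (if k \<in> K then \<zeta> k t else 0) + (if k \<in> L then \<xi> k t else 0)" for k t
  have "continuous_on UNIV (\<eta> k)" for k
    unfolding \<eta>_def using 1(2) 2(2) by (cases "k \<in> K"; cases "k \<in> L") (auto intro!: continuous_intros)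
  moreover have "F z + G z = (\<Sum>k\<in>K \<union> L. \<eta> k (fst z) * ebase a R k (snd z))" for z
  proof -
    have "F z = (\<Sum>k\<in>K \<union> L. (if k \<in> K then \<zeta> k (fst z) else 0) * ebase a R k (snd z))"
      unfolding 1(3) using 1(1) 2(1) by (intro sum.mono_neutral_cong_left) auto
    moreover have "G z = (\<Sum>k\<in>K \<union> L. (if k \<in> L then \<xi> k (fst z) else 0) * ebase a R k (snd z))"
      unfolding 2(3) using 1(1) 2(1) by (intro sum.mono_neutral_cong_left) auto
    ultimately show ?thesis by (simp add: \<eta>_def distrib_right sum.distrib)
  qed
  ultimately show ?thesis unfolding trigV_def using 1(1) 2(1)
    by (auto intro!: exI[of _ "K \<union> L"] exI[of _ \<eta>])
qed

lemma trigV_sum: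
  assumes "\<And>k. k \<in> K \<Longrightarrow> F k \<in> trigV a R" shows "(\<lambda>z. \<Sum>k\<in>K. F k z) \<in> trigV a R"
  using assms
proof (induction K rule: infinite_finite_induct)
  case (insert x K) then show ?case by (simp add: trigV_add)
qed (use trigV_term[of "\<lambda>_. 0" a R] in auto)

text \<open>A cosine times the sine of frequency \<open>k\<close> is the mean of the sines of
  frequencies \<open>k + 1\<close> and \<open>k - 1\<close>. So the sine sums form a module over the
  polynomials in the cosines, and the next lemma rests on this module structure.\<close>

lemma trigV_cos_mult:
  fixes a :: "'d::finite \<Rightarrow> real"
  assumes "F \<in> trigV a R" shows "(\<lambda>z. cos ((snd z $ i - a i) / R) * F z) \<in> trigV a R"
proof -
  obtain K \<zeta> where 1: "finite K" "\<And>k. continuous_on UNIV (\<zeta> k)" "F = (\<lambda>z. \<Sum>k\<in>K. \<zeta> k (fst z) * ebase a R k (snd z))"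
    using assms(1) unfolding trigV_def by blast
  have "(\<lambda>z. cos ((snd z $ i - a i) / R) * (\<zeta> k (fst z) * ebase a R k (snd z))) \<in> trigV a R" for k
  \<comment> \<open>Frequency 0 is separated because \<open>k i - 1\<close> is truncated
    subtraction; the mode vanishes in that case.\<close>
  proof (cases "k i = 0")
    case True
    then have "ebase a R k x = 0" for x by (simp add: ebase_def tens_split[of _ _ i] esin_def)
    then show ?thesis using trigV_term[of "\<lambda>_. 0" a R] by simp
  next
    case False
    have upd: "ebase a R (k(i := n)) x = sin (real n * ((x $ i - a i) / R)) * (\<Prod>j\<in>UNIV - {i}. esin a R k j (x $ j))" for n x
    proof -
      have "(\<Prod>j\<in>UNIV - {i}. esin a R (k(i := n)) j (x $ j)) = (\<Prod>j\<in>UNIV - {i}. esin a R k j (x $ j))"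
        by (rule prod.cong) (auto simp: esin_def)
      then show ?thesis by (simp add: ebase_def tens_split[of _ _ i]) (simp add: esin_def)
    qed
    have "cos \<tau> * sin (real (k i) * \<tau>) = (sin (real (k i + 1) * \<tau>) + sin (real (k i - 1) * \<tau>)) / 2" for \<tau>
      using False sin_times_cos[of "real (k i) * \<tau>" \<tau>] by (simp add: of_nat_diff algebra_simps)
    note cs = this
    have "cos ((x $ i - a i) / R) * ebase a R k x = 1/2 * ebase a R (k(i := k i + 1)) x + 1/2 * ebase a R (k(i := k i - 1)) x" for x
    proof -
      have "cos ((x $ i - a i) / R) * ebase a R k x
         = (cos ((x $ i - a i) / R) * sin (real (k i) * ((x $ i - a i) / R))) * (\<Prod>j\<in>UNIV - {i}. esin a R k j (x $ j))"
        using upd[of "k i" x] by (simp only: fun_upd_triv mult.assoc)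
      then show ?thesis unfolding cs upd by (simp only: add_divide_distrib distrib_right)
    qed
    then have "cos ((snd z $ i - a i) / R) * (\<zeta> k (fst z) * ebase a R k (snd z))
       = (1/2 * \<zeta> k (fst z)) * ebase a R (k(i := k i + 1)) (snd z) + (1/2 * \<zeta> k (fst z)) * ebase a R (k(i := k i - 1)) (snd z)" for z
      by (simp add: mult.left_commute[of "cos _"] distrib_left)
    then show ?thesis by (simp only:) (intro trigV_add trigV_term continuous_intros 1)
  qed
  then show ?thesis unfolding 1(3) sum_distrib_left by (intro trigV_sum)
qed

lemma trigV_time_mult:
  assumes "F \<in> trigV a R" "continuous_on UNIV c" shows "(\<lambda>z. c (fst z) * F z) \<in> trigV a R"
proof -
  obtain K \<zeta> where 1: "finite K" "\<And>k. continuous_on UNIV (\<zeta> k)" "F = (\<lambda>z. \<Sum>k\<in>K. \<zeta> k (fst z) * ebase a R k (snd z))"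
    using assms(1) unfolding trigV_def by blast
  show ?thesis unfolding 1(3) sum_distrib_left mult.assoc[symmetric]
    by (intro trigV_sum trigV_term continuous_intros 1 assms)
qed

text \<open>Stone-Weierstrass cannot be applied to \<open>trigV\<close> itself: its members vanish
  on the faces of the box, so constants are missing. It is applied to the algebra \<open>Q\<close>
  of multipliers of \<open>trigV\<close>, which contains the constants, the time variable and the
  cosines. The approximating multiplier then enters \<open>trigV\<close> through its product with
  the lowest mode.\<close>

lemma trigV_uniform_approx:
  fixes a :: "'d::finite \<Rightarrow> real" and g :: "real \<times> (real^'d) \<Rightarrow> real"
  assumes R: "R > 0" and g: "continuous_on ({0..T} \<times> pibox a R) g" and e: "e > 0"
  obtains h where "continuous_on UNIV h" "(\<lambda>z. h z * ebase a R (\<lambda>_. 1) (snd z)) \<in> trigV a R"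
    "\<And>z. z \<in> {0..T} \<times> pibox a R \<Longrightarrow> \<bar>g z - h z\<bar> < e"
proof -
  define Q where "Q h \<longleftrightarrow> continuous_on UNIV h \<and> (\<forall>F\<in>trigV a R. (\<lambda>z. h z * F z) \<in> trigV a R)" for h
  have cont: "continuous_on S h" if "Q h" for h S using that by (auto simp: Q_def intro: continuous_on_subset)
  have "\<exists>h. Q h \<and> (\<forall>z\<in>{0..T} \<times> pibox a R. \<bar>g z - h z\<bar> < e)"
  proof (rule Stone_Weierstrass_HOL)
    show "compact ({0..T} \<times> pibox a R)" unfolding pibox_def by (intro compact_Times) auto
    show "Q (\<lambda>x. c)" for c unfolding Q_def using trigV_time_mult[of _ a R "\<lambda>_. c"] by auto
    show "Q (\<lambda>x. f x + g x)" if "Q f \<and> Q g" for f g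
      using that trigV_add[of "\<lambda>z. f z * F z" a R "\<lambda>z. g z * F z" for F]
      unfolding Q_def distrib_right by (auto intro!: continuous_intros)
    show "Q (\<lambda>x. f x * g x)" if "Q f \<and> Q g" for f g
      using that unfolding Q_def mult.assoc by (auto intro!: continuous_intros)
    show "\<exists>f. Q f \<and> f x \<noteq> f y" if xy: "x \<in> {0..T} \<times> pibox a R \<and> y \<in> {0..T} \<times> pibox a R \<and> x \<noteq> y" for x y
    proof (cases "fst x = fst y")
      case False
      moreover have "Q fst" unfolding Q_def using trigV_time_mult[of _ a R "\<lambda>t. t"] by (auto intro!: continuous_intros)
      ultimately show ?thesis by blast
    next
      case True
      then obtain i where i: "snd x $ i \<noteq> snd y $ i" using xy by (metis prod_eqI vec_eq_iff)
      \<comment> \<open>In the box the rescaled coordinate runs through \<open>[0, pi]\<close>,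
        where the cosine is injective; this is why cosines separate points.\<close>
      have "0 \<le> (snd z $ i - a i) / R \<and> (snd z $ i - a i) / R \<le> pi" if "z \<in> {0..T} \<times> pibox a R" for z
        using that R by (auto simp: pibox_def mem_box_cart field_simps)
      moreover have "(snd x $ i - a i) / R \<noteq> (snd y $ i - a i) / R" using i R by simp
      ultimately have "cos ((snd x $ i - a i) / R) \<noteq> cos ((snd y $ i - a i) / R)"
        using xy cos_inj_pi[of "(snd x $ i - a i) / R" "(snd y $ i - a i) / R"] by blast
      moreover have "Q (\<lambda>z. cos ((snd z $ i - a i) / R))"
        unfolding Q_def using trigV_cos_mult R by (auto intro!: continuous_intros)
      ultimately show ?thesis by blast
    qed
  qed (use cont g e in auto)
  then obtain h where h: "Q h" "\<And>z. z \<in> {0..T} \<times> pibox a R \<Longrightarrow> \<bar>g z - h z\<bar> < e" by blast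
  moreover have "(\<lambda>z. ebase a R (\<lambda>_. 1) (snd z)) \<in> trigV a R" using trigV_term[of "\<lambda>_. 1" a R "\<lambda>_. 1"] by simp
  ultimately show thesis using that[of h] by (auto simp: Q_def)
qed

lemma ebase_continuous: "R > 0 \<Longrightarrow> continuous_on UNIV (ebase a R k)"
  unfolding ebase_def by (intro continuous_on_tens) (auto simp: esin_def intro!: continuous_intros)

lemma power2_add_le: "(x + y)\<^sup>2 \<le> 2 * x\<^sup>2 + 2 * (y::real)\<^sup>2"
  using zero_le_power2[of "x - y"] unfolding power2_sum power2_diff by linarith

text \<open>The lowest mode \<open>w\<close> is positive wherever \<open>u\<close> is nonzero, so it
  suffices to approximate the quotient of \<open>u\<close> by \<open>w\<close>. Three errors arise:
  making the quotient bounded, making it continuous, and replacing it by a multiplier.\<close>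

lemma trigV_dense_L2:
  fixes a :: "'d::finite \<Rightarrow> real" and u :: "real \<times> (real^'d) \<Rightarrow> real"
  assumes R: "R > 0" and u [measurable]: "u \<in> borel_measurable borel" and ui: "integrable lborel (\<lambda>z. (u z)\<^sup>2)"
    and supp: "\<And>z. u z \<noteq> 0 \<Longrightarrow> z \<in> {0..T} \<times> pibox a R \<and> ebase a R (\<lambda>_. 1) (snd z) > 0"
    and d: "d > 0"
  obtains F where "F \<in> trigV a R" "(\<integral>z. indicator ({0..T} \<times> pibox a R) z * (u z - F z)\<^sup>2 \<partial>lborel) < d"
proof -
  define S where "S = {0..T} \<times> pibox a R"
  define w where "w z = ebase a R (\<lambda>_. 1) (snd z)" for z :: "real \<times> (real^'d)"
  have S: "compact S" unfolding S_def pibox_def by (intro compact_Times) auto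
  then have Sm [measurable]: "S \<in> sets borel" by (intro borel_compact)
  have Sf: "emeasure lborel S < \<infinity>" by (rule emeasure_bounded_finite[OF compact_imp_bounded[OF S]])
  have wc: "continuous_on UNIV w"
    unfolding w_def using ebase_continuous[OF R] by (intro continuous_on_compose2[OF ebase_continuous[OF R]] continuous_intros) auto
  then have [measurable]: "w \<in> borel_measurable borel" by (rule borel_measurable_continuous_onI)
  have w1: "\<bar>w z\<bar> \<le> 1" for z unfolding w_def ebase_def by (intro abs_tens_le_1) (simp add: esin_def)
  have su: "z \<in> S" "w z > 0" if "u z \<noteq> 0" for z using supp[OF that] by (auto simp: S_def w_def)
  \<comment> \<open>Keeping only the points with \<open>\<bar>u z\<bar> \<le> n\<close> and
    \<open>w z > 1 / n\<close> bounds the quotient by \<open>n\<^sup>2\<close>, the constant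
    \<open>b\<close> below.\<close>
  define U where "U n z = (if \<bar>u z\<bar> \<le> real n \<and> 1 < real n * w z then u z else 0)" for n z
  have [measurable]: "U n \<in> borel_measurable borel" for n unfolding U_def by measurable
  have "(\<lambda>n. \<integral>z. (u z - U n z)\<^sup>2 \<partial>lborel) \<longlonglongrightarrow> (\<integral>z. 0 \<partial>(lborel :: (real \<times> (real^'d)) measure))"
  proof (rule integral_dominated_convergence[OF _ _ ui])
    show "AE z in lborel. (\<lambda>n. (u z - U n z)\<^sup>2) \<longlonglongrightarrow> 0"
    proof (rule AE_I2)
      fix z
      have "\<forall>\<^sub>F n in sequentially. U n z = u z"
      proof (cases "u z = 0")
        case False
        have "\<forall>\<^sub>F n in sequentially. real n \<ge> max \<bar>u z\<bar> (2 / w z)"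
          by (rule eventually_ge_at_top[THEN filterlim_real_sequentially[unfolded filterlim_iff, rule_format]])
        then show ?thesis
        proof eventually_elim
          case (elim n)
          then have "2 / w z \<le> real n" by simp
          then have "2 \<le> real n * w z" using su(2)[OF False] by (simp add: field_simps)
          then show ?case using elim by (simp add: U_def)
        qed
      qed (simp add: U_def)
      then have "\<forall>\<^sub>F n in sequentially. (u z - U n z)\<^sup>2 = 0" by (rule eventually_mono) simp
      then show "(\<lambda>n. (u z - U n z)\<^sup>2) \<longlonglongrightarrow> 0" by (rule tendsto_eventually)
    qed
    show "AE z in lborel. norm ((u z - U n z)\<^sup>2) \<le> (u z)\<^sup>2" for n
      by (rule AE_I2) (simp add: U_def)
  qed measurable
  then have "\<forall>\<^sub>F n in sequentially. (\<integral>z. (u z - U n z)\<^sup>2 \<partial>lborel) < d / 16"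
    by (rule order_tendstoD(2)) (use d in simp)
  then obtain n where n: "(\<integral>z. (u z - U n z)\<^sup>2 \<partial>lborel) < d / 16" by (auto simp: eventually_sequentially)
  define v where "v z = U n z / w z" for z
  define b where "b = (real n)\<^sup>2"
  have vb: "\<bar>v z\<bar> \<le> b" for z
  proof (cases "U n z = 0")
    case False
    then have 1: "\<bar>u z\<bar> \<le> real n" "1 < real n * w z" "U n z = u z" by (auto simp: U_def split: if_splits)
    then have wp: "w z > 0" by (smt (verit) mult_nonneg_nonpos of_nat_0_le_iff)
    have "\<bar>v z\<bar> = \<bar>u z\<bar> * (1 / w z)" using 1 wp by (simp add: v_def abs_mult)
    also have "\<dots> \<le> real n * real n" using 1 wp by (intro mult_mono) (auto simp: field_simps)
    finally show ?thesis by (simp add: b_def power2_eq_square)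
  qed (simp add: v_def b_def)
  have Uw: "U n z = v z * w z" for z
  proof (cases "U n z = 0")
    case False
    then have "w z \<noteq> 0" by (auto simp: U_def split: if_splits)
    then show ?thesis by (simp add: v_def)
  qed (simp add: v_def)
  have vm [measurable]: "v \<in> borel_measurable borel" unfolding v_def by measurable
  \<comment> \<open>The detour through Lebesgue measurability leads to \<open>measurable_on\<close>,
    which supplies continuous functions converging to \<open>v\<close> off a negligible set.\<close>
  then have "v \<in> borel_measurable lebesgue" by (simp add: measurable_completion)
  then have "v measurable_on UNIV" by (rule lebesgue_measurable_imp_measurable_on_real) simp
  then obtain N \<gamma> where N: "negligible N" and \<gamma>: "\<And>j. continuous_on UNIV (\<gamma> j)"
    and lim: "\<And>z. z \<notin> N \<Longrightarrow> (\<lambda>j. \<gamma> j z) \<longlonglongrightarrow> v z"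
    unfolding measurable_on_def by auto
  \<comment> \<open>Clamping preserves continuity and, as \<open>v\<close> takes values in
    \<open>[-b, b]\<close>, also the limit; it provides the majorant for dominated
    convergence.\<close>
  define \<kappa> where "\<kappa> j z = max (- b) (min b (\<gamma> j z))" for j :: nat and z
  have \<kappa>c: "continuous_on UNIV (\<kappa> j)" for j unfolding \<kappa>_def by (intro continuous_intros \<gamma>)
  then have [measurable]: "\<kappa> j \<in> borel_measurable borel" for j by (rule borel_measurable_continuous_onI)
  have b0: "b \<ge> 0" by (simp add: b_def)
  have \<kappa>b: "\<bar>\<kappa> j z\<bar> \<le> b" for j z using b0 by (auto simp: \<kappa>_def)
  have \<kappa>lim: "(\<lambda>j. \<kappa> j z) \<longlonglongrightarrow> v z" if "z \<notin> N" for z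
  proof -
    have "(\<lambda>j. \<kappa> j z) \<longlonglongrightarrow> max (- b) (min b (v z))"
      unfolding \<kappa>_def by (intro tendsto_intros lim that)
    moreover have "max (- b) (min b (v z)) = v z" using vb[of z] by auto
    ultimately show ?thesis by simp
  qed
  have ae: "AE z in lborel. z \<notin> N"
    using AE_not_in[OF N[unfolded negligible_iff_null_sets]] by (simp add: AE_completion_iff)
  have "(\<lambda>j. \<integral>z. indicator S z * (\<kappa> j z - v z)\<^sup>2 \<partial>lborel) \<longlonglongrightarrow> (\<integral>z. 0 \<partial>(lborel :: (real \<times> (real^'d)) measure))"
  proof (rule integral_dominated_convergence)
    show "integrable lborel (\<lambda>z. (2 * b)\<^sup>2 * indicator S z)" using Sf by simp
    show "AE z in lborel. (\<lambda>j. indicator S z * (\<kappa> j z - v z)\<^sup>2) \<longlonglongrightarrow> 0"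
      using ae
    proof eventually_elim
      case (elim z)
      have "(\<lambda>j. indicator S z * (\<kappa> j z - v z)\<^sup>2) \<longlonglongrightarrow> indicator S z * (v z - v z)\<^sup>2"
        by (intro tendsto_intros \<kappa>lim elim)
      then show ?case by simp
    qed
    show "AE z in lborel. norm (indicator S z * (\<kappa> j z - v z)\<^sup>2) \<le> (2 * b)\<^sup>2 * indicator S z" for j
    proof (rule AE_I2)
      fix z
      have "\<bar>\<kappa> j z - v z\<bar> \<le> 2 * b" using \<kappa>b[of j z] vb[of z] by linarith
      then have "\<bar>\<kappa> j z - v z\<bar>\<^sup>2 \<le> (2 * b)\<^sup>2" by (intro power_mono) auto
      then show "norm (indicator S z * (\<kappa> j z - v z)\<^sup>2) \<le> (2 * b)\<^sup>2 * indicator S z"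
        by (simp add: indicator_def)
    qed
  qed measurable
  then have "\<forall>\<^sub>F j in sequentially. (\<integral>z. indicator S z * (\<kappa> j z - v z)\<^sup>2 \<partial>lborel) < d / 16"
    by (rule order_tendstoD(2)) (use d in simp)
  then obtain j where j: "(\<integral>z. indicator S z * (\<kappa> j z - v z)\<^sup>2 \<partial>lborel) < d / 16" by (auto simp: eventually_sequentially)
  define \<epsilon> where "\<epsilon> = sqrt (d / (16 * (1 + measure lborel S)))"
  have \<epsilon>: "\<epsilon> > 0" "\<epsilon>\<^sup>2 * measure lborel S \<le> d / 16"
  proof -
    have \<mu>: "1 + measure lborel S > 0" using measure_nonneg[of lborel S] by linarith
    then show "\<epsilon> > 0" using d by (simp add: \<epsilon>_def)
    have "\<epsilon>\<^sup>2 = d / (16 * (1 + measure lborel S))" using d \<mu> by (simp add: \<epsilon>_def)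
    then have "\<epsilon>\<^sup>2 * measure lborel S = d / 16 * (measure lborel S / (1 + measure lborel S))" by simp
    also have "\<dots> \<le> d / 16 * 1" using d \<mu> by (intro mult_left_mono) (auto simp: divide_le_eq_1)
    finally show "\<epsilon>\<^sup>2 * measure lborel S \<le> d / 16" by simp
  qed
  obtain h where h: "continuous_on UNIV h" "(\<lambda>z. h z * w z) \<in> trigV a R" "\<And>z. z \<in> S \<Longrightarrow> \<bar>\<kappa> j z - h z\<bar> < \<epsilon>"
    using trigV_uniform_approx[OF R continuous_on_subset[OF \<kappa>c[of j] subset_UNIV] \<epsilon>(1), where T = T and a = a]
    unfolding S_def w_def by blast
  have [measurable]: "h \<in> borel_measurable borel" by (rule borel_measurable_continuous_onI[OF h(1)])
  let ?b = "\<lambda>z. 2 * (u z - U n z)\<^sup>2 + 2 * (2 * (indicator S z * (\<kappa> j z - v z)\<^sup>2) + 2 * (\<epsilon>\<^sup>2 * indicator S z))"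
  have bound: "indicator S z * (u z - h z * w z)\<^sup>2 \<le> ?b z" for z
  proof (cases "z \<in> S")
    case True
    have "(u z - h z * w z)\<^sup>2 = ((u z - U n z) + (v z - h z) * w z)\<^sup>2" by (simp add: Uw algebra_simps)
    also have "\<dots> \<le> 2 * (u z - U n z)\<^sup>2 + 2 * ((v z - h z) * w z)\<^sup>2" by (rule power2_add_le)
    also have "((v z - h z) * w z)\<^sup>2 \<le> (v z - h z)\<^sup>2"
      using w1[of z] by (simp add: power_mult_distrib mult_left_le abs_square_le_1)
    also have "(v z - h z)\<^sup>2 = ((v z - \<kappa> j z) + (\<kappa> j z - h z))\<^sup>2" by simp
    also have "\<dots> \<le> 2 * (v z - \<kappa> j z)\<^sup>2 + 2 * (\<kappa> j z - h z)\<^sup>2" by (rule power2_add_le)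
    also have "(\<kappa> j z - h z)\<^sup>2 \<le> \<epsilon>\<^sup>2"
      using power_mono[OF less_imp_le[OF h(3)[OF True]], of 2] by simp
    finally show ?thesis using True by (simp add: power2_commute[of "v z"])
  qed simp
  have i1: "integrable lborel (\<lambda>z. (u z - U n z)\<^sup>2)"
    by (rule Bochner_Integration.integrable_bound[OF ui]) (auto simp: U_def)
  have i2: "integrable lborel (\<lambda>z. indicator S z * (\<kappa> j z - v z)\<^sup>2)"
  proof (rule Bochner_Integration.integrable_bound)
    show "integrable lborel (\<lambda>z. (2 * b)\<^sup>2 * indicator S z)" using Sf by simp
    have "\<bar>\<kappa> j z - v z\<bar>\<^sup>2 \<le> (2 * b)\<^sup>2" for z 
      using \<kappa>b[of j z] vb[of z] by (intro power_mono) linarith+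
    then show "AE z in lborel. norm (indicator S z * (\<kappa> j z - v z)\<^sup>2) \<le> norm ((2 * b)\<^sup>2 * indicator S z)"
      by (intro AE_I2) (simp add: indicator_def)
  qed measurable
  have i3: "integrable lborel (\<lambda>z. \<epsilon>\<^sup>2 * indicator S z :: real)" using Sf by simp
  have ib: "integrable lborel ?b"
    by (intro Bochner_Integration.integrable_add integrable_mult_right i1 i2 i3)
  have "(\<integral>z. indicator S z * (u z - h z * w z)\<^sup>2 \<partial>lborel) \<le> (\<integral>z. ?b z \<partial>lborel)"
    by (rule integral_mono[OF Bochner_Integration.integrable_bound[OF ib] ib bound])
      (use order_trans[OF bound abs_ge_self] in auto)
  also have "\<dots> = 2 * (\<integral>z. (u z - U n z)\<^sup>2 \<partial>lborel)
      + 2 * (2 * (\<integral>z. indicator S z * (\<kappa> j z - v z)\<^sup>2 \<partial>lborel) + 2 * (\<epsilon>\<^sup>2 * measure lborel S))"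
    using i1 i2 i3 Sf by simp
  also have "\<dots> < d"
  proof -
    \<comment> \<open>The errors enter with weights 2, 4 and 4, so \<open>d / 16\<close> for each of
      them leaves at most \<open>10 * d / 16\<close>.\<close>
    have "2 * A + 2 * (2 * B + 2 * C) < d" if "A < d / 16" "B < d / 16" "C \<le> d / 16" for A B C :: real
    proof -
      have "16 * A < d" "16 * B < d" "16 * C \<le> d" using that by simp_all
      then show ?thesis using d by argo
    qed
    from this[OF n j \<epsilon>(2)] show ?thesis .
  qed
  finally show thesis using that[OF h(2)] by (simp add: S_def)
qed

section \<open>Energy estimates in time\<close>

lemma has_bochner_integral_product:
  fixes f :: "'a::euclidean_space \<Rightarrow> real" and g :: "'b::euclidean_space \<Rightarrow> real"
  assumes f: "integrable lborel f" and g: "integrable lborel g"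
  shows "has_bochner_integral lborel (\<lambda>z. f (fst z) * g (snd z)) (integral\<^sup>L lborel f * integral\<^sup>L lborel g)"
proof -
  have [measurable]: "f \<in> borel_measurable lborel" "g \<in> borel_measurable lborel" using f g by auto
  have i: "integrable (lborel \<Otimes>\<^sub>M lborel) (\<lambda>z. f (fst z) * g (snd z))"
  proof (rule lborel_pair.Fubini_integrable)
    show "integrable lborel (\<lambda>x. \<integral>y. norm (f (fst (x, y)) * g (snd (x, y))) \<partial>lborel)"
      using f by (simp add: abs_mult)
    show "AE x in lborel. integrable lborel (\<lambda>y. f (fst (x, y)) * g (snd (x, y)))"
      using g by simp
  qed measurable
  moreover have "(\<integral>z. f (fst z) * g (snd z) \<partial>(lborel \<Otimes>\<^sub>M lborel)) = integral\<^sup>L lborel f * integral\<^sup>L lborel g"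
    using lborel_pair.integral_fst'[OF i] by simp
  ultimately show ?thesis by (simp add: has_bochner_integral_iff lborel_prod)
qed

lemma integrable_indicator_Icc_continuous:
  fixes f :: "real \<Rightarrow> real"
  assumes "continuous_on UNIV f"
  shows "integrable lborel (\<lambda>s. indicator {0..T} s * f s)"
  using borel_integrable_atLeastAtMost'[of 0 T f] continuous_on_subset[OF assms]
  by (simp add: set_integrable_def)

text \<open>Parseval's identity for finite sums with time-dependent coefficients. The orthogonal
  family is abstract so that it serves both for the sines and for their partial derivatives.\<close>

lemma has_bochner_integral_orthogonal_sum:
  fixes E :: "'k \<Rightarrow> real^'d::finite \<Rightarrow> real" and \<xi> :: "'k \<Rightarrow> real \<Rightarrow> real"
  assumes K: "finite K"
    and orth: "\<And>k l. has_bochner_integral lborel (\<lambda>x. indicator D x * (E k x * E l x)) (if k = l then n k else 0)"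
    and \<xi>: "\<And>k. continuous_on UNIV (\<xi> k)"
  shows "has_bochner_integral lborel (\<lambda>z. indicator ({0..T} \<times> D) z * (\<Sum>k\<in>K. \<xi> k (fst z) * E k (snd z))\<^sup>2)
    (\<Sum>k\<in>K. n k * (\<integral>s. indicator {0..T} s * (\<xi> k s)\<^sup>2 \<partial>lborel))"
proof -
  have "has_bochner_integral lborel (\<lambda>z. (indicator {0..T} (fst z) * (\<xi> k (fst z) * \<xi> l (fst z))) * (indicator D (snd z) * (E k (snd z) * E l (snd z))))
    ((\<integral>s. indicator {0..T} s * (\<xi> k s * \<xi> l s) \<partial>lborel) * (if k = l then n k else 0))" for k l
    using has_bochner_integral_product[OF integrable_indicator_Icc_continuous[of "\<lambda>s. \<xi> k s * \<xi> l s" T] integrable.intros[OF orth[of k l]]]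
      has_bochner_integral_integral_eq[OF orth[of k l]] \<xi> by (simp add: continuous_intros)
  then have "has_bochner_integral lborel (\<lambda>z. \<Sum>k\<in>K. \<Sum>l\<in>K. (indicator {0..T} (fst z) * (\<xi> k (fst z) * \<xi> l (fst z))) * (indicator D (snd z) * (E k (snd z) * E l (snd z))))
    (\<Sum>k\<in>K. \<Sum>l\<in>K. (\<integral>s. indicator {0..T} s * (\<xi> k s * \<xi> l s) \<partial>lborel) * (if k = l then n k else 0))"
    by (intro has_bochner_integral_sum)
  moreover have "(\<Sum>k\<in>K. \<Sum>l\<in>K. (indicator {0..T} (fst z) * (\<xi> k (fst z) * \<xi> l (fst z))) * (indicator D (snd z) * (E k (snd z) * E l (snd z))))
     = indicator ({0..T} \<times> D) z * (\<Sum>k\<in>K. \<xi> k (fst z) * E k (snd z))\<^sup>2" for z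
  proof -
    have "indicator ({0..T} \<times> D) z * (\<Sum>k\<in>K. \<xi> k (fst z) * E k (snd z))\<^sup>2
      = (\<Sum>k\<in>K. \<Sum>l\<in>K. indicator ({0..T} \<times> D) z * ((\<xi> k (fst z) * E k (snd z)) * (\<xi> l (fst z) * E l (snd z))))"
      unfolding power2_eq_square sum_product unfolding sum_distrib_left ..
    then show ?thesis by (simp add: indicator_times mult_ac)
  qed
  moreover have "(\<Sum>k\<in>K. \<Sum>l\<in>K. (\<integral>s. indicator {0..T} s * (\<xi> k s * \<xi> l s) \<partial>lborel) * (if k = l then n k else 0))
    = (\<Sum>k\<in>K. n k * (\<integral>s. indicator {0..T} s * (\<xi> k s)\<^sup>2 \<partial>lborel))"
    using K by (intro sum.cong refl) (simp add: if_distrib power2_eq_square mult.commute cong: if_cong)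
  ultimately show ?thesis by simp
qed

text \<open>Energy estimate run backwards: the integral of the derivative of
  \<open>\<theta>\<^sup>2\<close> is \<open>- (\<theta> 0)\<^sup>2 \<le> 0\<close>, because
  \<open>\<theta>\<close> vanishes at \<open>T\<close>. That derivative,
  \<open>2 * \<theta> * (c * \<theta> + \<zeta>)\<close>, exceeds
  \<open>c * \<theta>\<^sup>2 - \<zeta>\<^sup>2 / c\<close> by the nonnegative term
  \<open>(c * \<theta> + \<zeta>)\<^sup>2 / c\<close>.\<close>

lemma backward_ode:
  fixes \<zeta> :: "real \<Rightarrow> real"
  assumes T: "T \<ge> 0" and c: "c > 0" and \<zeta>: "continuous_on UNIV \<zeta>"
  obtains \<theta> where "\<And>t. (\<theta> has_real_derivative c * \<theta> t + \<zeta> t) (at t)" "\<theta> T = 0" "continuous_on UNIV \<theta>"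
    "c\<^sup>2 * (\<integral>s. indicator {0..T} s * (\<theta> s)\<^sup>2 \<partial>lborel) \<le> (\<integral>s. indicator {0..T} s * (\<zeta> s)\<^sup>2 \<partial>lborel)"
proof -
  have "\<exists>A. \<forall>x. - \<infinity> < ereal x \<longrightarrow> ereal x < \<infinity> \<longrightarrow> (A has_vector_derivative exp (- c * x) * \<zeta> x) (at x)"
    using \<zeta> by (intro einterval_antiderivative) (auto simp: continuous_on_eq_continuous_at intro!: continuous_intros)
  then obtain A where A: "\<And>x. (A has_real_derivative exp (- c * x) * \<zeta> x) (at x)"
    by (auto simp: has_real_derivative_iff_has_vector_derivative)
  \<comment> \<open>Variation of constants, with \<open>A\<close> a primitive of the source
    multiplied by the integrating factor.\<close>
  define \<theta> where "\<theta> t = exp (c * t) * (A t - A T)" for t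
  have d: "(\<theta> has_real_derivative c * \<theta> t + \<zeta> t) (at t)" for t
  proof -
    have "(\<theta> has_real_derivative (exp (c * t) * c) * (A t - A T) + (exp (- c * t) * \<zeta> t) * exp (c * t)) (at t)"
      unfolding \<theta>_def by (auto intro!: derivative_eq_intros A)
    moreover have "exp (- c * t) * \<zeta> t * exp (c * t) = \<zeta> t" by (simp add: exp_minus field_simps)
    ultimately show ?thesis by (simp only: \<theta>_def mult_ac)
  qed
  have \<theta>c: "continuous_on UNIV \<theta>" by (rule DERIV_continuous_on, rule has_field_derivative_at_within, rule d)
  have \<theta>T: "\<theta> T = 0" by (simp add: \<theta>_def)
  have "((\<lambda>t. (\<theta> t)\<^sup>2) has_real_derivative 2 * \<theta> t * (c * \<theta> t + \<zeta> t)) (at t)" for t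
    by (rule DERIV_cong[OF DERIV_power[OF d, of 2]]) simp
  then have "(\<integral>s. (2 * \<theta> s * (c * \<theta> s + \<zeta> s)) * indicator {0..T} s \<partial>lborel) = (\<theta> T)\<^sup>2 - (\<theta> 0)\<^sup>2"
    using T \<theta>c \<zeta> by (intro integral_FTC_Icc_real) (auto simp: continuous_on_eq_continuous_at intro!: continuous_intros)
  then have neg: "(\<integral>s. indicator {0..T} s * (2 * \<theta> s * (c * \<theta> s + \<zeta> s)) \<partial>lborel) \<le> 0"
    by (simp add: \<theta>T mult.commute)
  have i1: "integrable lborel (\<lambda>s. indicator {0..T} s * (c * (\<theta> s)\<^sup>2 - (\<zeta> s)\<^sup>2 / c))"
    and i2: "integrable lborel (\<lambda>s. indicator {0..T} s * (2 * \<theta> s * (c * \<theta> s + \<zeta> s)))"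
    and i3: "integrable lborel (\<lambda>s. indicator {0..T} s * (\<theta> s)\<^sup>2)"
    and i4: "integrable lborel (\<lambda>s. indicator {0..T} s * (\<zeta> s)\<^sup>2)"
    using c by (intro integrable_indicator_Icc_continuous continuous_intros \<theta>c \<zeta>; simp)+
  have "c * (\<theta> s)\<^sup>2 - (\<zeta> s)\<^sup>2 / c \<le> 2 * \<theta> s * (c * \<theta> s + \<zeta> s)" for s
  proof -
    have "0 \<le> (c * \<theta> s + \<zeta> s)\<^sup>2 / c" using c by simp
    then show ?thesis using c by (simp add: power2_eq_square field_simps)
  qed
  then have "(\<integral>s. indicator {0..T} s * (c * (\<theta> s)\<^sup>2 - (\<zeta> s)\<^sup>2 / c) \<partial>lborel)
     \<le> (\<integral>s. indicator {0..T} s * (2 * \<theta> s * (c * \<theta> s + \<zeta> s)) \<partial>lborel)"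
    by (intro integral_mono i1 i2 mult_left_mono) auto
  also note neg
  also have "(\<integral>s. indicator {0..T} s * (c * (\<theta> s)\<^sup>2 - (\<zeta> s)\<^sup>2 / c) \<partial>lborel)
     = (\<integral>s. c * (indicator {0..T} s * (\<theta> s)\<^sup>2) - (indicator {0..T} s * (\<zeta> s)\<^sup>2) / c \<partial>lborel)"
    by (simp add: algebra_simps)
  also have "\<dots> = c * (\<integral>s. indicator {0..T} s * (\<theta> s)\<^sup>2 \<partial>lborel) - (\<integral>s. indicator {0..T} s * (\<zeta> s)\<^sup>2 \<partial>lborel) / c"
    using i3 i4 by simp
  finally have "c\<^sup>2 * (\<integral>s. indicator {0..T} s * (\<theta> s)\<^sup>2 \<partial>lborel) \<le> (\<integral>s. indicator {0..T} s * (\<zeta> s)\<^sup>2 \<partial>lborel)"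
    using c by (simp add: power2_eq_square field_simps)
  then show thesis using that[OF d \<theta>T \<theta>c] by blast
qed

text \<open>\<open>q\<close> is only a primitive of an integrable function, so Fubini on the
  triangle \<open>s \<le> t\<close> replaces the product rule. No boundary terms appear, as
  \<open>q\<close> starts from 0 and \<open>\<Theta>\<close> ends at 0.\<close>

lemma time_integration_by_parts:
  fixes q r \<Theta> \<Theta>' :: "real \<Rightarrow> real"
  assumes T: "T \<ge> 0" and r: "integrable lborel r" "\<And>s. s \<notin> {0<..T} \<Longrightarrow> r s = 0"
    and q: "\<And>t. t \<in> {0<..T} \<Longrightarrow> q t = (\<integral>s. indicator {0<..t} s * r s \<partial>lborel)" "\<And>t. t \<notin> {0<..T} \<Longrightarrow> q t = 0"
    and \<Theta>: "\<And>t. (\<Theta> has_real_derivative \<Theta>' t) (at t)" "continuous_on UNIV \<Theta>'" "\<Theta> T = 0"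
  shows "(\<integral>t. \<Theta>' t * q t \<partial>lborel) + (\<integral>s. \<Theta> s * r s \<partial>lborel) = 0"
proof -
  have [measurable]: "r \<in> borel_measurable borel" using r(1) by auto
  have [measurable]: "\<Theta>' \<in> borel_measurable borel" using \<Theta>(2) by (rule borel_measurable_continuous_onI)
  define h where "h t s = (indicator {0..T} t * \<Theta>' t) * (indicator {0<..t} s * r s)" for t s
  have hm: "(\<lambda>z. h (fst z) (snd z)) \<in> borel_measurable borel"
  proof -
    have "h t s = (indicator {0..T} t * \<Theta>' t) * ((if 0 < s \<and> s \<le> t then 1 else 0) * r s)" for t s
      by (simp add: h_def indicator_def)
    then show ?thesis by simp
  qed
  have h: "integrable (lborel \<Otimes>\<^sub>M lborel) (\<lambda>(t, s). h t s)"
  proof (rule Bochner_Integration.integrable_bound)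
    show "integrable (lborel \<Otimes>\<^sub>M lborel) (\<lambda>z. (indicator {0..T} (fst z) * \<Theta>' (fst z)) * r (snd z))"
      using integrable.intros[OF has_bochner_integral_product[OF integrable_indicator_Icc_continuous[OF \<Theta>(2), of T] r(1)]]
      by (simp add: lborel_prod)
    show "(\<lambda>(t, s). h t s) \<in> borel_measurable (lborel \<Otimes>\<^sub>M lborel)"
      using hm by (simp add: lborel_prod split_beta')
    show "AE z in lborel \<Otimes>\<^sub>M lborel. norm (case z of (t, s) \<Rightarrow> h t s) \<le> norm ((indicator {0..T} (fst z) * \<Theta>' (fst z)) * r (snd z))"
      by (intro AE_I2) (auto simp: h_def indicator_def)
  qed
  have "(\<integral>t. \<Theta>' t * q t \<partial>lborel) = (\<integral>t. \<integral>s. h t s \<partial>lborel \<partial>lborel)"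
  proof (rule Bochner_Integration.integral_cong[OF refl])
    fix t show "\<Theta>' t * q t = (\<integral>s. h t s \<partial>lborel)"
    proof (cases "t \<in> {0<..T}")
      case True
      then show ?thesis by (simp add: h_def q(1))
    next
      case False
      then have "indicator {0..T} t = (0::real) \<or> {0<..t} = {}" by (auto simp: indicator_def)
      then have "h t s = 0" for s by (auto simp: h_def)
      then show ?thesis using False by (simp add: q(2))
    qed
  qed
  also have "\<dots> = (\<integral>s. \<integral>t. h t s \<partial>lborel \<partial>lborel)"
    using lborel_pair.Fubini_integral[OF h] by simp
  also have "\<dots> = (\<integral>s. - (\<Theta> s * r s) \<partial>lborel)"
  proof (rule Bochner_Integration.integral_cong[OF refl])
    fix s show "(\<integral>t. h t s \<partial>lborel) = - (\<Theta> s * r s)"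
    proof (cases "s \<in> {0<..T}")
      case True
      have "(\<integral>t. h t s \<partial>lborel) = (\<integral>t. r s * (\<Theta>' t * indicator {s..T} t) \<partial>lborel)"
        using True by (intro Bochner_Integration.integral_cong refl) (auto simp: h_def indicator_def)
      also have "\<dots> = r s * (\<integral>t. \<Theta>' t * indicator {s..T} t \<partial>lborel)" by simp
      also have "(\<integral>t. \<Theta>' t * indicator {s..T} t \<partial>lborel) = \<Theta> T - \<Theta> s"
        using True \<Theta>(1,2) by (intro integral_FTC_Icc_real) (auto simp: continuous_on_eq_continuous_at)
      finally show ?thesis using \<Theta>(3) by simp
    next
      case False
      then show ?thesis using r(2) by (simp add: h_def)
    qed
  qed
  finally show ?thesis by simp
qed

section \<open>Uniqueness for the Dirichlet problem\<close>

text \<open>Leibniz rule, sorted by derivatives of \<open>S\<close>. The mixed terms of the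
  Laplacian occur twice, so the factor 1/2 disappears and they join the drift. Second derivatives of
  \<open>S\<close> survive only in its half Laplacian, which for sines is a multiple of
  \<open>tens S\<close>.\<close>

lemma Lten_product:
  fixes C S :: "'d::finite \<Rightarrow> real \<Rightarrow> real"
  shows "Lten B (\<lambda>i s. C i s * S i s) (\<lambda>i s. C' i s * S i s + C i s * S' i s)
       (\<lambda>i s. C'' i s * S i s + 2 * (C' i s * S' i s) + C i s * S'' i s) x
    = tens C x * (1/2 * (\<Sum>i\<in>UNIV. tens (S(i := S'' i)) x))
      + (\<Sum>i\<in>UNIV. (B x $ i * tens C x + tens (C(i := C' i)) x) * tens (S(i := S' i)) x)
      + Lten B C C' C'' x * tens S x"
proof -
  define c s where "c i = (\<Prod>j\<in>UNIV - {i}. C j (x $ j))" and "s i = (\<Prod>j\<in>UNIV - {i}. S j (x $ j))" for i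
  have cs: "(\<Prod>j\<in>UNIV - {i}. C j (x $ j) * S j (x $ j)) = c i * s i" for i
    by (simp add: c_def s_def prod.distrib)
  have C: "tens C x = C i (x $ i) * c i" for i by (simp add: c_def tens_split[of _ _ i])
  have S: "tens S x = S i (x $ i) * s i" for i by (simp add: s_def tens_split[of _ _ i])
  have 1: "tens ((\<lambda>i s. C i s * S i s)(i := \<lambda>s. C' i s * S i s + C i s * S' i s)) x
     = tens (C(i := C' i)) x * tens S x + tens C x * tens (S(i := S' i)) x" for i
    unfolding tens_upd cs C[of i] S[of i] c_def[symmetric] s_def[symmetric] by (simp add: algebra_simps)
  have 2: "tens ((\<lambda>i s. C i s * S i s)(i := \<lambda>s. C'' i s * S i s + 2 * (C' i s * S' i s) + C i s * S'' i s)) x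
     = tens (C(i := C'' i)) x * tens S x + 2 * (tens (C(i := C' i)) x * tens (S(i := S' i)) x) + tens C x * tens (S(i := S'' i)) x" for i
    unfolding tens_upd cs C[of i] S[of i] c_def[symmetric] s_def[symmetric] by (simp add: algebra_simps)
  show ?thesis
    unfolding Lten_def 1 2 by (simp add: algebra_simps sum.distrib sum_distrib_left sum_distrib_right)
qed

lemma esin_deriv:
  assumes "R \<noteq> 0"
  shows "(esin a R k i has_real_derivative ecos a R k i s) (at s)"
    and "(ecos a R k i has_real_derivative - ((real (k i) / R)\<^sup>2 * esin a R k i s)) (at s)"
  using assms unfolding esin_def[abs_def] ecos_def[abs_def]
  by (auto intro!: derivative_eq_intros simp: power2_eq_square)

lemma integral_time_space:
  assumes P: "L2bdd T P" and T: "T \<ge> 0" and \<Theta>: "continuous_on UNIV \<Theta>" and \<phi>: "continuous_on UNIV \<phi>" and A: "compact A" "\<And>x. x \<notin> A \<Longrightarrow> \<phi> x = 0"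
  shows "integrable lborel (\<lambda>z. \<Theta> (fst z) * \<phi> (snd z) * P (snd z) (fst z))"
    and "(\<integral>z. \<Theta> (fst z) * \<phi> (snd z) * P (snd z) (fst z) \<partial>lborel) = (\<integral>s. \<Theta> s * (\<integral>x. \<phi> x * P x s \<partial>lborel) \<partial>lborel)"
    and "integrable lborel (\<lambda>s. \<Theta> s * (\<integral>x. \<phi> x * P x s \<partial>lborel))"
proof -
  have Pt0: "P x t = 0" if "t \<notin> {0<..T}" for x t using P that unfolding L2bdd_def by blast
  note [measurable] = L2bdd_measurable[OF P] borel_measurable_continuous_onI[OF \<Theta>] borel_measurable_continuous_onI[OF \<phi>]
  obtain K where K: "\<And>x. \<bar>\<phi> x\<bar> \<le> K * indicator A x" using bounded_on_compact_support[OF \<phi> A] by blast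
  have \<phi>2: "integrable lborel (\<lambda>x. (\<phi> x)\<^sup>2)"
    by (rule integrable_square_bounded_support[OF _ _ _ K])
      (use A(1) emeasure_bounded_finite[OF compact_imp_bounded[OF A(1)]] in \<open>auto simp: borel_compact\<close>)
  have \<Theta>2: "integrable lborel (\<lambda>s. indicator {0..T} s * (\<Theta> s)\<^sup>2)"
    by (intro integrable_indicator_Icc_continuous continuous_intros \<Theta>)
  have "integrable lborel (\<lambda>z. (indicator {0..T} (fst z) * (\<Theta> (fst z))\<^sup>2) * (\<phi> (snd z))\<^sup>2)"
    by (rule integrable.intros[OF has_bochner_integral_product[OF \<Theta>2 \<phi>2]])
  moreover have "(indicator {0..T} (fst z) * (\<Theta> (fst z))\<^sup>2) * (\<phi> (snd z))\<^sup>2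
     = (indicator {0..T} (fst z) * \<Theta> (fst z) * \<phi> (snd z))\<^sup>2" for z
    by (auto simp: indicator_def power_mult_distrib)
  moreover have "integrable lborel (\<lambda>z. (P (snd z) (fst z))\<^sup>2)"
    using L2bdd_integrable(1)[OF P] T by (simp add: lborel_prod)
  ultimately have "integrable lborel (\<lambda>z. (indicator {0..T} (fst z) * \<Theta> (fst z) * \<phi> (snd z)) * P (snd z) (fst z))"
    by (intro integrable_mult_L2) auto
  moreover have "(indicator {0..T} (fst z) * \<Theta> (fst z) * \<phi> (snd z)) * P (snd z) (fst z) = \<Theta> (fst z) * \<phi> (snd z) * P (snd z) (fst z)" for z
    using Pt0[of "fst z" "snd z"] by (cases "fst z \<in> {0<..T}") auto
  ultimately show i: "integrable lborel (\<lambda>z. \<Theta> (fst z) * \<phi> (snd z) * P (snd z) (fst z))" by simp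
  then have i': "integrable (lborel \<Otimes>\<^sub>M lborel) (\<lambda>z. \<Theta> (fst z) * \<phi> (snd z) * P (snd z) (fst z))" by (simp add: lborel_prod)
  show "(\<integral>z. \<Theta> (fst z) * \<phi> (snd z) * P (snd z) (fst z) \<partial>lborel) = (\<integral>s. \<Theta> s * (\<integral>x. \<phi> x * P x s \<partial>lborel) \<partial>lborel)"
    using lborel_pair.integral_fst'[OF i'] by (simp add: lborel_prod mult.assoc)
  show "integrable lborel (\<lambda>s. \<Theta> s * (\<integral>x. \<phi> x * P x s \<partial>lborel))"
    using lborel_pair.integrable_fst'[OF i'] by (simp add: mult.assoc)
qed

text \<open>The hypothesis \<open>weak\<close> is the Dirichlet problem with zero initial datum in
  very weak form. Test functions vanish at \<open>x^1 = m0\<close> while their normal derivative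
  there is free; this is how the boundary value 0 is expressed for a \<open>P\<close> that need not
  have a trace.\<close>

context
  fixes i1 :: "'d::finite" and T m0 b :: real and B :: "real^'d \<Rightarrow> real^'d" and P :: "real^'d \<Rightarrow> real \<Rightarrow> real"
  assumes T: "T > 0" and P: "L2bdd T P" and Pz: "\<And>x t. m0 \<le> x $ i1 \<Longrightarrow> P x t = 0"
    and Bc: "continuous_on UNIV B" and Bb: "\<And>x i. \<bar>B x $ i\<bar> \<le> b"
    and weak: "\<And>f f' f'' R t. (\<And>i s. (f i has_real_derivative f' i s) (at s)) \<Longrightarrow>
      (\<And>i s. (f' i has_real_derivative f'' i s) (at s)) \<Longrightarrow> (\<And>i. continuous_on UNIV (f'' i)) \<Longrightarrow>
      (\<And>i s. \<bar>s\<bar> > R \<Longrightarrow> f i s = 0 \<and> f' i s = 0 \<and> f'' i s = 0) \<Longrightarrow> f i1 m0 = 0 \<Longrightarrow> t \<in> {0<..T} \<Longrightarrow>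
      (\<integral>x. tens f x * P x t \<partial>lborel) = (\<integral>s. indicator {0<..t} s * (\<integral>x. Lten B f f' f'' x * P x s \<partial>lborel) \<partial>lborel)"
begin

lemmas time_space = integral_time_space[OF P less_imp_le[OF T]]

lemma Pt0: "t \<notin> {0<..T} \<Longrightarrow> P x t = 0"
  using P unfolding L2bdd_def by blast

lemma integrable_weighted_P:
  assumes lam: "lam \<ge> 0"
  shows "integrable lborel (\<lambda>z. (exp (- lam * fst z) * P (snd z) (fst z))\<^sup>2)"
proof (rule Bochner_Integration.integrable_bound)
  let ?p = "\<lambda>z. exp (- lam * fst z) * P (snd z) (fst z)"
  show "integrable lborel (\<lambda>z. (P (snd z) (fst z))\<^sup>2)"
    using L2bdd_integrable(1)[OF P] T by (simp add: lborel_prod)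
  have "(?p z)\<^sup>2 \<le> (P (snd z) (fst z))\<^sup>2" for z
  proof (cases "fst z \<in> {0<..T}")
    case True
    then have "exp (- lam * fst z) \<le> 1" using lam by simp
    then have "(exp (- lam * fst z))\<^sup>2 * (P (snd z) (fst z))\<^sup>2 \<le> 1 * (P (snd z) (fst z))\<^sup>2"
      by (intro mult_right_mono) (auto simp: power_le_one)
    then show ?thesis by (simp add: power_mult_distrib)
  qed (use Pt0 in simp)
  then show "AE z in lborel. norm ((?p z)\<^sup>2) \<le> norm ((P (snd z) (fst z))\<^sup>2)" by simp
  note [measurable] = L2bdd_measurable[OF P]
  show "(\<lambda>z. (?p z)\<^sup>2) \<in> borel_measurable lborel" by measurable
qed

text \<open>The test function is \<open>exp (- lam * t) * \<theta> t\<close> times cutoff times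
  mode. The time weight cancels the \<open>lam\<close> in the equation for \<open>\<theta>\<close>,
  and the eigenvalue of the mode cancels the \<open>\<mu>\<close>. Only the source
  \<open>\<zeta>\<close> is left, balanced by \<open>rest\<close>, in which the mode is
  differentiated at most once.\<close>

lemma mode_identity:
  fixes C C' C'' :: "'d \<Rightarrow> real \<Rightarrow> real" and k :: "'d \<Rightarrow> nat" and R lam :: real and a :: "'d \<Rightarrow> real"
  defines "\<mu> \<equiv> 1/2 * (\<Sum>i\<in>UNIV. (real (k i) / R)\<^sup>2)"
  defines "rest \<equiv> \<lambda>x. (\<Sum>i\<in>UNIV. (B x $ i * tens C x + tens (C(i := C' i)) x) * dbase a R i k x) + Lten B C C' C'' x * ebase a R k x"
  assumes R: "R > 0"
    and C: "\<And>i s. (C i has_real_derivative C' i s) (at s)" "\<And>i s. (C' i has_real_derivative C'' i s) (at s)"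
      "\<And>i. continuous_on UNIV (C'' i)" "\<And>i s. \<bar>s\<bar> \<ge> R \<Longrightarrow> C i s = 0 \<and> C' i s = 0 \<and> C'' i s = 0"
    and k0: "esin a R k i1 m0 = 0"
    and \<theta>: "\<And>t. (\<theta> has_real_derivative (\<mu> + lam) * \<theta> t + \<zeta> t) (at t)" "\<theta> T = 0" and \<zeta>: "continuous_on UNIV \<zeta>"
  shows "integrable lborel (\<lambda>z. exp (- lam * fst z) * \<zeta> (fst z) * (tens C (snd z) * ebase a R k (snd z)) * P (snd z) (fst z))" (is "integrable lborel ?G1")
    and "integrable lborel (\<lambda>z. exp (- lam * fst z) * \<theta> (fst z) * rest (snd z) * P (snd z) (fst z))" (is "integrable lborel ?G2")
    and "(\<integral>z. exp (- lam * fst z) * \<zeta> (fst z) * (tens C (snd z) * ebase a R k (snd z)) * P (snd z) (fst z) \<partial>lborel)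
       = - (\<integral>z. exp (- lam * fst z) * \<theta> (fst z) * rest (snd z) * P (snd z) (fst z) \<partial>lborel)"
proof -
  let ?S = "esin a R k" and ?S' = "ecos a R k" and ?S'' = "\<lambda>i s. - ((real (k i) / R)\<^sup>2 * esin a R k i s)"
  let ?f = "\<lambda>i s. C i s * ?S i s" and ?f' = "\<lambda>i s. C' i s * ?S i s + C i s * ?S' i s"
    and ?f'' = "\<lambda>i s. C'' i s * ?S i s + 2 * (C' i s * ?S' i s) + C i s * ?S'' i s"
  let ?A = "cbox (\<chi> i. - R) (\<chi> i. R) :: (real^'d) set"
  let ?\<phi> = "\<lambda>x. tens C x * ebase a R k x"
  note dS = esin_deriv[OF less_imp_neq[OF R, symmetric], of a k]
  have Cc: "continuous_on UNIV (C i)" "continuous_on UNIV (C' i)" for i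
    by (rule DERIV_continuous_on, rule has_field_derivative_at_within, rule C)+
  have Sc: "continuous_on UNIV (?S i)" "continuous_on UNIV (?S' i)" for i
    by (rule DERIV_continuous_on, rule has_field_derivative_at_within, rule dS)+
  have \<theta>c: "continuous_on UNIV \<theta>" by (rule DERIV_continuous_on, rule has_field_derivative_at_within, rule \<theta>)
  have out: "\<exists>j. \<bar>x $ j\<bar> \<ge> R" if x: "x \<notin> ?A" for x
  proof -
    obtain j where "\<not> (- R \<le> x $ j \<and> x $ j \<le> R)" using x by (auto simp: mem_box_cart)
    then have "\<bar>x $ j\<bar> \<ge> R" by linarith
    then show ?thesis ..
  qed
  have tz: "tens C x = 0 \<and> tens (C(i := C' i)) x = 0 \<and> tens (C(i := C'' i)) x = 0" if x: "x \<notin> ?A" for x i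
  proof -
    obtain j where "\<bar>x $ j\<bar> \<ge> R" using out[OF x] ..
    then show ?thesis by (auto simp: tens_split[of _ _ j] C(4))
  qed
  have \<phi>f: "tens ?f x = ?\<phi> x" for x by (simp add: tens_mult ebase_def)
  have \<phi>c: "continuous_on UNIV ?\<phi>"
    unfolding ebase_def by (intro continuous_intros continuous_on_tens Cc Sc)
  have rest_c: "continuous_on UNIV rest"
    unfolding rest_def Lten_def ebase_def dbase_def
    by (intro continuous_intros continuous_on_tens Bc) (auto simp: Cc Sc C(3))
  have Lf: "Lten B ?f ?f' ?f'' x = - \<mu> * ?\<phi> x + rest x" for x
  proof -
    have "tens (?S(i := ?S'' i)) x = - ((real (k i) / R)\<^sup>2 * tens ?S x)" for i
      unfolding tens_upd tens_split[of ?S x i] by simp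
    then have "1/2 * (\<Sum>i\<in>UNIV. tens (?S(i := ?S'' i)) x) = - \<mu> * ebase a R k x"
      by (simp add: \<mu>_def ebase_def sum_negf sum_distrib_right)
    then show ?thesis unfolding Lten_product by (simp add: rest_def ebase_def dbase_def)
  qed
  have rz: "rest x = 0" if "x \<notin> ?A" for x
    using tz[OF that] by (simp add: rest_def Lten_def)
  have pz: "?\<phi> x = 0" if "x \<notin> ?A" for x using tz[OF that] by simp
  have A: "compact ?A" by simp
  have expc: "continuous_on UNIV (\<lambda>t::real. exp (- lam * t))" by (intro continuous_intros)
  show G1: "integrable lborel ?G1"
    by (rule time_space(1)[where \<Theta> = "\<lambda>t. exp (- lam * t) * \<zeta> t" and \<phi> = ?\<phi>, OF _ \<phi>c A pz])
       (intro continuous_intros \<zeta>)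
  show G2: "integrable lborel ?G2"
    by (rule time_space(1)[where \<Theta> = "\<lambda>t. exp (- lam * t) * \<theta> t" and \<phi> = rest, OF _ rest_c A rz])
       (intro continuous_intros \<theta>c)
  define \<Theta> where "\<Theta> t = exp (- lam * t) * \<theta> t" for t
  define \<Theta>' where "\<Theta>' t = exp (- lam * t) * (\<mu> * \<theta> t + \<zeta> t)" for t
  have \<Theta>c: "continuous_on UNIV \<Theta>" "continuous_on UNIV \<Theta>'"
    unfolding \<Theta>_def \<Theta>'_def by (intro continuous_intros \<theta>c \<zeta>)+
  have \<Theta>d: "(\<Theta> has_real_derivative \<Theta>' t) (at t)" for t
  proof -
    have "((\<lambda>t. exp (- lam * t)) has_real_derivative exp (- lam * t) * (- lam)) (at t)"
      by (auto intro!: derivative_eq_intros)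
    from DERIV_mult[OF this \<theta>(1)] show ?thesis
      unfolding \<Theta>_def by (rule DERIV_cong) (simp add: \<Theta>'_def algebra_simps)
  qed
  have Lc: "continuous_on UNIV (\<lambda>x. - \<mu> * ?\<phi> x + rest x)" by (intro continuous_intros \<phi>c rest_c)
  have Lz: "- \<mu> * ?\<phi> x + rest x = 0" if "x \<notin> ?A" for x using rz[OF that] pz[OF that] by simp
  define r where "r s = (\<integral>x. (- \<mu> * ?\<phi> x + rest x) * P x s \<partial>lborel)" for s
  define q where "q s = (\<integral>x. ?\<phi> x * P x s \<partial>lborel)" for s
  have "(\<integral>t. \<Theta>' t * q t \<partial>lborel) + (\<integral>s. \<Theta> s * r s \<partial>lborel) = 0"
  proof (rule time_integration_by_parts[of T])
    show "integrable lborel r"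
      using time_space(3)[of "\<lambda>_. 1", OF _ Lc A Lz] by (simp add: r_def[abs_def])
    show "q t = (\<integral>s. indicator {0<..t} s * r s \<partial>lborel)" if "t \<in> {0<..T}" for t
    proof -
      have d1: "(?f i has_real_derivative ?f' i s) (at s)" for i s
        by (rule DERIV_cong[OF DERIV_mult[OF C(1) dS(1)]]) simp
      have d2: "(?f' i has_real_derivative ?f'' i s) (at s)" for i s
        by (rule DERIV_cong[OF DERIV_add[OF DERIV_mult[OF C(2) dS(1)] DERIV_mult[OF C(1) dS(2)]]]) simp
      have d3: "continuous_on UNIV (?f'' i)" for i by (intro continuous_intros Cc Sc C)
      have d4: "?f i s = 0 \<and> ?f' i s = 0 \<and> ?f'' i s = 0" if "\<bar>s\<bar> > R" for i s
        using C(4)[of s i] that by simp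
      have d5: "?f i1 m0 = 0" by (simp add: k0)
      show ?thesis using weak[where f = ?f and f' = ?f' and f'' = ?f'' and R = R, OF d1 d2 d3 d4 d5 that] unfolding Lf \<phi>f q_def r_def .
    qed
    show "\<Theta> T = 0" by (simp add: \<Theta>_def \<theta>(2))
  qed (use T \<Theta>d \<Theta>c Pt0 in \<open>auto simp: r_def q_def\<close>)
  moreover have "(\<integral>z. \<Theta>' (fst z) * ?\<phi> (snd z) * P (snd z) (fst z) \<partial>lborel) = (\<integral>t. \<Theta>' t * q t \<partial>lborel)"
    unfolding q_def by (rule time_space(2)[OF \<Theta>c(2) \<phi>c A pz])
  moreover have "(\<integral>z. \<Theta> (fst z) * (- \<mu> * ?\<phi> (snd z) + rest (snd z)) * P (snd z) (fst z) \<partial>lborel) = (\<integral>s. \<Theta> s * r s \<partial>lborel)"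
    unfolding r_def by (rule time_space(2)[OF \<Theta>c(1) Lc A Lz])
  ultimately have "(\<integral>z. \<Theta>' (fst z) * ?\<phi> (snd z) * P (snd z) (fst z) \<partial>lborel)
      + (\<integral>z. \<Theta> (fst z) * (- \<mu> * ?\<phi> (snd z) + rest (snd z)) * P (snd z) (fst z) \<partial>lborel) = 0"
    by simp
  then have "(\<integral>z. \<Theta>' (fst z) * ?\<phi> (snd z) * P (snd z) (fst z)
      + \<Theta> (fst z) * (- \<mu> * ?\<phi> (snd z) + rest (snd z)) * P (snd z) (fst z) \<partial>lborel) = 0"
    by (subst Bochner_Integration.integral_add[OF time_space(1)[OF \<Theta>c(2) \<phi>c A pz] time_space(1)[OF \<Theta>c(1) Lc A Lz]])
  moreover have "\<Theta>' (fst z) * ?\<phi> (snd z) * P (snd z) (fst z)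
      + \<Theta> (fst z) * (- \<mu> * ?\<phi> (snd z) + rest (snd z)) * P (snd z) (fst z) = ?G1 z + ?G2 z" for z
    unfolding \<Theta>_def \<Theta>'_def by (simp add: algebra_simps)
  ultimately have "(\<integral>z. ?G1 z + ?G2 z \<partial>lborel) = 0" by simp
  then show "(\<integral>z. ?G1 z \<partial>lborel) = - (\<integral>z. ?G2 z \<partial>lborel)"
    using Bochner_Integration.integral_add[OF G1 G2] by simp
qed

text \<open>\<open>\<kappa>\<close> is \<open>lam\<close> to the power -1/2. By orthogonality the
  dual function and each of its derivatives have at most \<open>\<kappa>\<close> times the norm of
  \<open>F\<close> on the box. Young's inequality with weights \<open>\<kappa>\<close> and
  \<open>1 / \<kappa>\<close> then makes both parts of each of the \<open>d + 1\<close> error terms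
  of size \<open>\<kappa>\<close>.\<close>

lemma mode_sum_estimate:
  fixes C C' C'' :: "'d \<Rightarrow> real \<Rightarrow> real" and R lam :: real and a :: "'d \<Rightarrow> real"
  defines "u \<equiv> \<lambda>z. exp (- lam * fst z) * tens C (snd z) * P (snd z) (fst z)"
    and "S \<equiv> {0..T} \<times> pibox a R"
  assumes R: "R > 0"
    and C: "\<And>i s. (C i has_real_derivative C' i s) (at s)" "\<And>i s. (C' i has_real_derivative C'' i s) (at s)"
      "\<And>i. continuous_on UNIV (C'' i)" "\<And>i s. \<bar>s\<bar> \<ge> R \<Longrightarrow> C i s = 0 \<and> C' i s = 0 \<and> C'' i s = 0"
    and k0: "\<And>k. esin a R k i1 m0 = 0"
    and \<alpha>: "\<And>x i. \<bar>B x $ i * tens C x + tens (C(i := C' i)) x\<bar> \<le> M" and \<beta>: "\<And>x. \<bar>Lten B C C' C'' x\<bar> \<le> M"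
    and box: "\<forall>x t. x \<notin> pibox a R \<longrightarrow> P x t \<noteq> 0 \<longrightarrow> (\<exists>j. \<bar>x $ j\<bar> \<ge> R)"
    and \<kappa>: "0 < \<kappa>" "\<kappa> \<le> 1" and lam: "lam = 1 / \<kappa>\<^sup>2"
    and F: "F \<in> trigV a R"
  shows "integrable lborel (\<lambda>z. u z * F z)"
    and "integrable lborel (\<lambda>z. indicator S z * (F z)\<^sup>2)"
    and "\<bar>\<integral>z. u z * F z \<partial>lborel\<bar> \<le> (real CARD('d) + 1) * (M / 2 * \<kappa>) *
      ((\<integral>z. (exp (- lam * fst z) * P (snd z) (fst z))\<^sup>2 \<partial>lborel) + (\<integral>z. indicator S z * (F z)\<^sup>2 \<partial>lborel))"
proof -
  let ?F2 = "\<integral>z. indicator S z * (F z)\<^sup>2 \<partial>lborel"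
  obtain K \<zeta> where K: "finite K" and \<zeta>: "\<And>k. continuous_on UNIV (\<zeta> k)"
    and Feq: "F = (\<lambda>z. \<Sum>k\<in>K. \<zeta> k (fst z) * ebase a R k (snd z))"
    using F unfolding trigV_def by blast
  define \<mu> where "\<mu> k = 1/2 * (\<Sum>i\<in>UNIV. (real (k i) / R)\<^sup>2)" for k :: "'d \<Rightarrow> nat"
  have \<mu>0: "\<mu> k \<ge> 0" for k unfolding \<mu>_def by (simp add: sum_nonneg)
  have \<mu>i: "(real (k i) / R)\<^sup>2 \<le> 2 * \<mu> k" for k i
    unfolding \<mu>_def using member_le_sum[of i UNIV "\<lambda>i. (real (k i) / R)\<^sup>2"] by simp
  have lam1: "lam \<ge> 1" unfolding lam using \<kappa> by (simp add: power_le_one)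
  have "\<forall>k. \<exists>\<theta>. (\<forall>t. (\<theta> has_real_derivative (\<mu> k + lam) * \<theta> t + \<zeta> k t) (at t)) \<and> \<theta> T = 0 \<and> continuous_on UNIV \<theta> \<and>
    (\<mu> k + lam)\<^sup>2 * (\<integral>s. indicator {0..T} s * (\<theta> s)\<^sup>2 \<partial>lborel) \<le> (\<integral>s. indicator {0..T} s * (\<zeta> k s)\<^sup>2 \<partial>lborel)"
    by (rule allI, rule backward_ode[of T "\<mu> k + lam" "\<zeta> k" for k]) (use T \<mu>0 lam1 \<zeta> in \<open>auto intro: add_nonneg_pos\<close>)
  from choice[OF this] obtain \<theta> where \<theta>all:
    "\<forall>k. (\<forall>t. (\<theta> k has_real_derivative (\<mu> k + lam) * \<theta> k t + \<zeta> k t) (at t)) \<and> \<theta> k T = 0 \<and> continuous_on UNIV (\<theta> k) \<and>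
    (\<mu> k + lam)\<^sup>2 * (\<integral>s. indicator {0..T} s * (\<theta> k s)\<^sup>2 \<partial>lborel) \<le> (\<integral>s. indicator {0..T} s * (\<zeta> k s)\<^sup>2 \<partial>lborel)" ..
  then have \<theta>: "\<And>k t. (\<theta> k has_real_derivative (\<mu> k + lam) * \<theta> k t + \<zeta> k t) (at t)" "\<And>k. \<theta> k T = 0"
      "\<And>k. continuous_on UNIV (\<theta> k)"
    and \<theta>2: "\<And>k. (\<mu> k + lam)\<^sup>2 * (\<integral>s. indicator {0..T} s * (\<theta> k s)\<^sup>2 \<partial>lborel) \<le> (\<integral>s. indicator {0..T} s * (\<zeta> k s)\<^sup>2 \<partial>lborel)"
    by blast+
  define p where "p z = exp (- lam * fst z) * P (snd z) (fst z)" for z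
  define al where "al i x = B x $ i * tens C x + tens (C(i := C' i)) x" for i x
  define be where "be x = Lten B C C' C'' x" for x
  define \<Psi> where "\<Psi> z = (\<Sum>k\<in>K. \<theta> k (fst z) * ebase a R k (snd z))" for z
  define \<Psi>d where "\<Psi>d i z = (\<Sum>k\<in>K. \<theta> k (fst z) * dbase a R i k (snd z))" for i z
  let ?G1 = "\<lambda>k z. exp (- lam * fst z) * \<zeta> k (fst z) * (tens C (snd z) * ebase a R k (snd z)) * P (snd z) (fst z)"
  let ?G2 = "\<lambda>k z. exp (- lam * fst z) * \<theta> k (fst z) * ((\<Sum>i\<in>UNIV. (B (snd z) $ i * tens C (snd z) + tens (C(i := C' i)) (snd z)) * dbase a R i k (snd z)) + Lten B C C' C'' (snd z) * ebase a R k (snd z)) * P (snd z) (fst z)"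
  note id = mode_identity[OF R C k0 \<theta>(1)[unfolded \<mu>_def] \<theta>(2) \<zeta>]
  have uF: "u z * F z = (\<Sum>k\<in>K. ?G1 k z)" for z
    unfolding u_def Feq sum_distrib_left by (intro sum.cong refl) (simp add: mult_ac)
  have pR: "p z * ((\<Sum>i\<in>UNIV. al i (snd z) * \<Psi>d i z) + be (snd z) * \<Psi> z)
     = (\<Sum>k\<in>K. ?G2 k z)" for z
  proof -
    have 1: "(\<Sum>i\<in>UNIV. al i (snd z) * \<Psi>d i z) = (\<Sum>k\<in>K. \<theta> k (fst z) * (\<Sum>i\<in>UNIV. al i (snd z) * dbase a R i k (snd z)))"
      unfolding \<Psi>d_def sum_distrib_left by (subst sum.swap) (simp add: mult_ac)
    have 2: "be (snd z) * \<Psi> z = (\<Sum>k\<in>K. \<theta> k (fst z) * (be (snd z) * ebase a R k (snd z)))"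
      unfolding \<Psi>_def sum_distrib_left by (simp add: mult_ac)
    show ?thesis
      unfolding 1 2 sum.distrib[symmetric] distrib_left[symmetric] sum_distrib_left[of "p z"]
      by (intro sum.cong refl) (simp add: p_def al_def be_def mult_ac)
  qed
  show iuF: "integrable lborel (\<lambda>z. u z * F z)"
    unfolding uF by (intro Bochner_Integration.integrable_sum id(1))
  have iR: "integrable lborel (\<lambda>z. p z * ((\<Sum>i\<in>UNIV. al i (snd z) * \<Psi>d i z) + be (snd z) * \<Psi> z))"
    unfolding pR by (intro Bochner_Integration.integrable_sum id(2))
  have eq: "(\<integral>z. u z * F z \<partial>lborel) = - (\<integral>z. p z * ((\<Sum>i\<in>UNIV. al i (snd z) * \<Psi>d i z) + be (snd z) * \<Psi> z) \<partial>lborel)"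
  proof -
    have 1: "(\<integral>z. u z * F z \<partial>lborel) = (\<Sum>k\<in>K. \<integral>z. ?G1 k z \<partial>lborel)"
      unfolding uF by (rule Bochner_Integration.integral_sum) (rule id(1))
    have 2: "(\<integral>z. p z * ((\<Sum>i\<in>UNIV. al i (snd z) * \<Psi>d i z) + be (snd z) * \<Psi> z) \<partial>lborel)
      = (\<Sum>k\<in>K. \<integral>z. ?G2 k z \<partial>lborel)"
      unfolding pR by (rule Bochner_Integration.integral_sum) (rule id(2))
    show ?thesis unfolding 1 2 sum_negf[symmetric] by (intro sum.cong refl id(3))
  qed
  note nF = has_bochner_integral_orthogonal_sum[OF K ebase_orthogonal[OF R] \<zeta>, of T]
  note n\<Psi> = has_bochner_integral_orthogonal_sum[OF K ebase_orthogonal[OF R] \<theta>(3), of T]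
  note n\<Psi>d = has_bochner_integral_orthogonal_sum[OF K dbase_orthogonal[OF R] \<theta>(3), of T]
  show iF: "integrable lborel (\<lambda>z. indicator S z * (F z)\<^sup>2)"
    using integrable.intros[OF nF] by (simp add: S_def Feq)
  have i\<Psi>: "integrable lborel (\<lambda>z. indicator S z * (\<Psi> z)\<^sup>2)"
    using integrable.intros[OF n\<Psi>] by (simp add: S_def \<Psi>_def)
  have i\<Psi>d: "integrable lborel (\<lambda>z. indicator S z * (\<Psi>d i z)\<^sup>2)" for i
    using integrable.intros[OF n\<Psi>d] by (simp add: S_def \<Psi>d_def)
  define Z where "Z k = (\<integral>s. indicator {0..T} s * (\<zeta> k s)\<^sup>2 \<partial>lborel)" for k
  define H where "H k = (\<integral>s. indicator {0..T} s * (\<theta> k s)\<^sup>2 \<partial>lborel)" for k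
  have H0: "H k \<ge> 0" for k unfolding H_def by (intro Bochner_Integration.integral_nonneg) auto
  have FZ: "?F2 = (\<Sum>k\<in>K. enorm R k * Z k)"
    using has_bochner_integral_integral_eq[OF nF] by (simp add: S_def Feq Z_def)
  \<comment> \<open>Used with \<open>c k = 1\<close> for \<open>\<Psi>\<close> and with
    \<open>c k = (k i / R)\<^sup>2\<close>, which is at most \<open>2 * \<mu> k\<close>, for its
    derivatives. In both cases a factor \<open>lam\<close> of \<open>(\<mu> k + lam)\<^sup>2\<close>
    is left over and becomes the gain \<open>\<kappa>\<^sup>2\<close>.\<close>
  have le: "(\<Sum>k\<in>K. c k * enorm R k * H k) \<le> \<kappa>\<^sup>2 * (\<Sum>k\<in>K. enorm R k * Z k)"
    if c: "\<And>k. c k * lam \<le> (\<mu> k + lam)\<^sup>2" for c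
    unfolding sum_distrib_left
  proof (rule sum_mono)
    fix k
    have "c k * lam * H k \<le> (\<mu> k + lam)\<^sup>2 * H k" by (intro mult_right_mono c H0)
    also have "\<dots> \<le> Z k" using \<theta>2[of k] by (simp add: H_def Z_def)
    finally have "\<kappa>\<^sup>2 * (c k * lam * H k) \<le> \<kappa>\<^sup>2 * Z k" by (intro mult_left_mono) auto
    then have "c k * H k \<le> \<kappa>\<^sup>2 * Z k" using \<kappa> by (simp add: lam)
    then have "enorm R k * (c k * H k) \<le> enorm R k * (\<kappa>\<^sup>2 * Z k)" by (intro mult_left_mono enorm_nonneg R)
    then show "c k * enorm R k * H k \<le> \<kappa>\<^sup>2 * (enorm R k * Z k)" by (simp add: mult_ac)
  qed
  have b\<Psi>: "(\<integral>z. indicator S z * (\<Psi> z)\<^sup>2 \<partial>lborel) \<le> \<kappa>\<^sup>2 * ?F2"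
  proof -
    have "1 * lam \<le> (\<mu> k + lam)\<^sup>2" for k
      using \<mu>0[of k] lam1 mult_mono[of 1 "\<mu> k + lam" lam "\<mu> k + lam"] by (simp add: power2_eq_square)
    from le[OF this] show ?thesis
      using has_bochner_integral_integral_eq[OF n\<Psi>] unfolding FZ by (simp add: S_def \<Psi>_def H_def)
  qed
  have b\<Psi>d: "(\<integral>z. indicator S z * (\<Psi>d i z)\<^sup>2 \<partial>lborel) \<le> \<kappa>\<^sup>2 * ?F2" for i
  proof -
    have "(real (k i) / R)\<^sup>2 * lam \<le> (\<mu> k + lam)\<^sup>2" for k
    proof -
      have "(real (k i) / R)\<^sup>2 * lam \<le> 2 * \<mu> k * lam" using \<mu>i[of k i] lam1 by (intro mult_right_mono) auto
      also have "\<dots> \<le> (\<mu> k + lam)\<^sup>2" by (simp add: power2_sum)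
      finally show ?thesis .
    qed
    from le[OF this] show ?thesis
      using has_bochner_integral_integral_eq[OF n\<Psi>d] unfolding FZ by (simp add: S_def \<Psi>d_def H_def)
  qed
  have M0: "M \<ge> 0" using \<beta>[of 0] by linarith
  have ip: "integrable lborel (\<lambda>z. (p z)\<^sup>2)"
    unfolding p_def using lam1 by (intro integrable_weighted_P) simp
  \<comment> \<open>Orthogonality controls the sine sums on the box only, so the indicator of
    \<open>S\<close> has to be inserted next to \<open>\<psi>\<close>. Condition \<open>g0\<close>,
    supplied by \<open>outS\<close>, permits this.\<close>
  have amgm: "\<bar>p z * (g * \<psi>)\<bar> \<le> M / 2 * (\<kappa> * (p z)\<^sup>2 + indicator S z * \<psi>\<^sup>2 / \<kappa>)"
    if g: "\<bar>g\<bar> \<le> M" and g0: "z \<notin> S \<Longrightarrow> p z * g = 0" for z g \<psi>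
  proof (cases "z \<in> S")
    case True
    have "\<bar>p z * (g * \<psi>)\<bar> = \<bar>g\<bar> * (\<bar>p z\<bar> * \<bar>\<psi>\<bar>)" by (simp add: abs_mult mult_ac)
    also have "\<dots> \<le> M * (\<bar>p z\<bar> * \<bar>\<psi>\<bar>)" using g by (intro mult_right_mono) auto
    also have "\<bar>p z\<bar> * \<bar>\<psi>\<bar> \<le> 1/2 * (\<kappa> * (p z)\<^sup>2 + \<psi>\<^sup>2 / \<kappa>)"
    proof -
      have "0 \<le> (\<kappa> * \<bar>p z\<bar> - \<bar>\<psi>\<bar>)\<^sup>2 / \<kappa>" using \<kappa> by simp
      also have "\<dots> = \<kappa> * (p z)\<^sup>2 + \<psi>\<^sup>2 / \<kappa> - 2 * (\<bar>p z\<bar> * \<bar>\<psi>\<bar>)"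
        using \<kappa> by (simp add: power2_diff power_mult_distrib power2_eq_square field_simps)
      finally show ?thesis by simp
    qed
    finally show ?thesis using True M0 by (simp add: mult_left_mono)
  next
    case False
    have e: "p z * (g * \<psi>) = 0" using g0[OF False] by auto
    show ?thesis unfolding e using M0 \<kappa> False by simp
  qed
  \<comment> \<open>Outside \<open>S\<close> either \<open>P\<close> vanishes or some coordinate has
    absolute value at least \<open>R\<close>; in the latter case the cutoff vanishes together with
    its derivatives.\<close>
  have outS: "p z * al i (snd z) = 0 \<and> p z * be (snd z) = 0" if "z \<notin> S" for z i
  proof (cases "p z = 0")
    case False
    then have nz: "P (snd z) (fst z) \<noteq> 0" by (auto simp: p_def)
    then have "fst z \<in> {0..T}" using Pt0[of "fst z" "snd z"] by fastforce
    then have "snd z \<notin> pibox a R" using that by (auto simp: S_def mem_Times_iff)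
    then obtain j where "\<bar>snd z $ j\<bar> \<ge> R" using box nz by blast
    then have "tens C (snd z) = 0 \<and> tens (C(i := C' i)) (snd z) = 0 \<and> tens (C(i := C'' i)) (snd z) = 0" for i
      by (auto simp: tens_split[of _ _ j] C(4))
    then show ?thesis by (simp add: al_def be_def Lten_def)
  qed simp
  define bd where "bd z = (\<Sum>i\<in>UNIV. M / 2 * (\<kappa> * (p z)\<^sup>2 + indicator S z * (\<Psi>d i z)\<^sup>2 / \<kappa>))
      + M / 2 * (\<kappa> * (p z)\<^sup>2 + indicator S z * (\<Psi> z)\<^sup>2 / \<kappa>)" for z
  have bound: "\<bar>p z * ((\<Sum>i\<in>UNIV. al i (snd z) * \<Psi>d i z) + be (snd z) * \<Psi> z)\<bar> \<le> bd z" for z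
  proof -
    have "\<bar>p z * ((\<Sum>i\<in>UNIV. al i (snd z) * \<Psi>d i z) + be (snd z) * \<Psi> z)\<bar>
      \<le> (\<Sum>i\<in>UNIV. \<bar>p z * (al i (snd z) * \<Psi>d i z)\<bar>) + \<bar>p z * (be (snd z) * \<Psi> z)\<bar>"
      unfolding distrib_left sum_distrib_left by (rule order_trans[OF abs_triangle_ineq add_right_mono[OF sum_abs]])
    also have "\<dots> \<le> bd z"
      unfolding bd_def by (intro add_mono sum_mono amgm) (use \<alpha> \<beta> outS in \<open>auto simp: al_def be_def\<close>)
    finally show ?thesis .
  qed
  have ibd: "integrable lborel bd"
    unfolding bd_def by (intro Bochner_Integration.integrable_add Bochner_Integration.integrable_sum
      integrable_mult_right integrable_divide ip i\<Psi> i\<Psi>d)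
  have "\<bar>\<integral>z. u z * F z \<partial>lborel\<bar> \<le> (\<integral>z. \<bar>p z * ((\<Sum>i\<in>UNIV. al i (snd z) * \<Psi>d i z) + be (snd z) * \<Psi> z)\<bar> \<partial>lborel)"
    unfolding eq abs_minus_cancel by (rule integral_abs_bound)
  also have "\<dots> \<le> (\<integral>z. bd z \<partial>lborel)"
    by (intro integral_mono ibd integrable_abs iR bound)
  also have "\<dots> = (\<Sum>i\<in>UNIV. M / 2 * (\<kappa> * (\<integral>z. (p z)\<^sup>2 \<partial>lborel) + (\<integral>z. indicator S z * (\<Psi>d i z)\<^sup>2 \<partial>lborel) / \<kappa>))
      + M / 2 * (\<kappa> * (\<integral>z. (p z)\<^sup>2 \<partial>lborel) + (\<integral>z. indicator S z * (\<Psi> z)\<^sup>2 \<partial>lborel) / \<kappa>)"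
    unfolding bd_def using ip i\<Psi> i\<Psi>d by simp
  also have "\<dots> \<le> (\<Sum>i\<in>(UNIV :: 'd set). M / 2 * (\<kappa> * (\<integral>z. (p z)\<^sup>2 \<partial>lborel) + \<kappa> * ?F2))
      + M / 2 * (\<kappa> * (\<integral>z. (p z)\<^sup>2 \<partial>lborel) + \<kappa> * ?F2)"
  proof -
    have "J / \<kappa> \<le> \<kappa> * ?F2"
      if "J \<le> \<kappa>\<^sup>2 * ?F2" for J
      using that \<kappa> by (simp add: divide_le_eq power2_eq_square mult_ac)
    then show ?thesis using M0 \<kappa> b\<Psi> b\<Psi>d by (intro add_mono sum_mono mult_left_mono) auto
  qed
  also have "\<dots> = (real CARD('d) + 1) * (M / 2 * \<kappa>) *
      ((\<integral>z. (p z)\<^sup>2 \<partial>lborel) + ?F2)"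
    by (simp add: algebra_simps add_divide_distrib)
  finally show "\<bar>\<integral>z. u z * F z \<partial>lborel\<bar> \<le> (real CARD('d) + 1) * (M / 2 * \<kappa>) *
      ((\<integral>z. (exp (- lam * fst z) * P (snd z) (fst z))\<^sup>2 \<partial>lborel) + ?F2)"
    by (simp add: p_def)
qed

text \<open>The constants are independent of \<open>R\<close>, since rescaling by
  \<open>R \<ge> 1\<close> does not increase the derivatives of the cutoff. \<open>M\<close> bounds
  all coefficients, and \<open>\<kappa>\<close> is chosen to make the factor in
  \<open>mode_sum_estimate\<close> equal to 1/16. The purpose is a final constant below 1; 1/10 is
  what the arithmetic yields.\<close>

lemma cutoff_energy:
  assumes c: "\<And>s. (c has_real_derivative c' s) (at s)" "\<And>s. (c' has_real_derivative c'' s) (at s)"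
    "continuous_on UNIV c''" "\<And>s. \<bar>c s\<bar> \<le> 1" "\<And>s. \<bar>c' s\<bar> \<le> 30" "\<And>s. \<bar>c'' s\<bar> \<le> 30"
    "\<And>s. \<bar>s\<bar> \<ge> 1 \<Longrightarrow> c s = 0" "\<And>s. \<bar>s\<bar> \<ge> 1 \<Longrightarrow> c' s = 0" "\<And>s. \<bar>s\<bar> \<ge> 1 \<Longrightarrow> c'' s = 0"
    and M: "M = real CARD('d) * (30 * b + 30)" and \<kappa>: "\<kappa> = 1 / (8 * (real CARD('d) + 1) * M)" and lam: "lam = 1 / \<kappa>\<^sup>2"
    and R: "R \<ge> 1" "R \<ge> \<bar>m0\<bar>"
  shows "(\<integral>z. (exp (- lam * fst z) * tens (\<lambda>i s. c (s / R)) (snd z) * P (snd z) (fst z))\<^sup>2 \<partial>lborel)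
    \<le> 1/10 * (\<integral>z. (exp (- lam * fst z) * P (snd z) (fst z))\<^sup>2 \<partial>lborel)"
proof -
  define C C' C'' :: "'d \<Rightarrow> real \<Rightarrow> real" where "C = (\<lambda>i s. c (s / R))" and "C' = (\<lambda>i s. c' (s / R) / R)"
    and "C'' = (\<lambda>i s. c'' (s / R) / R\<^sup>2)"
  note C_defs = C_def C'_def C''_def
  \<comment> \<open>In direction \<open>i1\<close> the box ends at \<open>m0\<close>. As
    \<open>pi * R \<ge> 2 * R\<close> and \<open>R \<ge> \<bar>m0\<bar>\<close>, it contains every
    point with \<open>x^1 < m0\<close> whose coordinates are all below \<open>R\<close> in absolute
    value, so cutoff times \<open>P\<close> vanishes outside it.\<close>
  define a where "a i = (if i = i1 then m0 - pi * R else - R)" for i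
  define u where "u z = exp (- lam * fst z) * tens C (snd z) * P (snd z) (fst z)" for z
  define S where "S = {0..T} \<times> pibox a R"
  have b0: "b \<ge> 0" using Bb[of 0 undefined] by linarith
  have card1: "real CARD('d) \<ge> 1" by (simp add: Suc_leI)
  have M30: "M \<ge> 30 * b + 30" unfolding M using mult_right_mono[OF card1, of "30 * b + 30"] b0 by simp
  have \<kappa>1: "0 < \<kappa>" "\<kappa> \<le> 1"
  proof -
    have "1 * 1 \<le> (8 * (real CARD('d) + 1)) * M" using card1 M30 b0 by (intro mult_mono) auto
    then show "0 < \<kappa>" "\<kappa> \<le> 1" unfolding \<kappa> by (auto simp: divide_le_eq_1)
  qed
  have const: "(real CARD('d) + 1) * (M / 2 * \<kappa>) = 1/16"
  proof -
    have "N * (M / 2 * (1 / (8 * N * M))) = 1/16" if "N > 0" "M > 0" for N M :: real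
      using that by (simp add: field_simps)
    then show ?thesis unfolding \<kappa> using M30 b0 card1 by simp
  qed
  have R0: "R > 0" using R by simp
  have dR: "((\<lambda>s. s / R) has_real_derivative 1 / R) (at s)" for s
    using R0 by (auto intro!: derivative_eq_intros)
  have C: "\<And>i s. (C i has_real_derivative C' i s) (at s)" "\<And>i s. (C' i has_real_derivative C'' i s) (at s)"
    unfolding C_defs using R0
    by (auto intro!: DERIV_cong[OF DERIV_chain'[OF dR c(1)]] DERIV_cong[OF DERIV_cdivide[OF DERIV_chain'[OF dR c(2)]]] simp: power2_eq_square)
  have C3: "continuous_on UNIV (C'' i)" for i
    unfolding C_defs using R0 by (intro continuous_intros continuous_on_compose2[OF c(3)]) auto
  have C4: "C i s = 0 \<and> C' i s = 0 \<and> C'' i s = 0" if "\<bar>s\<bar> \<ge> R" for i s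
  proof -
    have "\<bar>s / R\<bar> \<ge> 1" using that R0 by simp
    then show ?thesis unfolding C_defs using c(7-9) by simp
  qed
  have tC: "\<bar>tens C x\<bar> \<le> 1" for x by (intro abs_tens_le_1) (simp add: C_def c(4))
  have tC': "\<bar>tens (C(i := g)) x\<bar> \<le> 30" if "\<And>s. \<bar>g s\<bar> \<le> 30" for i g x
  proof -
    have "\<bar>\<Prod>j\<in>UNIV - {i}. C j (x $ j)\<bar> \<le> 1"
      unfolding abs_prod by (intro prod_le_1) (auto simp: C_def c(4))
    then have "\<bar>g (x $ i)\<bar> * \<bar>\<Prod>j\<in>UNIV - {i}. C j (x $ j)\<bar> \<le> 30 * 1" by (intro mult_mono that) auto
    then show ?thesis by (simp add: tens_upd abs_mult)
  qed
  have g1: "\<bar>C' i s\<bar> \<le> 30" for i s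
    using frac_le[OF _ c(5)[of "s / R"] _ R(1)] R0 by (simp add: C'_def)
  have g2: "\<bar>C'' i s\<bar> \<le> 30" for i s
    using frac_le[OF _ c(6)[of "s / R"] _ one_le_power[OF R(1), of 2]] by (simp add: C''_def)
  have \<alpha>: "\<bar>B x $ i * tens C x + tens (C(i := C' i)) x\<bar> \<le> M" for x i
  proof -
    have "\<bar>B x $ i * tens C x\<bar> \<le> b * 1" unfolding abs_mult using b0 by (intro mult_mono Bb tC) auto
    then show ?thesis using tC'[of "C' i" i x, OF g1] M30 b0 by linarith
  qed
  have \<beta>: "\<bar>Lten B C C' C'' x\<bar> \<le> M" for x
  proof -
    have "\<bar>\<Sum>i\<in>UNIV. B x $ i * tens (C(i := C' i)) x\<bar> \<le> (\<Sum>i\<in>(UNIV::'d set). b * 30)"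
    proof (rule order_trans[OF sum_abs sum_mono])
      fix i show "\<bar>B x $ i * tens (C(i := C' i)) x\<bar> \<le> b * 30"
        unfolding abs_mult using b0 by (intro mult_mono Bb tC' g1) auto
    qed
    moreover have "\<bar>\<Sum>i\<in>UNIV. tens (C(i := C'' i)) x\<bar> \<le> (\<Sum>i\<in>(UNIV::'d set). 30)"
      by (rule order_trans[OF sum_abs sum_mono]) (intro tC' g2)
    ultimately have "\<bar>Lten B C C' C'' x\<bar> \<le> real CARD('d) * (b * 30) + 1/2 * (real CARD('d) * 30)"
      unfolding Lten_def by (simp add: abs_le_iff)
    also have "\<dots> \<le> M" unfolding M by (simp add: algebra_simps)
    finally show ?thesis .
  qed
  have sinpi: "esin a R k i1 m0 = 0" for k
    unfolding esin_def a_def using R0 by simp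
  have out: "\<exists>j. \<bar>x $ j\<bar> \<ge> R" if x: "x \<notin> pibox a R" and nz: "P x t \<noteq> 0" for x t
  proof -
    obtain j where j: "\<not> (a j \<le> x $ j \<and> x $ j \<le> a j + pi * R)" using x by (auto simp: pibox_def mem_box_cart)
    have "x $ i1 < m0" using Pz[of x t] nz by force
    moreover have "2 * R \<le> pi * R" using R0 pi_ge_two by (intro mult_right_mono) auto
    ultimately have "\<bar>x $ j\<bar> \<ge> R" using j R
      by (cases "j = i1", hypsubst, unfold a_def if_P if_not_P if_True simp_thms) linarith+
    then show ?thesis ..
  qed
  have inside: "z \<in> S \<and> ebase a R (\<lambda>_. 1) (snd z) > 0" if nz: "u z \<noteq> 0" for z
  proof
    have P0: "P (snd z) (fst z) \<noteq> 0" and t0: "tens C (snd z) \<noteq> 0" using nz by (auto simp: u_def)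
    have lt: "\<bar>snd z $ j\<bar> < R" for j
      using t0 C4[of "snd z $ j" j] by (cases "\<bar>snd z $ j\<bar> \<ge> R") (auto simp: tens_split[of _ _ j])
    then have "snd z \<in> pibox a R" using out[of "snd z" "fst z"] P0 by (meson not_le)
    moreover have "fst z \<in> {0..T}" using Pt0[of "fst z" "snd z"] P0 by fastforce
    ultimately show "z \<in> S" by (simp add: S_def mem_Times_iff)
    have "snd z $ i1 < m0" using Pz[of "snd z" "fst z"] P0 by force
    have pi2: "2 * R \<le> pi * R" using R0 pi_ge_two by (intro mult_right_mono) auto
    have "0 < esin a R (\<lambda>_. 1) j (snd z $ j)" for j
    proof -
      have "0 < snd z $ j - a j \<and> snd z $ j - a j < pi * R"
        using lt[of j] \<open>snd z $ i1 < m0\<close> pi2 R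
        by (cases "j = i1", hypsubst, unfold a_def if_P if_not_P if_True simp_thms) linarith+
      then have "0 < (snd z $ j - a j) / R" "(snd z $ j - a j) / R < pi" using R0 by (auto simp: divide_less_eq)
      then show ?thesis unfolding esin_def by (simp add: sin_gt_zero)
    qed
    then show "ebase a R (\<lambda>_. 1) (snd z) > 0" unfolding ebase_def tens_def by (intro prod_pos) auto
  qed
  have Cm: "tens C \<in> borel_measurable borel"
    by (intro borel_measurable_continuous_onI continuous_on_tens DERIV_continuous_on[OF has_field_derivative_at_within[OF C(1)]])
  note [measurable] = L2bdd_measurable[OF P] Cm
  have um [measurable]: "u \<in> borel_measurable borel" unfolding u_def by measurable
  have lam0: "lam \<ge> 0" unfolding lam by simp
  define A where "A = (\<integral>z. (exp (- lam * fst z) * P (snd z) (fst z))\<^sup>2 \<partial>lborel)"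
  let ?p = "\<lambda>z. exp (- lam * fst z) * P (snd z) (fst z)"
  have ui: "integrable lborel (\<lambda>z. (u z)\<^sup>2)"
  proof (rule Bochner_Integration.integrable_bound[OF integrable_weighted_P[OF lam0]])
    have "(u z)\<^sup>2 \<le> (?p z)\<^sup>2" for z
    proof -
      have "(tens C (snd z))\<^sup>2 * (?p z)\<^sup>2 \<le> 1 * (?p z)\<^sup>2"
        using tC[of "snd z"] by (intro mult_right_mono) (auto simp: abs_square_le_1)
      then show ?thesis by (simp add: u_def power_mult_distrib mult_ac)
    qed
    then show "AE z in lborel. norm ((u z)\<^sup>2) \<le> norm ((?p z)\<^sup>2)" by simp
  qed measurable
  define X where "X = (\<integral>z. (u z)\<^sup>2 \<partial>lborel)"
  have Sm [measurable]: "S \<in> sets borel"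
    unfolding S_def pibox_def by (intro borel_compact compact_Times) auto
  have "X \<le> 1/10 * A + e" if e: "e > 0" for e
  proof (rule trigV_dense_L2[OF R0 um ui, where T = T and a = a and d = "e / 2"])
    show "z \<in> {0..T} \<times> pibox a R \<and> ebase a R (\<lambda>_. 1) (snd z) > 0" if "u z \<noteq> 0" for z
      using inside[OF that] by (simp add: S_def)
    fix F assume F: "F \<in> trigV a R" and "(\<integral>z. indicator ({0..T} \<times> pibox a R) z * (u z - F z)\<^sup>2 \<partial>lborel) < e / 2"
    then have D: "(\<integral>z. indicator S z * (u z - F z)\<^sup>2 \<partial>lborel) < e / 2" by (simp add: S_def)
    have "\<forall>x t. x \<notin> pibox a R \<longrightarrow> P x t \<noteq> 0 \<longrightarrow> (\<exists>j. \<bar>x $ j\<bar> \<ge> R)" using out by blast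
    note est = mode_sum_estimate[OF R0 C C3 C4 sinpi \<alpha> \<beta> this \<kappa>1 lam F]
    have iuF: "integrable lborel (\<lambda>z. u z * F z)" using est(1) by (simp add: u_def)
    have iF: "integrable lborel (\<lambda>z. indicator S z * (F z)\<^sup>2)" using est(2) by (simp add: S_def)
    have main: "(\<integral>z. u z * F z \<partial>lborel) \<le> 1/16 * (A + (\<integral>z. indicator S z * (F z)\<^sup>2 \<partial>lborel))"
      using est(3) unfolding const by (simp add: u_def S_def A_def)
    have "F \<in> borel_measurable borel"
    proof -
      obtain K \<zeta> where K: "\<And>k. continuous_on UNIV (\<zeta> k)" "F = (\<lambda>z. \<Sum>k\<in>K. \<zeta> k (fst z) * ebase a R k (snd z))"
        using F unfolding trigV_def by blast
      show ?thesis unfolding K(2)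
        by (intro borel_measurable_continuous_onI continuous_intros continuous_on_compose2[OF K(1)]
            continuous_on_compose2[OF ebase_continuous[OF R0]]) auto
    qed
    note [measurable] = this
    let ?D = "\<integral>z. indicator S z * (u z - F z)\<^sup>2 \<partial>lborel"
    have u0: "u z = 0" if "z \<notin> S" for z using inside[of z] that by auto
    have iD: "integrable lborel (\<lambda>z. indicator S z * (u z - F z)\<^sup>2)"
    proof (rule Bochner_Integration.integrable_bound)
      show "integrable lborel (\<lambda>z. 2 * (u z)\<^sup>2 + 2 * (indicator S z * (F z)\<^sup>2))" using ui iF by simp
      have "indicator S z * (u z - F z)\<^sup>2 \<le> 2 * (u z)\<^sup>2 + 2 * (indicator S z * (F z)\<^sup>2)" for z
        using power2_add_le[of "u z" "- F z"] by (auto simp: indicator_def)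
      then show "AE z in lborel. norm (indicator S z * (u z - F z)\<^sup>2) \<le> norm (2 * (u z)\<^sup>2 + 2 * (indicator S z * (F z)\<^sup>2))" by simp
    qed measurable
    have "X \<le> (\<integral>z. u z * F z + 1/4 * (u z)\<^sup>2 + indicator S z * (u z - F z)\<^sup>2 \<partial>lborel)"
      unfolding X_def
    proof (intro integral_mono ui Bochner_Integration.integrable_add iuF iD integrable_mult_right)
      \<comment> \<open>Write \<open>u\<^sup>2\<close> as \<open>u * F + u * (u - F)\<close> and
        bound the last product by \<open>u\<^sup>2 / 4 + (u - F)\<^sup>2\<close>.\<close>
      fix z show "(u z)\<^sup>2 \<le> u z * F z + 1/4 * (u z)\<^sup>2 + indicator S z * (u z - F z)\<^sup>2"
      proof (cases "z \<in> S")
        case True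
        have "0 \<le> (1/2 * u z - (u z - F z))\<^sup>2" by simp
        then show ?thesis using True by (simp add: power2_eq_square algebra_simps)
      qed (simp add: u0)
    qed
    also have "\<dots> = (\<integral>z. u z * F z \<partial>lborel) + 1/4 * X + ?D"
      using iuF ui iD by (simp add: X_def)
    finally have 1: "X \<le> (\<integral>z. u z * F z \<partial>lborel) + 1/4 * X + ?D" .
    have "(\<integral>z. indicator S z * (F z)\<^sup>2 \<partial>lborel) \<le> (\<integral>z. 2 * (u z)\<^sup>2 + 2 * (indicator S z * (u z - F z)\<^sup>2) \<partial>lborel)"
    proof (intro integral_mono iF Bochner_Integration.integrable_add ui iD integrable_mult_right)
      fix z show "indicator S z * (F z)\<^sup>2 \<le> 2 * (u z)\<^sup>2 + 2 * (indicator S z * (u z - F z)\<^sup>2)"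
        using power2_add_le[of "u z" "F z - u z"] by (auto simp: indicator_def power2_commute)
    qed
    also have "\<dots> = 2 * X + 2 * ?D"
      using ui iD by (simp add: X_def)
    finally have 2: "(\<integral>z. indicator S z * (F z)\<^sup>2 \<partial>lborel) \<le> 2 * X + 2 * ?D" .
    \<comment> \<open>Eliminating \<open>I\<close> and \<open>J\<close> gives
      \<open>5/8 * X \<le> A / 16 + 9/8 * Q\<close>, that is
      \<open>X \<le> A / 10 + 9/5 * Q\<close>; this is where 1/10 comes from and why
      \<open>Q < e / 2\<close> suffices.\<close>
    have "X \<le> 1/10 * A + e"
      if "X \<le> I + 1/4 * X + Q" "J \<le> 2 * X + 2 * Q" "I \<le> 1/16 * (A + J)" "Q < e / 2" for I J Q
      using that e by argo
    from this[OF 1 2 main D] show "X \<le> 1/10 * A + e" .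
  qed (use e in auto)
  then have "X \<le> 1/10 * A" by (rule field_le_epsilon)
  then show ?thesis by (simp add: X_def A_def u_def C_def)
qed

text \<open>As the box grows the cutoff tends to 1, so \<open>cutoff_energy\<close> becomes
  \<open>A \<le> A / 10\<close> for the weighted energy \<open>A\<close> of \<open>P\<close>.
  Integrability of the squared weighted \<open>P\<close> makes \<open>A\<close> its true energy, and
  \<open>A = 0\<close> follows.\<close>

lemma P_eq_zero_AE: "AE z in lborel. P (snd z) (fst z) = 0"
proof (rule bump)
  fix c c' c'' :: "real \<Rightarrow> real"
  assume c: "\<And>s. (c has_real_derivative c' s) (at s)" "\<And>s. (c' has_real_derivative c'' s) (at s)"
    "continuous_on UNIV c''" and c0: "c 0 = 1" and c': "\<And>s. \<bar>c s\<bar> \<le> 1" "\<And>s. \<bar>c' s\<bar> \<le> 30" "\<And>s. \<bar>c'' s\<bar> \<le> 30"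
    "\<And>s. \<bar>s\<bar> \<ge> 1 \<Longrightarrow> c s = 0" "\<And>s. \<bar>s\<bar> \<ge> 1 \<Longrightarrow> c' s = 0" "\<And>s. \<bar>s\<bar> \<ge> 1 \<Longrightarrow> c'' s = 0"
  define M \<kappa> lam where "M = real CARD('d) * (30 * b + 30)" and "\<kappa> = 1 / (8 * (real CARD('d) + 1) * M)" and "lam = 1 / \<kappa>\<^sup>2"
  define p where "p z = exp (- lam * fst z) * P (snd z) (fst z)" for z
  define A where "A = (\<integral>z. (p z)\<^sup>2 \<partial>lborel)"
  have lam0: "lam \<ge> 0" by (simp add: lam_def)
  have ip: "integrable lborel (\<lambda>z. (p z)\<^sup>2)" unfolding p_def by (rule integrable_weighted_P[OF lam0])
  define u where "u n z = exp (- lam * fst z) * tens (\<lambda>i s. c (s / real n)) (snd z) * P (snd z) (fst z)" for n z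
  have cc: "continuous_on UNIV c" by (rule DERIV_continuous_on[OF has_field_derivative_at_within[OF c(1)]])
  have "tens (\<lambda>i s. c (s / real n)) \<in> borel_measurable borel" for n
    by (intro borel_measurable_tens measurable_compose[OF _ borel_measurable_continuous_onI[OF cc]]) measurable
  note [measurable] = this L2bdd_measurable[OF P]
  have "(\<lambda>n. \<integral>z. (u n z)\<^sup>2 \<partial>lborel) \<longlonglongrightarrow> A"
    unfolding A_def
  proof (rule integral_dominated_convergence[OF _ _ ip])
    show "AE z in lborel. (\<lambda>n. (u n z)\<^sup>2) \<longlonglongrightarrow> (p z)\<^sup>2"
    proof (rule AE_I2)
      fix z :: "real \<times> (real^'d)"
      have lim1: "(\<lambda>n. c (snd z $ i / real n)) \<longlonglongrightarrow> 1" for i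
      proof -
        have "isCont c 0" using cc by (simp add: continuous_on_eq_continuous_at)
        from isCont_tendsto_compose[OF this lim_const_over_n[of "snd z $ i"]] show ?thesis by (simp add: c0)
      qed
      have "(\<lambda>n. tens (\<lambda>i s. c (s / real n)) (snd z)) \<longlonglongrightarrow> (\<Prod>i\<in>(UNIV::'d set). 1)"
        unfolding tens_def by (rule Limits.tendsto_prod[where L = "\<lambda>i. 1"]) (rule lim1)
      then have "(\<lambda>n. (u n z)\<^sup>2) \<longlonglongrightarrow> (exp (- lam * fst z) * (\<Prod>i\<in>(UNIV::'d set). 1) * P (snd z) (fst z))\<^sup>2"
        unfolding u_def by (intro tendsto_intros)
      then show "(\<lambda>n. (u n z)\<^sup>2) \<longlonglongrightarrow> (p z)\<^sup>2" by (simp add: p_def)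
    qed
    show "AE z in lborel. norm ((u n z)\<^sup>2) \<le> (p z)\<^sup>2" for n
    proof (rule AE_I2)
      fix z :: "real \<times> (real^'d)"
      have "\<bar>tens (\<lambda>i s. c (s / real n)) (snd z)\<bar> \<le> 1" by (intro abs_tens_le_1 c')
      then have "(tens (\<lambda>i s. c (s / real n)) (snd z))\<^sup>2 * (p z)\<^sup>2 \<le> 1 * (p z)\<^sup>2"
        by (intro mult_right_mono) (auto simp: abs_square_le_1)
      then show "norm ((u n z)\<^sup>2) \<le> (p z)\<^sup>2" by (simp add: u_def p_def power_mult_distrib mult_ac)
    qed
  qed (unfold u_def p_def, measurable)
  moreover have "\<forall>\<^sub>F n in sequentially. (\<integral>z. (u n z)\<^sup>2 \<partial>lborel) \<le> 1/10 * A"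
  proof -
    have "\<forall>\<^sub>F n in sequentially. real n \<ge> max 1 \<bar>m0\<bar>"
      by (rule eventually_ge_at_top[THEN filterlim_real_sequentially[unfolded filterlim_iff, rule_format]])
    then show ?thesis
    proof eventually_elim
      case (elim n)
      then show ?case
        unfolding u_def A_def p_def
        by (intro cutoff_energy[OF c c' M_def \<kappa>_def lam_def]) auto
    qed
  qed
  ultimately have "A \<le> 1/10 * A" by (rule tendsto_upperbound) simp
  moreover have "A \<ge> 0" unfolding A_def by (intro Bochner_Integration.integral_nonneg) simp
  ultimately have "A = 0" by simp
  then have "AE z in lborel. (p z)\<^sup>2 = 0"
    unfolding A_def using integral_nonneg_eq_0_iff_AE[OF ip] by simp
  then show ?thesis by (rule eventually_mono) (simp add: p_def)
qed

end

section \<open>The Dirichlet problem solved by the slab integrals\<close>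

text \<open>The claim is read backwards: the sequence on the left contains \<open>f0\<close> but not
  \<open>p\<close>, so any two solutions must share its limit. The contribution of the initial datum
  is thereby compared without ever being evaluated.\<close>

lemma weak_solution_slab_limit:
  fixes i1 :: "'d::finite" and f f' f'' :: "'d \<Rightarrow> real \<Rightarrow> real"
  assumes T0: "0 \<le> T" and Bc: "continuous_on UNIV B" and W: "weak_solution i1 T B f0 p"
    and g: "\<And>s. (g has_real_derivative g' s) (at s)" "\<And>s. (g' has_real_derivative g'' s) (at s)"
    "continuous_on UNIV g''" "\<And>s. 0 \<le> g s \<and> g s \<le> 1" "\<And>s. s \<le> 0 \<Longrightarrow> g s = 1" "\<And>s. s \<ge> 1 \<Longrightarrow> g s = 0"
    "\<And>s. s \<le> 0 \<Longrightarrow> g' s = 0" "\<And>s. s \<ge> 1 \<Longrightarrow> g' s = 0" "\<And>s. \<bar>g' s\<bar> \<le> 9"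
    and f: "\<And>i s. (f i has_real_derivative f' i s) (at s)" "\<And>i s. (f' i has_real_derivative f'' i s) (at s)"
      "\<And>i. continuous_on UNIV (f'' i)"
    and supp: "\<And>i s. \<bar>s\<bar> > R \<Longrightarrow> f i s = 0 \<and> f' i s = 0 \<and> f'' i s = 0"
    and zero: "f i1 m0 = 0" and t: "t \<in> {0<..T}"
  shows "(\<lambda>n. \<integral>y. g (real (Suc n) * (y $ i1 - m0)) * g (- (y $ i1) - R) * tens f y * f0 y \<partial>lborel)
    \<longlonglongrightarrow> (\<integral>x. tens f x * slabP i1 T p m0 x t \<partial>lborel)
       - (\<integral>s. indicator {0<..t} s * (\<integral>x. Lten B f f' f'' x * slabP i1 T p m0 x s \<partial>lborel) \<partial>lborel)"
proof -
  let ?c = "\<lambda>z s. cutp i1 T p (fst z) (snd z) s" and ?L = "Lten B f f' f''"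
  have X: "spaceX i1 T p" using W by (simp add: weak_solution_def)
  note cm = cutp_measurable[OF T0 X]
  have cont: "continuous_on UNIV (f i)" "continuous_on UNIV (f' i)" for i
    by (rule DERIV_continuous_on, rule has_field_derivative_at_within, rule f)+
  have gcont: "continuous_on UNIV g" "continuous_on UNIV g'"
    by (rule DERIV_continuous_on, rule has_field_derivative_at_within, rule g)+
  note [measurable] = borel_measurable_continuous_onI[OF gcont(1)] borel_measurable_continuous_onI[OF gcont(2)]
  define A :: "(real^'d) set" where "A = cbox (\<chi> i. -R) (\<chi> i. R)"
  have A: "compact A" "A \<in> sets borel" "emeasure lborel A < \<infinity>"
    using emeasure_bounded_finite[OF bounded_cbox] by (auto simp: A_def less_top)
  have notA: "\<exists>i. \<bar>x $ i\<bar> > R" if x: "x \<notin> A" for x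
  proof -
    obtain i where "\<not> (- R \<le> x $ i \<and> x $ i \<le> R)" using x by (auto simp: A_def mem_box_cart)
    then have "\<bar>x $ i\<bar> > R" by linarith
    then show ?thesis ..
  qed
  have inA: "- R \<le> x $ i" if "x \<in> A" for x i
    using that by (auto simp: A_def mem_box_cart)
  have tc: "continuous_on UNIV (tens f)" by (rule continuous_on_tens[OF cont(1)])
  have Lc: "continuous_on UNIV (?L)"
    unfolding Lten_def
    by (intro continuous_intros continuous_on_tens Bc) (auto simp: cont f)
  have tz: "tens f x = 0" if x: "x \<notin> A" for x
  proof -
    obtain i where "\<bar>x $ i\<bar> > R" using notA[OF x] by blast
    then show ?thesis by (simp add: tens_split[of _ _ i] supp)
  qed
  have Lz: "?L x = 0" if x: "x \<notin> A" for x
  proof -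
    obtain i where i: "\<bar>x $ i\<bar> > R" using notA[OF x] by blast
    have "tens (f(j := f' j)) x = 0" "tens (f(j := f'' j)) x = 0" for j
      using i by (auto simp: tens_split[of _ _ i] supp)
    then show ?thesis by (simp add: Lten_def)
  qed
  note [measurable] = borel_measurable_continuous_onI[OF tc] borel_measurable_continuous_onI[OF Lc]
  obtain K1 where K1: "K1 \<ge> 0" "\<And>x. \<bar>tens f x\<bar> \<le> K1 * indicator A x"
    using bounded_on_compact_support[OF tc A(1) tz] by blast
  obtain K2 where K2: "K2 \<ge> 0" "\<And>x. \<bar>?L x\<bar> \<le> K2 * indicator A x"
    using bounded_on_compact_support[OF Lc A(1) Lz] by blast
  define G where "G n m = g (real (Suc n) * (m - m0)) * g (- m - R)" for n m
  define G' where "G' n m = real (Suc n) * g' (real (Suc n) * (m - m0)) * g (- m - R)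
     - g (real (Suc n) * (m - m0)) * g' (- m - R)" for n m
  have [measurable]: "G n \<in> borel_measurable borel" "G' n \<in> borel_measurable borel" for n
    unfolding G_def G'_def by measurable
  have G01: "\<bar>G n m\<bar> \<le> 1" for n m
    unfolding G_def abs_mult using g(4) by (intro mult_le_one) auto
  have eventually1: "\<forall>\<^sub>F n in sequentially. real (Suc n) * (m - m0) \<ge> 1" if "m > m0" for m
  proof -
    have "LIM n sequentially. real (Suc n) * (m - m0) :> at_top"
      using that by (intro filterlim_at_top_mult_tendsto_pos[OF tendsto_const]
        filterlim_compose[OF filterlim_real_sequentially filterlim_Suc]) auto
    then show ?thesis by (simp add: filterlim_at_top)
  qed
  have Glim: "(\<lambda>n. G n m) \<longlonglongrightarrow> indicator {..m0} m" if "- R \<le> m" for m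
  proof (cases "m \<le> m0")
    case True
    then have "real (Suc n) * (m - m0) \<le> 0" for n by (simp add: mult_le_0_iff)
    then have "G n m = 1" for n using that unfolding G_def by (simp add: g)
    then show ?thesis using True by simp
  next
    case False
    then have "\<forall>\<^sub>F n in sequentially. G n m = 0"
      using eventually1[of m] by (auto simp: G_def g elim!: eventually_mono)
    then show ?thesis using False by (simp add: tendsto_eventually)
  qed
  \<comment> \<open>\<open>G n m\<close> is known to converge to the indicator only for
    \<open>m \<ge> - R\<close>. Where the product is nonzero, \<open>x\<close> lies in
    \<open>A\<close> and \<open>x^1 \<le> m\<close>, which gives this bound.\<close>
  have lim0: "(\<lambda>n. G n m * h * cutp i1 T p m x s) \<longlonglongrightarrow> indicator {..m0} m * h * cutp i1 T p m x s"
    if "x \<notin> A \<Longrightarrow> h = 0" for m x s h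
  proof (cases "h = 0 \<or> cutp i1 T p m x s = 0")
    case False
    then have "x \<in> A" "x $ i1 \<le> m" using that by (auto simp: cutp_def split: if_splits)
    then have "- R \<le> m" using inA[of x i1] by linarith
    then show ?thesis by (intro tendsto_intros Glim)
  qed auto
  \<comment> \<open>The weak formulation solved for the datum term. The indicator of the time
    interval is moved into the inner integrals to fit
    \<open>iterated_dominated_convergence\<close>.\<close>
  have eqn: "(\<integral>y. g (real (Suc n) * (y $ i1 - m0)) * g (- (y $ i1) - R) * tens f y * f0 y \<partial>lborel)
    = (\<integral>z. G n (fst z) * tens f (snd z) * ?c z t \<partial>lborel)
     - (\<integral>s. \<integral>z. indicator {0<..t} s * (G n (fst z) * ?L (snd z) * ?c z s) \<partial>lborel \<partial>lborel)
     - 1/2 * (\<integral>s. \<integral>y. indicator {0<..t} s * (G' n (y $ i1) * tens f y * trace_p i1 p y s) \<partial>lborel \<partial>lborel)" for n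
  proof (rule smooth_step_scaled[OF g(1-3), of "real (Suc n)" m0 R, folded G_def G'_def])
    fix G''
    assume G1: "\<And>m. (G n has_real_derivative G' n m) (at m)" "\<And>m. (G' n has_real_derivative G'' m) (at m)"
      "continuous_on UNIV G''"
    \<comment> \<open>This support bound is uniform in \<open>n\<close>: as
      \<open>Suc n \<ge> 1\<close>, the upper step has come down to 0 at \<open>m0 + 1\<close> at
      the latest.\<close>
    have Gs: "G n m = 0" if "\<bar>m\<bar> > \<bar>m0\<bar> + \<bar>R\<bar> + 1" for m
    proof (cases "m > 0")
      case True
      then have "m - m0 \<ge> 1" using that by linarith
      then have "1 * 1 \<le> real (Suc n) * (m - m0)" by (intro mult_mono) auto
      then show ?thesis by (simp add: G_def g)
    next
      case False
      then have "- m - R \<ge> 1" using that by linarith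
      then show ?thesis by (simp add: G_def g)
    qed
    show ?thesis
    proof (rule C2c_with_product[OF f G1, where R = R and R' = "\<bar>m0\<bar> + \<bar>R\<bar> + 1"])
      fix \<Phi>' \<Phi>''
      assume C: "C2c_with (\<lambda>z. G n (fst z) * tens f (snd z)) \<Phi>' \<Phi>''"
        and dm: "\<And>m x. dm \<Phi>' (m, x) = G' n m * tens f x"
        and Lop: "\<And>B m x. Lop B \<Phi>' \<Phi>'' (m, x) = G n m * Lten B f f' f'' x"
      have weak: "set_lebesgue_integral lborel (Tdom i1) (\<lambda>z. G n (fst z) * tens f (snd z) * p (fst z) (snd z) t)
        = (\<integral>y. G n (y $ i1) * tens f y * f0 y \<partial>lborel)
          + set_lebesgue_integral lborel {0<..t} (\<lambda>s.
               set_lebesgue_integral lborel (Tdom i1) (\<lambda>z. p (fst z) (snd z) s * Lop B \<Phi>' \<Phi>'' z))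
          + 1/2 * set_lebesgue_integral lborel {0<..t} (\<lambda>s.
               \<integral>y. dm \<Phi>' (y $ i1, y) * trace_p i1 p y s \<partial>lborel)"
        using W C t unfolding weak_solution_def by fastforce
      have 1: "set_lebesgue_integral lborel (Tdom i1) (\<lambda>z. G n (fst z) * tens f (snd z) * p (fst z) (snd z) t)
         = (\<integral>z. G n (fst z) * tens f (snd z) * ?c z t \<partial>lborel)"
        unfolding set_lebesgue_integral_def using t
        by (intro Bochner_Integration.integral_cong) (auto simp: Tdom_def cutp_def indicator_def)
      have "indicator {0<..t} s *\<^sub>R set_lebesgue_integral lborel (Tdom i1) (\<lambda>z. p (fst z) (snd z) s * Lop B \<Phi>' \<Phi>'' z)
         = (\<integral>z. indicator {0<..t} s * (G n (fst z) * ?L (snd z) * ?c z s) \<partial>lborel)" for s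
      proof (cases "s \<in> {0<..t}")
        case True
        then show ?thesis unfolding set_lebesgue_integral_def using t
          by (auto intro!: Bochner_Integration.integral_cong simp: Tdom_def cutp_def indicator_def Lop)
      qed auto
      then have 2: "set_lebesgue_integral lborel {0<..t} (\<lambda>s.
               set_lebesgue_integral lborel (Tdom i1) (\<lambda>z. p (fst z) (snd z) s * Lop B \<Phi>' \<Phi>'' z))
          = (\<integral>s. \<integral>z. indicator {0<..t} s * (G n (fst z) * ?L (snd z) * ?c z s) \<partial>lborel \<partial>lborel)"
        unfolding set_lebesgue_integral_def[of _ "{0<..t}"] by (simp only:)
      have 3: "set_lebesgue_integral lborel {0<..t} (\<lambda>s. \<integral>y. dm \<Phi>' (y $ i1, y) * trace_p i1 p y s \<partial>lborel)
         = (\<integral>s. \<integral>y. indicator {0<..t} s * (G' n (y $ i1) * tens f y * trace_p i1 p y s) \<partial>lborel \<partial>lborel)"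
        unfolding set_lebesgue_integral_def by (simp add: dm)
      show ?thesis using weak unfolding 1 2 3 by (simp add: G_def)
    qed (use supp Gs in auto)
  qed
  have limA: "(\<lambda>n. \<integral>z. G n (fst z) * tens f (snd z) * ?c z t \<partial>lborel)
    \<longlonglongrightarrow> (\<integral>z. indicator {..m0} (fst z) * tens f (snd z) * ?c z t \<partial>lborel)"
  proof (rule integral_dominated_convergence)
    show "integrable lborel (\<lambda>z. K1 * indicator A (snd z) * \<bar>?c z t\<bar>)"
    proof -
      have "integrable lborel (\<lambda>z. (K1 * indicator A (snd z)) * ?c z t)"
        using K1(1) A(2) by (intro integrable_cutp_mult[OF T0 X A(2,3), of _ K1]) (auto simp: abs_mult)
      then have "integrable lborel (\<lambda>z. \<bar>(K1 * indicator A (snd z)) * ?c z t\<bar>)"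
        by (rule integrable_abs)
      then show ?thesis using K1(1) by (simp add: abs_mult)
    qed
    show "AE z in lborel. (\<lambda>n. G n (fst z) * tens f (snd z) * ?c z t)
       \<longlonglongrightarrow> indicator {..m0} (fst z) * tens f (snd z) * ?c z t"
      by (intro AE_I2 lim0 tz)
    show "AE z in lborel. norm (G n (fst z) * tens f (snd z) * ?c z t)
       \<le> K1 * indicator A (snd z) * \<bar>?c z t\<bar>" for n
    proof (rule AE_I2)
      fix z :: "'d pt"
      have "\<bar>G n (fst z)\<bar> * \<bar>tens f (snd z)\<bar> \<le> 1 * (K1 * indicator A (snd z))"
        by (intro mult_mono G01 K1) auto
      from mult_right_mono[OF this abs_ge_zero[of "?c z t"]]
      show "norm (G n (fst z) * tens f (snd z) * ?c z t)
       \<le> K1 * indicator A (snd z) * \<bar>?c z t\<bar>" by (simp add: abs_mult)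
    qed
  qed (use cm in measurable)
  have limB: "(\<lambda>n. \<integral>s. \<integral>z. indicator {0<..t} s * (G n (fst z) * ?L (snd z) * ?c z s) \<partial>lborel \<partial>lborel)
    \<longlonglongrightarrow> (\<integral>s. \<integral>z. indicator {0<..t} s * (indicator {..m0} (fst z) * ?L (snd z) * ?c z s) \<partial>lborel \<partial>lborel)"
  proof (rule iterated_dominated_convergence[OF integrable_cutp_space_time[OF T0 X A(2,3), of K2]])
    fix n and s :: real and z :: "'d pt"
    show "(\<lambda>z. indicator {0<..t} (fst z) * (G n (fst (snd z)) * ?L (snd (snd z)) * cutp i1 T p (fst (snd z)) (snd (snd z)) (fst z)))
         \<in> borel_measurable borel" using cm by measurable
    show "(\<lambda>n. indicator {0<..t} s * (G n (fst z) * ?L (snd z) * ?c z s))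
       \<longlonglongrightarrow> indicator {0<..t} s * (indicator {..m0} (fst z) * ?L (snd z) * ?c z s)"
      by (intro tendsto_mult_left lim0 Lz)
    have "\<bar>G n (fst z)\<bar> * \<bar>?L (snd z)\<bar> \<le> 1 * (K2 * indicator A (snd z))"
      by (intro mult_mono G01 K2) auto
    from mult_right_mono[OF this abs_ge_zero[of "?c z s"]]
    have "\<bar>G n (fst z) * ?L (snd z) * ?c z s\<bar>
       \<le> K2 * (indicator A (snd z) * \<bar>?c z s\<bar>)" by (simp add: abs_mult mult.assoc)
    moreover have "\<bar>indicator {0<..t} s * a\<bar> \<le> \<bar>a\<bar>" for a :: real by (simp add: indicator_def)
    ultimately show "\<bar>indicator {0<..t} s * (G n (fst z) * ?L (snd z) * ?c z s)\<bar>
       \<le> K2 * (indicator A (snd (snd (s, z))) * \<bar>cutp i1 T p (fst (snd (s, z))) (snd (snd (s, z))) (fst (s, z))\<bar>)"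
      unfolding fst_conv snd_conv by (rule order_trans[rotated])
  qed
  text \<open>The trace term vanishes in the limit: on the support of the derivative of the step, which has
    width \<open>1/n\<close>, the factor \<open>f i1\<close> is \<open>O(1/n)\<close> because it vanishes at \<open>m0\<close>.\<close>
  obtain M where M: "M \<ge> 0" "\<And>s. \<bar>f' i1 s\<bar> \<le> M"
  proof -
    have "f' i1 s = 0" if "s \<notin> cbox (- R) R" for s
      using that by (intro supp[THEN conjunct2, THEN conjunct1]) (auto simp: abs_le_iff not_le[symmetric])
    then obtain M where M: "M \<ge> 0" "\<And>s. \<bar>f' i1 s\<bar> \<le> M * indicator (cbox (- R) R) s"
      using bounded_on_compact_support[OF cont(2)[of i1] compact_cbox[of "-R" R]] by blast
    have "\<bar>f' i1 s\<bar> \<le> M" for s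
      using M(1) M(2)[of s] by (cases "s \<in> cbox (-R) R") auto
    then show thesis using that M(1) by blast
  qed
  have lip: "\<bar>f i1 s\<bar> \<le> M * \<bar>s - m0\<bar>" for s
    using field_differentiable_bound[of UNIV "f i1" "f' i1" M s m0] f(1) M(2) zero
    by (auto intro: has_field_derivative_at_within)
  obtain K3 where K3: "K3 \<ge> 0" "\<And>x. x \<in> A \<Longrightarrow> \<bar>\<Prod>j\<in>UNIV - {i1}. f j (x $ j)\<bar> \<le> K3"
  proof -
    have "continuous_on A (\<lambda>x. \<Prod>j\<in>UNIV - {i1}. f j (x $ j))"
      by (intro continuous_on_prod continuous_on_compose2[OF cont(1)] continuous_intros) auto
    then have "bounded ((\<lambda>x. \<Prod>j\<in>UNIV - {i1}. f j (x $ j)) ` A)"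
      using A(1) by (intro compact_imp_bounded compact_continuous_image)
    then obtain a where "\<forall>x\<in>A. \<bar>\<Prod>j\<in>UNIV - {i1}. f j (x $ j)\<bar> \<le> a" by (auto simp: bounded_iff)
    then show thesis using that[of "max 0 a"] by fastforce
  qed
  \<comment> \<open>Over \<open>A\<close> the lower step is constantly 1, so its derivative drops
    out.\<close>
  have G'A: "G' n (y $ i1) * tens f y = real (Suc n) * g' (real (Suc n) * (y $ i1 - m0)) * tens f y" for n y
  proof (cases "y \<in> A")
    case True
    then have "- (y $ i1) - R \<le> 0" using inA[of y i1] by simp
    then show ?thesis by (simp add: G'_def g)
  qed (simp add: tz)
  have Cbound: "\<bar>G' n (y $ i1) * tens f y\<bar> \<le> 9 * M * K3 * indicator A y" for n y
  proof (cases "y \<in> A")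
    case True
    \<comment> \<open>In this rescaled variable the derivative of the step lives on
      \<open>[0, 1]\<close>, so \<open>\<bar>g' s\<bar> * \<bar>s\<bar>\<close> is bounded; the
      factor \<open>Suc n\<close> is absorbed by the distance to \<open>m0\<close>.\<close>
    define s where "s = real (Suc n) * (y $ i1 - m0)"
    have "\<bar>g' s\<bar> * \<bar>s\<bar> \<le> 9"
    proof (cases "s \<le> 0 \<or> s \<ge> 1")
      case False
      then have "\<bar>g' s\<bar> * \<bar>s\<bar> \<le> 9 * 1" by (intro mult_mono g) auto
      then show ?thesis by simp
    qed (auto simp: g)
    moreover have "0 \<le> M * K3" using M K3 by simp
    ultimately have *: "(\<bar>g' s\<bar> * \<bar>s\<bar>) * (M * K3) \<le> 9 * (M * K3)" by (rule mult_right_mono)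
    have "\<bar>tens f y\<bar> \<le> (M * \<bar>y $ i1 - m0\<bar>) * K3"
      unfolding tens_split[of _ _ i1] abs_mult using M by (intro mult_mono lip K3 True) auto
    then have "real (Suc n) * \<bar>g' s\<bar> * \<bar>tens f y\<bar> \<le> real (Suc n) * \<bar>g' s\<bar> * ((M * \<bar>y $ i1 - m0\<bar>) * K3)"
      by (intro mult_left_mono) auto
    also have "\<dots> = (\<bar>g' s\<bar> * \<bar>s\<bar>) * (M * K3)" by (simp add: s_def abs_mult)
    also note *
    finally have "real (Suc n) * \<bar>g' s\<bar> * \<bar>tens f y\<bar> \<le> 9 * (M * K3)" .
    then show ?thesis using True unfolding G'A s_def[symmetric] abs_mult by simp
  qed (simp add: tz)
  \<comment> \<open>The factor in front of the trace is bounded, not uniformly small. The limit is 0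
    because every fixed \<open>y\<close> ends up outside the shrinking layer, with a multiple of the
    trace on \<open>A\<close> as majorant.\<close>
  have limC: "(\<lambda>n. \<integral>s. \<integral>y. indicator {0<..t} s * (G' n (y $ i1) * tens f y * trace_p i1 p y s) \<partial>lborel \<partial>lborel)
    \<longlonglongrightarrow> (\<integral>s. \<integral>y. 0 \<partial>(lborel :: (real^'d) measure) \<partial>(lborel :: real measure))"
  proof (rule iterated_dominated_convergence[OF integrable_trace[OF T0 X A(2,3), of "9 * M * K3"]])
    fix n and s :: real and y :: "real^'d"
    have "(\<lambda>w::real \<times> (real^'d). snd w $ i1) \<in> borel_measurable borel"
      by (intro borel_measurable_continuous_onI continuous_intros)
    then have [measurable]: "(\<lambda>w::real \<times> (real^'d). G' n (snd w $ i1)) \<in> borel_measurable borel"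
      by (rule measurable_compose) measurable
    show "(\<lambda>w. indicator {0<..t} (fst w) * (G' n (snd w $ i1) * tens f (snd w) * trace_p i1 p (snd w) (fst w)))
       \<in> borel_measurable borel" using trace_p_measurable[OF T0 X] by measurable
    show "(\<lambda>n. indicator {0<..t} s * (G' n (y $ i1) * tens f y * trace_p i1 p y s)) \<longlonglongrightarrow> 0"
    proof -
      have "\<forall>\<^sub>F n in sequentially. G' n (y $ i1) * tens f y = 0"
      proof (cases "y $ i1 \<le> m0")
        case True
        then have "real (Suc n) * (y $ i1 - m0) \<le> 0" for n by (simp add: mult_le_0_iff)
        then show ?thesis unfolding G'A by (simp add: g)
      next
        case False
        then show ?thesis using eventually1[of "y $ i1"] unfolding G'A by (auto simp: g elim!: eventually_mono)
      qed
      then have "\<forall>\<^sub>F n in sequentially. indicator {0<..t} s * (G' n (y $ i1) * tens f y * trace_p i1 p y s) = 0"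
        by (rule eventually_mono) simp
      then show ?thesis by (rule tendsto_eventually)
    qed
    have "\<bar>G' n (y $ i1) * tens f y\<bar> * \<bar>trace_p i1 p y s\<bar> \<le> (9 * M * K3 * indicator A y) * \<bar>trace_p i1 p y s\<bar>"
      by (intro mult_right_mono Cbound) simp
    moreover have "(indicator {0<..t} s :: real) \<le> indicator {0<..T} s" using t by (auto simp: indicator_def)
    ultimately have "indicator {0<..t} s * (\<bar>G' n (y $ i1) * tens f y\<bar> * \<bar>trace_p i1 p y s\<bar>)
       \<le> indicator {0<..T} s * ((9 * M * K3 * indicator A y) * \<bar>trace_p i1 p y s\<bar>)"
      by (intro mult_mono[where a = "indicator {0<..t} s"] Cbound mult_right_mono) auto
    then show "\<bar>indicator {0<..t} s * (G' n (y $ i1) * tens f y * trace_p i1 p y s)\<bar>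
       \<le> 9 * M * K3 * (indicator {0<..T} (fst (s, y)) * (indicator A (snd (s, y)) * \<bar>trace_p i1 p (snd (s, y)) (fst (s, y))\<bar>))"
      by (simp add: abs_mult mult_ac)
  qed
  have A': "(\<integral>z. indicator {..m0} (fst z) * tens f (snd z) * ?c z t \<partial>lborel)
     = (\<integral>x. tens f x * slabP i1 T p m0 x t \<partial>lborel)"
    by (rule integral_cutp_slabP[OF T0 X A(2,3) _ K1(2)]) measurable
  have B': "(\<integral>z. indicator {0<..t} s * (indicator {..m0} (fst z) * ?L (snd z) * ?c z s) \<partial>lborel)
     = indicator {0<..t} s * (\<integral>x. ?L x * slabP i1 T p m0 x s \<partial>lborel)" for s
    by (subst integral_mult_right_zero, subst integral_cutp_slabP[OF T0 X A(2,3) _ K2(2)]) auto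
  show ?thesis
    unfolding eqn using tendsto_diff[OF tendsto_diff[OF limA limB] tendsto_mult_left[OF limC, of "1/2"]]
    unfolding A' B' by simp
qed

lemma dirichlet_weak_formulation:
  fixes i1 :: "'d::finite" and f f' f'' :: "'d \<Rightarrow> real \<Rightarrow> real" and m0 T :: real
  defines "P \<equiv> \<lambda>p. slabP i1 T p m0"
  assumes T0: "0 \<le> T" and Bc: "continuous_on UNIV B"
    and W: "weak_solution i1 T B f0 p1" "weak_solution i1 T B f0 p2"
    and f: "\<And>i s. (f i has_real_derivative f' i s) (at s)" "\<And>i s. (f' i has_real_derivative f'' i s) (at s)"
      "\<And>i. continuous_on UNIV (f'' i)"
    and supp: "\<And>i s. \<bar>s\<bar> > R \<Longrightarrow> f i s = 0 \<and> f' i s = 0 \<and> f'' i s = 0"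
    and zero: "f i1 m0 = 0" and t: "t \<in> {0<..T}"
  shows "(\<integral>x. tens f x * P p1 x t \<partial>lborel)
       - (\<integral>s. indicator {0<..t} s * (\<integral>x. Lten B f f' f'' x * P p1 x s \<partial>lborel) \<partial>lborel)
     = (\<integral>x. tens f x * P p2 x t \<partial>lborel)
       - (\<integral>s. indicator {0<..t} s * (\<integral>x. Lten B f f' f'' x * P p2 x s \<partial>lborel) \<partial>lborel)"
proof (rule smooth_step)
  fix g g' g'' :: "real \<Rightarrow> real"
  assume g: "\<And>s. (g has_real_derivative g' s) (at s)" "\<And>s. (g' has_real_derivative g'' s) (at s)"
    "continuous_on UNIV g''" "\<And>s. 0 \<le> g s \<and> g s \<le> 1" "\<And>s. s \<le> 0 \<Longrightarrow> g s = 1" "\<And>s. s \<ge> 1 \<Longrightarrow> g s = 0"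
    "\<And>s. s \<le> 0 \<Longrightarrow> g' s = 0" "\<And>s. s \<ge> 1 \<Longrightarrow> g' s = 0" "\<And>s. \<bar>g' s\<bar> \<le> 9"
  show ?thesis
    unfolding P_def
    by (rule LIMSEQ_unique[OF weak_solution_slab_limit[where f = f and f' = f' and f'' = f'' and g = g and g' = g' and g'' = g'' and ?m0.0 = m0 and R = R, OF T0 Bc W(1) g f supp zero t]
        weak_solution_slab_limit[where f = f and f' = f' and f'' = f'' and g = g and g' = g' and g'' = g'' and ?m0.0 = m0 and R = R, OF T0 Bc W(2) g f supp zero t]])
qed

section \<open>Uniqueness\<close>

text \<open>The constraints \<open>x^1 \<le> m \<le> m0\<close> leave at most the single level
  \<open>m = m0\<close>, a null set.\<close>

lemma slabP_eq_0:
  assumes "m0 \<le> x $ i1" shows "slabP i1 T p m0 x t = 0"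
proof -
  have "AE m in lborel. indicator {..m0} m * cutp i1 T p m x t = 0"
    using AE_lborel_singleton[of m0] by eventually_elim (use assms in \<open>auto simp: cutp_def indicator_def\<close>)
  then show ?thesis unfolding slabP_def by (rule integral_eq_zero_AE)
qed

lemma slabP_unique:
  fixes i1 :: "'d::finite"
  assumes T: "T > 0" and B: "C1b B" and W: "weak_solution i1 T B f0 p1" "weak_solution i1 T B f0 p2"
  shows "AE z in lborel. slabP i1 T p1 m0 (snd z) (fst z) = slabP i1 T p2 m0 (snd z) (fst z)"
proof -
  obtain b where b: "\<And>x. norm (B x) \<le> b" using B unfolding C1b_def bounded_iff by auto
  have Bb: "\<bar>B x $ i\<bar> \<le> b" for x i using component_le_norm_cart[of "B x" i] b[of x] by linarith
  have Bc: "continuous_on UNIV B"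
    using B unfolding C1b_def by (metis continuous_at_imp_continuous_on has_derivative_continuous)
  have T0: "T \<ge> 0" using T by simp
  have X: "spaceX i1 T p1" "spaceX i1 T p2" using W by (auto simp: weak_solution_def)
  define P1 P2 where "P1 = slabP i1 T p1 m0" and "P2 = slabP i1 T p2 m0"
  have L: "L2bdd T P1" "L2bdd T P2" unfolding P1_def P2_def by (rule L2bdd_slabP[OF T0 X(1)], rule L2bdd_slabP[OF T0 X(2)])
  have "AE z in lborel. P1 (snd z) (fst z) - P2 (snd z) (fst z) = 0"
  proof (rule P_eq_zero_AE[OF T L2bdd_diff[OF L] _ Bc Bb])
    show "P1 x t - P2 x t = 0" if "m0 \<le> x $ i1" for x t
      using slabP_eq_0[OF that] by (simp add: P1_def P2_def)
    fix f f' f'' :: "'d \<Rightarrow> real \<Rightarrow> real" and R t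
    assume f: "\<And>i s. (f i has_real_derivative f' i s) (at s)" "\<And>i s. (f' i has_real_derivative f'' i s) (at s)"
      "\<And>i. continuous_on UNIV (f'' i)"
      and supp: "\<And>i s. \<bar>s\<bar> > R \<Longrightarrow> f i s = 0 \<and> f' i s = 0 \<and> f'' i s = 0"
      and zero: "f i1 m0 = 0" and t: "t \<in> {0<..T}"
    let ?A = "cbox (\<chi> i. - R) (\<chi> i. R) :: (real^'d) set" and ?L = "Lten B f f' f''"
    have cont: "continuous_on UNIV (f i)" "continuous_on UNIV (f' i)" for i
      by (rule DERIV_continuous_on, rule has_field_derivative_at_within, rule f)+
    have tc: "continuous_on UNIV (tens f)" by (rule continuous_on_tens[OF cont(1)])
    have Lc: "continuous_on UNIV (?L)"
      unfolding Lten_def by (intro continuous_intros continuous_on_tens Bc) (auto simp: cont f)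
    have z: "tens f x = 0 \<and> ?L x = 0" if x: "x \<notin> ?A" for x
    proof -
      obtain j where "\<not> (- R \<le> x $ j \<and> x $ j \<le> R)" using x by (auto simp: mem_box_cart)
      then have j: "\<bar>x $ j\<bar> > R" by linarith
      have "tens f x = 0" "tens (f(i := f' i)) x = 0" "tens (f(i := f'' i)) x = 0" for i
        using j by (auto simp: tens_split[of _ _ j] supp)
      then show ?thesis by (simp add: Lten_def)
    qed
    \<comment> \<open>Integrability is checked term by term because the integrals of differences are
      split below, and a Bochner integral of a non-integrable function is 0 by convention.\<close>
    have int: "integrable lborel (\<lambda>x. h x * P x s)" "integrable lborel (\<lambda>s. \<integral>x. h x * P x s \<partial>lborel)"
      if P: "L2bdd T P" and h: "continuous_on UNIV h" "\<And>x. x \<notin> ?A \<Longrightarrow> h x = 0" for h P s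
    proof -
      obtain K where K: "\<And>x. \<bar>h x\<bar> \<le> K * indicator ?A x" using bounded_on_compact_support[OF h(1) compact_cbox h(2)] by blast
      have hm: "h \<in> borel_measurable borel" using h(1) by (rule borel_measurable_continuous_onI)
      have "integrable lborel (\<lambda>x. (h x)\<^sup>2)"
        by (rule integrable_square_bounded_support[OF hm _ emeasure_bounded_finite[OF bounded_cbox] K]) simp
      then show "integrable lborel (\<lambda>x. h x * P x s)"
        using hm L2bdd_measurable[OF P, of "\<lambda>x. x" borel "\<lambda>_. s"] L2bdd_integrable(2)[OF P T0] by (intro integrable_mult_L2) auto
      show "integrable lborel (\<lambda>s. \<integral>x. h x * P x s \<partial>lborel)"
        using integral_time_space(3)[OF P T0, of "\<lambda>_. 1", OF _ h(1) compact_cbox h(2)] by simp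
    qed
    note t1 = int(1)[OF L(1) tc z[THEN conjunct1]] and t2 = int(1)[OF L(2) tc z[THEN conjunct1]]
    note l1 = int(1)[OF L(1) Lc z[THEN conjunct2]] and l2 = int(1)[OF L(2) Lc z[THEN conjunct2]]
    note r1 = int(2)[OF L(1) Lc z[THEN conjunct2]] and r2 = int(2)[OF L(2) Lc z[THEN conjunct2]]
    have "(\<integral>x. tens f x * (P1 x t - P2 x t) \<partial>lborel) = (\<integral>x. tens f x * P1 x t \<partial>lborel) - (\<integral>x. tens f x * P2 x t \<partial>lborel)"
      unfolding right_diff_distrib by (rule Bochner_Integration.integral_diff[OF t1 t2])
    also have "\<dots> = (\<integral>s. indicator {0<..t} s * (\<integral>x. ?L x * P1 x s \<partial>lborel) \<partial>lborel)
       - (\<integral>s. indicator {0<..t} s * (\<integral>x. ?L x * P2 x s \<partial>lborel) \<partial>lborel)"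
      using dirichlet_weak_formulation[where f = f and f' = f' and f'' = f'' and ?m0.0 = m0 and R = R, OF T0 Bc W f supp zero t] unfolding P1_def P2_def by simp
    also have "\<dots> = (\<integral>s. indicator {0<..t} s * (\<integral>x. ?L x * P1 x s \<partial>lborel)
       - indicator {0<..t} s * (\<integral>x. ?L x * P2 x s \<partial>lborel) \<partial>lborel)"
      using integrable_mult_indicator[OF _ r1, of "{0<..t}"] integrable_mult_indicator[OF _ r2, of "{0<..t}"] by simp
    also have "\<dots> = (\<integral>s. indicator {0<..t} s * (\<integral>x. ?L x * (P1 x s - P2 x s) \<partial>lborel) \<partial>lborel)"
    proof (rule Bochner_Integration.integral_cong[OF refl])
      fix s
      have "(\<integral>x. ?L x * (P1 x s - P2 x s) \<partial>lborel)
        = (\<integral>x. ?L x * P1 x s \<partial>lborel) - (\<integral>x. ?L x * P2 x s \<partial>lborel)"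
        unfolding right_diff_distrib by (rule Bochner_Integration.integral_diff[OF l1 l2])
      then show "indicator {0<..t} s * (\<integral>x. ?L x * P1 x s \<partial>lborel)
         - indicator {0<..t} s * (\<integral>x. ?L x * P2 x s \<partial>lborel)
        = indicator {0<..t} s * (\<integral>x. ?L x * (P1 x s - P2 x s) \<partial>lborel)"
        by (simp only: right_diff_distrib)
    qed
    finally show "(\<integral>x. tens f x * (P1 x t - P2 x t) \<partial>lborel)
      = (\<integral>s. indicator {0<..t} s * (\<integral>x. ?L x * (P1 x s - P2 x s) \<partial>lborel) \<partial>lborel)" .
  qed
  then show ?thesis by (simp add: P1_def P2_def)
qed

section \<open>From slab integrals back to the densities\<close>

lemma AE_integrable_cutp:
  assumes T: "0 \<le> T" and X: "spaceX i1 T p"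
  shows "AE z in lborel. integrable lborel (\<lambda>m. cutp i1 T p m (snd z) (fst z))"
proof (rule cutp_L2[OF T X])
  fix C :: real
  assume C: "C \<ge> 0" "\<And>t. (\<integral>\<^sup>+ x. (\<integral>\<^sup>+ m. ennreal \<bar>cutp i1 T p m x t\<bar> \<partial>lborel)\<^sup>2 \<partial>lborel) \<le> ennreal C"
  note [measurable] = cutp_measurable[OF T X]
  let ?N = "\<lambda>x t. \<integral>\<^sup>+ m. ennreal \<bar>cutp i1 T p m x t\<bar> \<partial>lborel"
  have Nm [measurable]: "(\<lambda>z. ?N (snd z) (fst z)) \<in> borel_measurable (lborel \<Otimes>\<^sub>M lborel)"
    by measurable
  have "(\<integral>\<^sup>+ z. (?N (snd z) (fst z))\<^sup>2 \<partial>(lborel \<Otimes>\<^sub>M lborel)) = (\<integral>\<^sup>+ t. \<integral>\<^sup>+ x. (?N x t)\<^sup>2 \<partial>lborel \<partial>lborel)"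
    by (subst lborel.nn_integral_fst[symmetric]) auto
  also have "\<dots> \<le> (\<integral>\<^sup>+ t. ennreal C * indicator {0<..T} t \<partial>lborel)"
  proof (intro nn_integral_mono)
    fix t show "(\<integral>\<^sup>+ x. (?N x t)\<^sup>2 \<partial>lborel) \<le> ennreal C * indicator {0<..T} t"
    proof (cases "t \<in> {0<..T}")
      case False
      then have "cutp i1 T p m x t = 0" for m x by (auto simp: cutp_def)
      then show ?thesis by simp
    qed (use C in simp)
  qed
  also have "\<dots> < \<infinity>" by (simp add: nn_integral_cmult ennreal_mult_less_top T)
  finally have "AE z in lborel \<Otimes>\<^sub>M lborel. (?N (snd z) (fst z))\<^sup>2 \<noteq> \<infinity>"
    by (intro nn_integral_PInf_AE) auto
  then have "AE z in lborel. (?N (snd z) (fst z))\<^sup>2 \<noteq> \<infinity>" unfolding lborel_prod .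
  then show ?thesis
  proof (rule eventually_mono)
    fix z :: "real \<times> (real^'a)"
    assume "(?N (snd z) (fst z))\<^sup>2 \<noteq> \<infinity>"
    then have "?N (snd z) (fst z) < \<infinity>" by (auto simp: power2_eq_square less_top ennreal_mult_eq_top_iff)
    then show "integrable lborel (\<lambda>m. cutp i1 T p m (snd z) (fst z))"
      by (intro integrableI_bounded) auto
  qed
qed

text \<open>Levels are rational because each level comes with its own exceptional null set and only
  countably many can be united. Approximation from the right extends the hypothesis to all levels;
  then the positive and negative parts of \<open>f\<close> are densities of measures that agree on
  half-lines, hence of equal measures.\<close>

lemma AE_zero_if_cumulative_zero:
  fixes f :: "real \<Rightarrow> real"
  assumes f: "integrable lborel f" and zero: "\<And>q. q \<in> \<rat> \<Longrightarrow> (\<integral>m. indicator {..q} m * f m \<partial>lborel) = 0"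
  shows "AE m in lborel. f m = 0"
proof -
  have [measurable]: "f \<in> borel_measurable borel" using f by auto
  have fi: "integrable lborel (\<lambda>m. indicator A m * f m)" "integrable lborel (\<lambda>m. indicator A m * max 0 (f m))"
    "integrable lborel (\<lambda>m. indicator A m * max 0 (- f m))" if "A \<in> sets borel" for A
    using integrable_mult_indicator[of A lborel f] integrable_mult_indicator[of A lborel "\<lambda>m. max 0 (f m)"]
      integrable_mult_indicator[of A lborel "\<lambda>m. max 0 (- f m)"] f that by auto
  have all: "(\<integral>m. indicator {..y} m * f m \<partial>lborel) = 0" for y
  proof -
    have "\<exists>r\<in>\<rat>. y < r \<and> r < y + 1 / real (Suc n)" for n
      by (rule Rats_dense_in_real) simp
    then obtain r where r: "\<And>n. r n \<in> \<rat>" "\<And>n. y < r n" "\<And>n. r n < y + 1 / real (Suc n)" by metis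
    have "(\<lambda>n. \<integral>m. indicator {..r n} m * f m \<partial>lborel) \<longlonglongrightarrow> (\<integral>m. indicator {..y} m * f m \<partial>lborel)"
    proof (rule integral_dominated_convergence)
      show "integrable lborel (\<lambda>m. \<bar>f m\<bar>)" using f by simp
      show "AE m in lborel. (\<lambda>n. indicator {..r n} m * f m) \<longlonglongrightarrow> indicator {..y} m * f m"
      proof (rule AE_I2)
        fix m
        show "(\<lambda>n. indicator {..r n} m * f m) \<longlonglongrightarrow> indicator {..y} m * f m"
        proof (cases "m \<le> y")
          case True
          then have "m \<le> r n" for n using r(2)[of n] by simp
          then show ?thesis using True by simp
        next
          case False
          have "(\<lambda>n. y + 1 / real (Suc n)) \<longlonglongrightarrow> y + 0"
            by (intro tendsto_intros LIMSEQ_Suc[OF lim_const_over_n])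
          then have "\<forall>\<^sub>F n in sequentially. y + 1 / real (Suc n) < m"
            using False by (intro order_tendstoD(2)[of _ "y + 0"]) auto
          then have "\<forall>\<^sub>F n in sequentially. indicator {..r n} m * f m = 0"
          proof eventually_elim
            case (elim n) then show ?case using r(3)[of n] by (simp add: indicator_def)
          qed
          then show ?thesis using False by (simp add: tendsto_eventually)
        qed
      qed
      show "AE m in lborel. norm (indicator {..r n} m * f m) \<le> \<bar>f m\<bar>" for n
        by (rule AE_I2) (auto simp: indicator_def)
    qed measurable
    then show ?thesis using zero[OF r(1)] by (simp add: LIMSEQ_const_iff)
  qed
  have total: "(\<integral>m. f m \<partial>lborel) = 0"
  proof -
    have "(\<lambda>n. \<integral>m. indicator {..real n} m * f m \<partial>lborel) \<longlonglongrightarrow> (\<integral>m. f m \<partial>lborel)"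
    proof (rule integral_dominated_convergence)
      show "integrable lborel (\<lambda>m. \<bar>f m\<bar>)" using f by simp
      show "AE m in lborel. (\<lambda>n. indicator {..real n} m * f m) \<longlonglongrightarrow> f m"
      proof (rule AE_I2)
        fix m
        have "\<forall>\<^sub>F n in sequentially. real n \<ge> m"
          by (rule eventually_ge_at_top[THEN filterlim_real_sequentially[unfolded filterlim_iff, rule_format]])
        then have "\<forall>\<^sub>F n in sequentially. indicator {..real n} m * f m = f m"
          by eventually_elim simp
        then show "(\<lambda>n. indicator {..real n} m * f m) \<longlonglongrightarrow> f m" by (rule tendsto_eventually)
      qed
      show "AE m in lborel. norm (indicator {..real n} m * f m) \<le> \<bar>f m\<bar>" for n
        by (rule AE_I2) (auto simp: indicator_def)
    qed measurable
    then show ?thesis using all by (simp add: LIMSEQ_const_iff)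
  qed
  \<comment> \<open>\<open>measure_eqI_lessThan\<close> compares measures on open upper half-lines,
    whereas the hypothesis concerns lower ones; \<open>total\<close> converts one into the
    other.\<close>
  have tail: "(\<integral>m. indicator {y<..} m * max 0 (f m) \<partial>lborel) = (\<integral>m. indicator {y<..} m * max 0 (- f m) \<partial>lborel)" for y
  proof -
    have "(\<integral>m. indicator {y<..} m * max 0 (f m) \<partial>lborel) - (\<integral>m. indicator {y<..} m * max 0 (- f m) \<partial>lborel)
      = (\<integral>m. indicator {y<..} m * max 0 (f m) - indicator {y<..} m * max 0 (- f m) \<partial>lborel)"
      by (rule Bochner_Integration.integral_diff[symmetric]) (auto intro!: fi)
    also have "\<dots> = (\<integral>m. f m - indicator {..y} m * f m \<partial>lborel)"
      by (intro Bochner_Integration.integral_cong refl) (auto simp: indicator_def max_def)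
    also have "\<dots> = 0"
      using f fi(1)[of "{..y}"] all[of y] total by simp
    finally show ?thesis by simp
  qed
  have em: "emeasure (density lborel (\<lambda>m. ennreal (g m))) {y<..} = ennreal (\<integral>m. indicator {y<..} m * max 0 (g m) \<partial>lborel)"
    if [measurable]: "g \<in> borel_measurable borel" and "integrable lborel (\<lambda>m. indicator {y<..} m * max 0 (g m))" for g :: "real \<Rightarrow> real" and y
  proof -
    have "emeasure (density lborel (\<lambda>m. ennreal (g m))) {y<..} = (\<integral>\<^sup>+ m. ennreal (indicator {y<..} m * max 0 (g m)) \<partial>lborel)"
      by (subst emeasure_density) (auto intro!: nn_integral_cong simp: indicator_def max_def ennreal_neg)
    also have "\<dots> = ennreal (\<integral>m. indicator {y<..} m * max 0 (g m) \<partial>lborel)"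
      using that by (intro nn_integral_eq_integral) auto
    finally show ?thesis .
  qed
  \<comment> \<open>\<open>ennreal\<close> sends negative numbers to 0, so these are the densities
    given by the positive and the negative part of \<open>f\<close>.\<close>
  have "density lborel (\<lambda>m. ennreal (f m)) = density lborel (\<lambda>m. ennreal (- f m))"
    by (rule measure_eqI_lessThan) (auto simp: em fi tail)
  then have "AE m in lborel. ennreal (f m) = ennreal (- f m)"
    by (intro sigma_finite_measure.density_unique[OF sigma_finite_lborel]) auto
  then show ?thesis
  proof eventually_elim
    case (elim m)
    then show ?case by (cases "f m" "0 :: real" rule: linorder_cases) (auto simp: ennreal_neg ennreal_eq_0_iff)
  qed
qed

theorem theorem2:
  fixes i1 :: "'d::finite"
    and T :: real
    and B :: "real^'d \<Rightarrow> real^'d"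
    and f0 :: "real^'d \<Rightarrow> real"
    and p1 p2 :: "real \<Rightarrow> real^'d \<Rightarrow> real \<Rightarrow> real"
  assumes "T > 0"
    and "C1b B"
    and "integrable lborel f0"
    and "integrable lborel (\<lambda>y. (f0 y)\<^sup>2)"
    and "weak_solution i1 T B f0 p1"
    and "weak_solution i1 T B f0 p2"
  shows "AE (m, x, t) in lborel. 0 < t \<and> t \<le> T \<and> x $ i1 \<le> m \<longrightarrow> p1 m x t = p2 m x t"
proof -
  have T0: "T \<ge> 0" using assms by simp
  have X: "spaceX i1 T p1" "spaceX i1 T p2" using assms by (auto simp: weak_solution_def)
  note [measurable] = cutp_measurable[OF T0 X(1)] cutp_measurable[OF T0 X(2)]
  let ?q1 = "cutp i1 T p1" and ?q2 = "cutp i1 T p2"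
  let ?d = "\<lambda>m z. ?q1 m (snd z) (fst z) - ?q2 m (snd z) (fst z)"
  have "AE z in lborel. \<forall>q\<in>\<rat>. slabP i1 T p1 q (snd z) (fst z) = slabP i1 T p2 q (snd z) (fst z)"
    by (subst AE_ball_countable[OF countable_rat]) (intro ballI slabP_unique[OF assms(1,2,5,6)])
  then have "AE z in lborel. AE m in lborel. ?q1 m (snd z) (fst z) = ?q2 m (snd z) (fst z)"
    using AE_integrable_cutp[OF T0 X(1)] AE_integrable_cutp[OF T0 X(2)]
  proof eventually_elim
    case (elim z)
    have ind: "integrable lborel (\<lambda>m. indicator {..q} m * ?q1 m (snd z) (fst z))"
       "integrable lborel (\<lambda>m. indicator {..q} m * ?q2 m (snd z) (fst z))" for q
      using integrable_mult_indicator[OF _ elim(2), of "{..q}"] integrable_mult_indicator[OF _ elim(3), of "{..q}"] by auto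
    have "AE m in lborel. ?d m z = 0"
    proof (rule AE_zero_if_cumulative_zero)
      show "integrable lborel (\<lambda>m. ?d m z)" using elim(2,3) by simp
      fix q :: real assume "q \<in> \<rat>"
      then have "slabP i1 T p1 q (snd z) (fst z) = slabP i1 T p2 q (snd z) (fst z)" using elim(1) by blast
      then show "(\<integral>m. indicator {..q} m * ?d m z \<partial>lborel) = 0"
        unfolding right_diff_distrib Bochner_Integration.integral_diff[OF ind] by (simp add: slabP_def)
    qed
    then show ?case by simp
  qed
  then have zero: "AE z in lborel. (\<integral>\<^sup>+ m. ennreal \<bar>?d m z\<bar> \<partial>lborel) = 0"
  proof (rule eventually_mono)
    fix z :: "real \<times> (real^'d)"
    assume "AE m in lborel. ?q1 m (snd z) (fst z) = ?q2 m (snd z) (fst z)"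
    then have "AE m in lborel. ennreal \<bar>?d m z\<bar> = 0" by eventually_elim simp
    then show "(\<integral>\<^sup>+ m. ennreal \<bar>?d m z\<bar> \<partial>lborel) = 0"
      using nn_integral_cong_AE by fastforce
  qed
  \<comment> \<open>So far the null set is described by fibres: almost every \<open>(t, x)\<close>,
    then almost every \<open>m\<close>. The claim concerns triples in the order
    \<open>(m, x, t)\<close>, and Tonelli for the integral of the absolute difference carries the
    result over.\<close>
  define g where "g x t = (\<integral>\<^sup>+ m. ennreal \<bar>?q1 m x t - ?q2 m x t\<bar> \<partial>lborel)" for x t
  have gm: "(\<lambda>(x, t). g x t) \<in> borel_measurable (lborel \<Otimes>\<^sub>M lborel)"
    unfolding g_def by measurable
  have "(\<integral>\<^sup>+ w. ennreal \<bar>?q1 (fst w) (fst (snd w)) (snd (snd w)) - ?q2 (fst w) (fst (snd w)) (snd (snd w))\<bar> \<partial>lborel)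
    = (\<integral>\<^sup>+ v. g (fst v) (snd v) \<partial>lborel)"
    unfolding g_def by (subst lborel_prod[symmetric], subst lborel_pair.nn_integral_snd[symmetric]) auto
  also have "\<dots> = (\<integral>\<^sup>+ x. \<integral>\<^sup>+ t. g x t \<partial>lborel \<partial>lborel)"
    using lborel.nn_integral_fst[OF gm] by (simp add: lborel_prod split_beta')
  also have "\<dots> = (\<integral>\<^sup>+ t. \<integral>\<^sup>+ x. g x t \<partial>lborel \<partial>lborel)"
    by (rule lborel_pair.Fubini'[OF gm, symmetric])
  also have "\<dots> = (\<integral>\<^sup>+ z. g (snd z) (fst z) \<partial>lborel)"
  proof -
    have "(\<lambda>z. g (snd z) (fst z)) \<in> borel_measurable (lborel \<Otimes>\<^sub>M lborel)" unfolding g_def by measurable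
    from lborel.nn_integral_fst[OF this] show ?thesis by (simp add: lborel_prod)
  qed
  also have "\<dots> = (\<integral>\<^sup>+ z. 0 \<partial>(lborel :: (real \<times> (real^'d)) measure))"
    unfolding g_def by (rule nn_integral_cong_AE[OF zero])
  finally have "(\<integral>\<^sup>+ w. ennreal \<bar>?q1 (fst w) (fst (snd w)) (snd (snd w)) - ?q2 (fst w) (fst (snd w)) (snd (snd w))\<bar> \<partial>lborel) = 0"
    by simp
  then have "AE w in lborel. ennreal \<bar>?q1 (fst w) (fst (snd w)) (snd (snd w)) - ?q2 (fst w) (fst (snd w)) (snd (snd w))\<bar> = 0"
    by (rule iffD1[OF nn_integral_0_iff_AE, rotated]) measurable
  then show ?thesis
    by (rule eventually_mono) (auto simp: cutp_def)
qed

end
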